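(* Let $r\ge 1$ be an integer. A set $A\subseteq\mathbb{F}_2^r\setminus\{0\}$ with $|A|>\frac{11}{36}\,2^r+3$ is a minimal $1$-saturating set if and only if there are a maximal sum-free set $S\subseteq\mathbb{F}_2^r$ and an element $s\in S\cup\{0\}$ such that $A=\big(s+(S\cup\{0\})\big)\setminus\{0\}$.
   Context: $\mathbb{F}_2^r$ denotes the elementary abelian $2$-group of rank $r$. For $X\subseteq\mathbb{F}_2^r$, $2X:=\{x_1+x_2\colon x_1,x_2\in X\}$ (with $x_1=x_2$ allowed), and for $g\in\mathbb{F}_2^r$, $g+X:=\{g+x\colon x\in X\}$. A set $A\subseteq\mathbb{F}_2^r\setminus\{0\}$ is $1$-saturating if $A\cup 2A=\mathbb{F}_2^r$; it is a minimal $1$-saturating set if it is $1$-saturating and no proper subset of it is $1$-saturating. A set $S\subseteq\mathbb{F}_2^r$ is sum-free if $S\cap 2S=\varnothing$; it is maximal sum-free if it is sum-free and not properly contained in another sum-free subset of $\mathbb{F}_2^r$. *)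

theory Defs
  imports "HOL-Analysis.Finite_Cartesian_Product" "HOL-Library.Z2" "HOL-Library.Set_Algebras"
begin

text \<open>
  The group \<open>\<F>\<^sub>2\<^sup>r\<close> is the type \<^typ>\<open>bit ^ 'r\<close>, with \<open>r = CARD('r) \<ge> 1\<close>.
  The sumset \<open>2X\<close> is \<open>X + X\<close> and the translate \<open>g + X\<close> is \<open>g +o X\<close>,
  both from \<^theory>\<open>HOL-Library.Set_Algebras\<close>.
\<close>

definition one_saturating :: "'a::ab_group_add set \<Rightarrow> bool" where
  "one_saturating A \<longleftrightarrow> A \<subseteq> UNIV - {0} \<and> A \<union> (A + A) = UNIV"

definition minimal_one_saturating :: "'a::ab_group_add set \<Rightarrow> bool" where
  "minimal_one_saturating A \<longleftrightarrow> one_saturating A \<and> (\<forall>B. B \<subset> A \<longrightarrow> \<not> one_saturating B)"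

definition sum_free :: "'a::ab_group_add set \<Rightarrow> bool" where
  "sum_free S \<longleftrightarrow> S \<inter> (S + S) = {}"

definition maximal_sum_free :: "'a::ab_group_add set \<Rightarrow> bool" where
  "maximal_sum_free S \<longleftrightarrow> sum_free S \<and> (\<forall>T. S \<subset> T \<longrightarrow> \<not> sum_free T)"

end

theory Submission
  imports Defs
begin

text \<open>
  Let \<open>B = A \<union> {0}\<close> and join \<open>x, y \<in> B\<close> by an edge when \<open>x + y\<close> has no other representation as a
  sum of two elements of \<open>B\<close>. For a minimal \<open>1\<close>-saturating set every nonzero vertex lies on an edge,
  and the sets on the right-hand side of the theorem are those for which all edges pass through one
  vertex \<open>s\<close>.

  Suppose the graph is not a star. The set \<open>U\<close> of edge sums is sum-free and has more than an eighth
  of all elements, and this leaves two cases for its shortest odd relation. If there is none, \<open>U\<close>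
  avoids a hyperplane \<open>H\<close> and the graph is bipartite between \<open>B - H\<close> and \<open>B \<inter> H\<close>. Two disjoint edges
  then give a period \<open>d\<close>, the sum of their four ends, such that the \<open>d\<close>-closures of the two sides
  almost complement each other; counting edge sums against the small gap between them is
  contradictory.

  Otherwise five elements of \<open>U\<close> sum to \<open>0\<close>. They form a set \<open>T\<close> which spans a group \<open>K\<close> of order 16
  and generates the Clebsch graph on it. Most cosets of \<open>K\<close> meet \<open>B\<close> in a neighbourhood \<open>z + T\<close>, the
  largest possible intersection. The centres \<open>z\<close> fill most of one coset of a complement of \<open>K\<close>, and
  comparing the positions of the other ends of edges at the points of \<open>z + T\<close> shows that the graph is
  a star after all.
\<close>

section \<open>Unique representations\<close>

text \<open>Write N for the order of the group. Almost every estimate rests on one fact: if u is an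
  edge sum, then B and its translate by u share only two points. Translates of B, or of sets of edge
  sums, are therefore nearly disjoint, and their densities add up to at most 1.

  The critical densities are 1/4 (an edge sum that is the sum of two others; two vertices covering
  all edges in the bipartite case), 3/10 (three or more vertices carrying leaves) and 11/36. The
  last arises twice. In the Clebsch case a coset of K not filled by a neighbourhood holds at most 4
  of its 16 points, once five vertices are deleted; as 11/36 = (4 + 8/9)/16, about 8/9 of the cosets
  are filled. In the hyperplane case 36|B| > 11N + 144 reads 9(2|B| - N/2) > N + 72, and 9 is the
  coefficient at which the leading terms of the final inequality cancel.

  The vertex 0 may lie on no edge, since minimality says nothing about it; it is carried along as an
  exception and contributes to the additive constants.\<close>

class char2 = ab_group_add +
  assumes self_add [simp]: "x + x = 0"
begin

lemma self_add_left [simp]: "x + (x + y) = y"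
  by (simp flip: add.assoc)

lemma add_eq_iff: "x + y = z \<longleftrightarrow> x = z + y"
  by (metis add.assoc add.right_neutral self_add)

lemma add_eq_0_iff_char2 [simp]: "x + y = 0 \<longleftrightarrow> x = y"
  by (simp add: add_eq_iff)

end

instance bit :: char2
proof
  fix x :: bit show "x + x = 0" by (cases x) simp_all
qed

instance vec :: (char2, finite) char2
  by standard (simp add: vec_eq_iff)

text \<open>In characteristic 2 this is the translate of S by d. The preimage form reduces
  membership to membership of a single sum.\<close>

definition tr :: "'a::plus \<Rightarrow> 'a set \<Rightarrow> 'a set" where
  "tr d S = {x. x + d \<in> S}"

lemma mem_tr [simp]: "x \<in> tr d S \<longleftrightarrow> x + d \<in> S"
  by (simp add: tr_def)

lemma tr_eq_image: "tr d S = (\<lambda>x. x + d) ` (S :: 'a::char2 set)"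
proof
  show "tr d S \<subseteq> (\<lambda>x. x + d) ` S"
  proof
    fix x assume "x \<in> tr d S"
    then have "(x + d) + d \<in> (\<lambda>x. x + d) ` S" by simp
    then show "x \<in> (\<lambda>x. x + d) ` S" by (simp only: add.assoc self_add add_0_right)
  qed
qed (auto simp: add.assoc)

lemma card_tr [simp]: "card (tr d (S :: 'a::char2 set)) = card S"
  by (simp add: tr_eq_image card_image)

text \<open>A representation of x + y through z has x + y + z as its other summand, so the last
  clause is uniqueness of the representation. Loops are excluded because 0 is represented by every
  element.\<close>

definition edge :: "'a::ab_group_add set \<Rightarrow> 'a \<Rightarrow> 'a \<Rightarrow> bool" where
  "edge B x y \<longleftrightarrow> x \<in> B \<and> y \<in> B \<and> x \<noteq> y \<and> (\<forall>z\<in>B. x + y + z \<in> B \<longrightarrow> z = x \<or> z = y)"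

definition edge_sums :: "'a::ab_group_add set \<Rightarrow> 'a set" where
  "edge_sums B = {x + y | x y. edge B x y}"

lemma edge_sym: "edge B x y \<Longrightarrow> edge B y x"
  by (auto simp: edge_def add.commute)

lemma edgeD:
  assumes "edge B x y"
  shows "x \<in> B" "y \<in> B" "x \<noteq> y"
  using assms by (auto simp: edge_def)

lemma edge_owner:
  assumes "edge B x y" "z \<in> B" "x + y + z \<in> B"
  shows "z = x \<or> z = y"
  using assms by (auto simp: edge_def)

lemma edge_same_sum:
  fixes B :: "'a::char2 set"
  assumes "edge B x y" "z \<in> B" "w \<in> B" "x + y = z + w"
  shows "x = z \<and> y = w \<or> x = w \<and> y = z"
proof -
  have "x + y + z = w" by (simp add: assms(4) ac_simps)
  then have "z = x \<or> z = y" using edge_owner[OF assms(1,2)] assms(3) by simp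
  then show ?thesis using assms(4) by (auto simp: ac_simps)
qed

lemma edge_sums_I: "edge B x y \<Longrightarrow> x + y \<in> edge_sums B"
  by (auto simp: edge_sums_def)

lemma edge_sums_E:
  assumes "v \<in> edge_sums B" obtains x y where "edge B x y" "v = x + y"
  using assms by (auto simp: edge_sums_def)

lemma edge_sums_nonzero: "(v::'a::char2) \<in> edge_sums B \<Longrightarrow> v \<noteq> 0"
  by (auto simp: edge_sums_def dest: edgeD)

lemma edge_Int:
  fixes B :: "'a::char2 set"
  assumes "edge B x y"
  shows "B \<inter> tr (x + y) B = {x, y}"
proof -
  have "z = x \<or> z = y" if "z \<in> B" "z + (x + y) \<in> B" for z
    using edge_owner[OF assms that(1)] that(2) by (simp add: ac_simps)
  then show ?thesis using edgeD[OF assms] by (fastforce simp: ac_simps)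
qed

lemma card_edge_sums_Int:
  fixes B :: "'a::char2 set"
  assumes "u \<in> edge_sums B"
  shows "card (B \<inter> tr u B) = 2"
proof -
  obtain x y where "edge B x y" "u = x + y" using assms by (rule edge_sums_E)
  then show ?thesis using edge_Int[of B x y] edgeD(3)[of B x y] by simp
qed

lemma card_Un_Int_eq: "finite A \<Longrightarrow> finite B \<Longrightarrow> card (A \<union> B) + card (A \<inter> B) = card A + card B"
  by (metis card_Un_Int)

text \<open>Here B is A with 0 adjoined, and z0 is 0, the one vertex that minimality does not force
  onto an edge. The constant 144 is 36 * 3 plus 36 for the adjoined element.\<close>

locale edge_cover =
  fixes B :: "'a::{char2,finite} set" and z0 :: 'a
  assumes size: "36 * card B > 11 * CARD('a) + 144"
    and covered: "\<And>x. x \<in> B \<Longrightarrow> x \<noteq> z0 \<Longrightarrow> \<exists>y. edge B x y"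
begin

abbreviation "U \<equiv> edge_sums B"

text \<open>If u + v = w, then the translates of B by 0, u, v, w pairwise share just two points. The
  six overlaps cost 12 in all, so 4|B| - 12 \<le> N, against the size hypothesis.\<close>

lemma sum_free_U:
  assumes "u \<in> U" "v \<in> U" "w \<in> U"
  shows "u + v \<noteq> w"
proof
  assume w: "u + v = w"
  let ?t = "\<lambda>d. tr d B"
  let ?C = "B \<union> ?t u"
  have two: "card (B \<inter> ?t u) = 2" "card (B \<inter> ?t v) = 2" "card (B \<inter> ?t w) = 2"
    using assms card_edge_sums_Int by blast+
  have shift: "card (?t u \<inter> ?t s) = card (B \<inter> ?t (u + s))" for s
  proof -
    have "?t u \<inter> ?t s = tr u (B \<inter> ?t (u + s))"
      by (auto simp: ac_simps)
    then show ?thesis by simp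
  qed
  have C: "card ?C + 2 = 2 * card B"
    using card_Un_Int_eq[of B "?t u"] two by simp
  have "?C \<inter> tr v ?C \<subseteq> (B \<inter> ?t v) \<union> (B \<inter> ?t w) \<union> (?t u \<inter> ?t v) \<union> (?t u \<inter> ?t w)"
    using w by (auto simp: ac_simps)
  then have "card (?C \<inter> tr v ?C)
      \<le> card ((B \<inter> ?t v) \<union> (B \<inter> ?t w) \<union> (?t u \<inter> ?t v) \<union> (?t u \<inter> ?t w))"
    by (intro card_mono) auto
  also have "\<dots> \<le> card (B \<inter> ?t v) + card (B \<inter> ?t w) + card (?t u \<inter> ?t v) + card (?t u \<inter> ?t w)"
    by (intro order_trans[OF card_Un_le] add_right_mono) simp
  also have "\<dots> = 8"
  proof -
    have "u + w = v" unfolding w[symmetric] by simp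
    then show ?thesis using two shift[of v] shift[of w] w by simp
  qed
  finally have "card (?C \<inter> tr v ?C) \<le> 8" .
  moreover have "card (?C \<union> tr v ?C) \<le> CARD('a)" by (intro card_mono) auto
  ultimately have "4 * card B \<le> CARD('a) + 12"
    using card_Un_Int_eq[of ?C "tr v ?C"] C by simp
  then show False using size by linarith
qed

end

section \<open>Packing around two disjoint edges\<close>

lemma card_disjoint4:
  fixes A1 :: "'a::finite set"
  assumes "A1 \<inter> A2 = {}" "A1 \<inter> A3 = {}" "A1 \<inter> A4 = {}" "A2 \<inter> A3 = {}" "A2 \<inter> A4 = {}" "A3 \<inter> A4 = {}"
  shows "card A1 + card A2 + card A3 + card A4 \<le> CARD('a)"
proof -
  have "card (A1 \<union> A2 \<union> A3 \<union> A4) = card A1 + card A2 + card A3 + card A4"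
    using assms by (simp add: card_Un_disjoint Int_Un_distrib2)
  moreover have "card (A1 \<union> A2 \<union> A3 \<union> A4) \<le> CARD('a)" by (intro card_mono) auto
  ultimately show ?thesis by simp
qed

context edge_cover
begin

text \<open>Adding d exchanges the edge sums a + b and c + e, so sum-freeness keeps the translates
  of \<open>W\<close> by a and by b disjoint. Packing them with \<open>P\<close> and a + b +
  \<open>P\<close>, and then the translates of \<open>V2\<close> with \<open>Q\<close> and a + b +
  \<open>Q\<close> (which overlap in at most eight points), gives two inequalities whose sum is
  twice the claim. The hypotheses on V hold when its sums come from edges that end neither at a nor
  at b.\<close>

lemma disjoint_edges_bound:
  assumes ab: "edge B a b" and ce: "edge B c e" and disj: "{a, b} \<inter> {c, e} = {}"
    and V: "V \<subseteq> U" and Va: "\<And>x. x \<in> B \<Longrightarrow> x + a \<notin> V" and Vb: "\<And>x. x \<in> B \<Longrightarrow> x + b \<notin> V"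
  shows "2 * card V + 2 * card B \<le> CARD('a) + 4"
proof -
  define d where "d = a + b + (c + e)"
  have d: "a + b + d = c + e" "b + d = a + (c + e)" "a + d = b + (c + e)"
    by (simp_all add: d_def ac_simps)
  define P Q W V2 where "P = B \<inter> tr d B" and "Q = B \<union> tr d B"
    and "W = V \<union> tr d V" and "V2 = V \<inter> tr d V"
  have cards: "card P + card Q = 2 * card B" "card W + card V2 = 2 * card V"
    using card_Un_Int_eq[of B "tr d B"] card_Un_Int_eq[of V "tr d V"]
    by (simp_all add: P_def Q_def W_def V2_def)
  have no_ab: False if xa: "x + a \<in> W" and xb: "x + b \<in> W" for x
  proof -
    obtain v where v: "v \<in> V" "v = x + a \<or> v = x + a + d" using xa by (auto simp: W_def)
    obtain v' where v': "v' \<in> V" "v' = x + b \<or> v' = x + b + d" using xb by (auto simp: W_def)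
    have "v + v' = a + b \<or> v + v' = a + b + d" using v(2) v'(2) by (auto simp: ac_simps)
    then show False
      using sum_free_U[of v v' "a + b"] sum_free_U[of v v' "c + e"] v v' V
        edge_sums_I[OF ab] edge_sums_I[OF ce] d(1) by auto
  qed
  have P_not: "a \<notin> P" "b \<notin> P"
    using edge_owner[OF ce, of b] edge_owner[OF ce, of a] disj edgeD[OF ab] d(2,3)
    by (auto simp: P_def ac_simps)
  have "card (tr a W) + card (tr b W) + card P + card (tr (a + b) P) \<le> CARD('a)"
  proof (rule card_disjoint4)
    show "tr a W \<inter> tr b W = {}" using no_ab by auto
    show "tr a W \<inter> P = {}"
    proof (intro equals0I)
      fix x assume "x \<in> tr a W \<inter> P"
      then show False using Va[of x] Va[of "x + d"] by (auto simp: W_def P_def ac_simps)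
    qed
    show "tr b W \<inter> P = {}"
    proof (intro equals0I)
      fix x assume "x \<in> tr b W \<inter> P"
      then show False using Vb[of x] Vb[of "x + d"] by (auto simp: W_def P_def ac_simps)
    qed
    show "tr a W \<inter> tr (a + b) P = {}"
    proof (intro equals0I)
      fix x assume "x \<in> tr a W \<inter> tr (a + b) P"
      then show False using Vb[of "x + a + b"] Vb[of "x + a + b + d"] by (auto simp: W_def P_def ac_simps)
    qed
    show "tr b W \<inter> tr (a + b) P = {}"
    proof (intro equals0I)
      fix x assume "x \<in> tr b W \<inter> tr (a + b) P"
      then show False using Va[of "x + a + b"] Va[of "x + a + b + d"] by (auto simp: W_def P_def ac_simps)
    qed
    show "P \<inter> tr (a + b) P = {}"
    proof (intro equals0I)
      fix x assume x: "x \<in> P \<inter> tr (a + b) P"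
      then have "x = a \<or> x = b" using edge_owner[OF ab, of x] by (auto simp: P_def ac_simps)
      then show False using x P_not by auto
    qed
  qed
  then have 1: "2 * card W + 2 * card P \<le> CARD('a)" by simp
  have "card (tr a V2) + card (tr b V2) + card (Q \<union> tr (a + b) Q) + card ({}::'a set) \<le> CARD('a)"
  proof (rule card_disjoint4)
    show "tr a V2 \<inter> tr b V2 = {}" using no_ab unfolding W_def V2_def by fastforce
    show "tr a V2 \<inter> (Q \<union> tr (a + b) Q) = {}"
    proof (intro equals0I)
      fix x assume "x \<in> tr a V2 \<inter> (Q \<union> tr (a + b) Q)"
      then show False
        using Va[of x] Va[of "x + d"] Vb[of "x + a + b"] Vb[of "x + a + b + d"]
        by (auto simp: V2_def Q_def ac_simps)
    qed
    show "tr b V2 \<inter> (Q \<union> tr (a + b) Q) = {}"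
    proof (intro equals0I)
      fix x assume "x \<in> tr b V2 \<inter> (Q \<union> tr (a + b) Q)"
      then show False
        using Vb[of x] Vb[of "x + d"] Va[of "x + a + b"] Va[of "x + a + b + d"]
        by (auto simp: V2_def Q_def ac_simps)
    qed
  qed auto
  then have 2: "2 * card V2 + card (Q \<union> tr (a + b) Q) \<le> CARD('a)" by simp
  have "Q \<inter> tr (a + b) Q \<subseteq> {a, b, c, e} \<union> {a + d, b + d, c + d, e + d}"
  proof
    fix x assume x: "x \<in> Q \<inter> tr (a + b) Q"
    then obtain y where y: "y \<in> B" "x = y \<or> x = y + d" by (auto simp: Q_def ac_simps)
    have "x + (a + b) \<in> B \<or> x + (a + b) + d \<in> B" using x by (auto simp: Q_def)
    then have "a + b + y \<in> B \<or> a + b + d + y \<in> B" using y(2) by (auto simp: ac_simps)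
    then have "y \<in> {a, b, c, e}"
      using edge_owner[OF ab y(1)] edge_owner[OF ce y(1)] d(1) by auto
    then show "x \<in> {a, b, c, e} \<union> {a + d, b + d, c + d, e + d}" using y(2) by auto
  qed
  then have "card (Q \<inter> tr (a + b) Q) \<le> card ({a, b, c, e} \<union> {a + d, b + d, c + d, e + d})"
    by (intro card_mono) auto
  also have "\<dots> \<le> 8"
    by (intro order_trans[OF card_Un_le]) (simp add: card_insert_if)
  finally have "2 * card V2 + 2 * card Q \<le> CARD('a) + 8"
    using card_Un_Int_eq[of Q "tr (a + b) Q"] 2 by simp
  then show ?thesis using 1 cards by linarith
qed

lemma triangle_free: "edge B x y \<Longrightarrow> edge B y z \<Longrightarrow> \<not> edge B x z"
proof
  assume "edge B x y" "edge B y z" "edge B x z"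
  then have "x + y \<in> U" "y + z \<in> U" "x + z \<in> U" using edge_sums_I by blast+
  moreover have "x + y + (y + z) = x + z" by (simp add: ac_simps)
  ultimately show False using sum_free_U by blast
qed

text \<open>If no edge works in the first alternative, each edge has a leaf outside it hanging at
  one of its ends, so the vertices that carry leaves cover all edges. Let c be the one with the
  fewest leaves. The non-centres that are not leaves at c supply different edge sums avoiding c, and
  \<open>disjoint_edges_bound\<close> then leaves room for two such vertices only. The bound by a
  third of N comes from the same count.\<close>

lemma edge_dichotomy:
  assumes nonstar: "\<And>c. \<exists>x y. edge B x y \<and> x \<noteq> c \<and> y \<noteq> c"
  shows "3 * card B \<le> CARD('a) + 7 \<and>
    ((\<exists>a b. edge B a b \<and>
       (\<forall>z. z \<notin> {a, b} \<longrightarrow> (\<exists>y. edge B z y) \<longrightarrow> (\<exists>w. edge B z w \<and> w \<notin> {a, b}))) \<or>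
     (\<exists>c1 c2 x1 x2. c1 \<noteq> c2 \<and> edge B c1 x1 \<and> edge B c2 x2 \<and> x1 \<noteq> c2 \<and> x2 \<noteq> c1 \<and>
       (\<forall>x y. edge B x y \<longrightarrow> x \<in> {c1, c2} \<or> y \<in> {c1, c2})))"
proof (cases "\<exists>a b. edge B a b \<and>
       (\<forall>z. z \<notin> {a, b} \<longrightarrow> (\<exists>y. edge B z y) \<longrightarrow> (\<exists>w. edge B z w \<and> w \<notin> {a, b}))")
  case True
  then obtain a b where ab: "edge B a b"
    and free: "\<And>z. z \<notin> {a, b} \<Longrightarrow> \<exists>y. edge B z y \<Longrightarrow> \<exists>w. edge B z w \<and> w \<notin> {a, b}"
    by blast
  define D where "D = B - {a, b, z0}"
  define f where "f z = (SOME w. edge B z w \<and> w \<notin> {a, b})" for z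
  have f: "edge B z (f z)" "f z \<notin> {a, b}" "z \<notin> {a, b}" if "z \<in> D" for z
    using someI_ex[OF free, of z] covered[of z] that unfolding f_def D_def by auto
  have "card B \<le> card D + card {a, b, z0}"
    unfolding D_def using card_Un_le[of "B - {a, b, z0}" "{a, b, z0}"]
    by (metis (no_types, opaque_lifting) Un_Diff_cancel2 Un_upper1 card_mono finite_code order_trans)
  also have "card {a, b, z0} \<le> 3" by (simp add: card_insert_if)
  finally have D: "card B \<le> card D + 3" by simp
  define V where "V = (\<lambda>z. z + f z) ` D"
  have owner: "x = z \<or> x = f z" if "z \<in> D" "x \<in> B" "y \<in> B" "y + x = z + f z" for x y z
    using edge_same_sum[OF f(1)[OF that(1)] that(3,2)] that(4) by auto
  have "card D = (\<Sum>v\<in>V. card {z \<in> D. z + f z = v})"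
    unfolding V_def by (subst card_eq_sum, subst sum.image_gen[of _ _ "\<lambda>z. z + f z"]) auto
  \<comment> \<open>An edge sum can be chosen only from the two ends of its edge.\<close>
  also have "\<dots> \<le> (\<Sum>v\<in>V. 2)"
  proof (rule sum_mono)
    fix v assume "v \<in> V"
    then obtain z where z: "z \<in> D" "v = z + f z" by (auto simp: V_def)
    have "{z' \<in> D. z' + f z' = v} \<subseteq> {z, f z}"
    proof
      fix z' assume "z' \<in> {z' \<in> D. z' + f z' = v}"
      then show "z' \<in> {z, f z}"
        using owner[OF z(1), of z' "f z'"] edgeD[OF f(1)[of z']] z(2) by (auto simp: ac_simps)
    qed
    then show "card {z' \<in> D. z' + f z' = v} \<le> 2"
      using card_mono[of "{z, f z}" "{z' \<in> D. z' + f z' = v}"] by (simp add: card_insert_if split: if_splits)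
  qed
  finally have DV: "card D \<le> 2 * card V" by simp
  have "D \<noteq> {}" using D size by auto
  then obtain z where z: "z \<in> D" by blast
  have "2 * card V + 2 * card B \<le> CARD('a) + 4"
  proof (rule disjoint_edges_bound[OF ab f(1)[OF z]])
    show "{a, b} \<inter> {z, f z} = {}" using f[OF z] by auto
    show "V \<subseteq> U" using f(1) edge_sums_I by (auto simp: V_def)
    show "x + a \<notin> V" if "x \<in> B" for x
      using owner[of _ a x] that f edgeD[OF ab] by (fastforce simp: V_def)
    show "x + b \<notin> V" if "x \<in> B" for x
      using owner[of _ b x] that f edgeD[OF ab] by (fastforce simp: V_def)
  qed
  then have "3 * card B \<le> CARD('a) + 7" using D DV by linarith
  then show ?thesis using True by blast
next
  case False
  define Lf where "Lf c = {x. edge B x c \<and> (\<forall>y. edge B x y \<longrightarrow> y = c)}" for c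
  have leaf: "\<exists>z. z \<notin> {a, b} \<and> (z \<in> Lf a \<or> z \<in> Lf b)" if ab: "edge B a b" for a b
  proof -
    obtain z y where z: "z \<notin> {a, b}" "edge B z y" "\<And>w. edge B z w \<Longrightarrow> w \<in> {a, b}"
      using False ab by blast
    have "\<not> (edge B z a \<and> edge B z b)" using triangle_free[of z a b] ab by blast
    then have "z \<in> Lf a \<or> z \<in> Lf b" using z unfolding Lf_def by blast
    then show ?thesis using z(1) by blast
  qed
  define C where "C = {c. Lf c \<noteq> {}}"
  have edge_C: "a \<in> C \<or> b \<in> C" if "edge B a b" for a b
    using leaf[OF that] by (auto simp: C_def)
  \<comment> \<open>An edge from c to a leaf x has another leaf at one of its ends, and x carries
    none besides possibly c. Hence leaves come at least in pairs, which also shows that a leaf is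
    never a centre.\<close>
  have two: "2 \<le> card (Lf c)" if cC: "c \<in> C" for c
  proof -
    obtain x where x: "x \<in> Lf c" using cC by (auto simp: C_def)
    then have "edge B c x" by (auto simp: Lf_def edge_sym)
    then obtain z where "z \<notin> {c, x}" "z \<in> Lf c \<or> z \<in> Lf x" using leaf by blast
    then have "z \<noteq> x" "z \<in> Lf c" using x by (auto simp: Lf_def dest: edge_sym)
    then have "{x, z} \<subseteq> Lf c" "card {x, z} = 2" using x by auto
    then show ?thesis by (metis card_mono finite_code)
  qed
  have LfC: "x \<notin> C" if x: "x \<in> Lf c" for x c
  proof
    assume "x \<in> C"
    then have "\<not> Lf x \<subseteq> {c}" using two[of x] card_mono[of "{c}" "Lf x"] by auto
    then show False using x by (auto simp: Lf_def dest: edge_sym)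
  qed
  define I where "I = {x. x \<notin> C \<and> (\<exists>y. edge B x y)}"
  have LfI: "Lf c \<subseteq> I" for c using LfC by (auto simp: I_def Lf_def)
  have "B - {z0} \<subseteq> I \<union> C" using covered by (auto simp: I_def)
  then have "card (B - {z0}) \<le> card I + card C"
    by (meson card_Un_le card_mono finite_code order_trans)
  then have IC: "card B \<le> card I + card C + 1"
    by (metis card_Diff1_le card_Diff_singleton_if le_diff_conv order_trans add_le_mono1 diff_le_self)
  have "C \<noteq> {}" using nonstar edge_C by blast
  define c where "c = arg_min_on (\<lambda>c. card (Lf c)) C"
  have c: "c \<in> C" and c_min: "\<And>c'. c' \<in> C \<Longrightarrow> card (Lf c) \<le> card (Lf c')"
    using arg_min_if_finite(1)[of C "\<lambda>c. card (Lf c)"]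
      arg_min_least[of C _ "\<lambda>c. card (Lf c)"] \<open>C \<noteq> {}\<close> unfolding c_def by auto
  obtain x0 where x0: "x0 \<in> Lf c" using c by (auto simp: C_def)
  obtain c' where c': "c' \<in> C" "c' \<noteq> c"
    using nonstar[of c] edge_C by blast
  obtain x1 where x1: "x1 \<in> Lf c'" using c' by (auto simp: C_def)
  have e1: "edge B c x0" and e2: "edge B c' x1" using x0 x1 by (auto simp: Lf_def edge_sym)
  have dist: "c \<noteq> x1" "x0 \<noteq> c'" "x0 \<noteq> x1"
    using LfC[OF x0] LfC[OF x1] c c' x0 x1 by (auto simp: Lf_def)
  have "card C * card (Lf c) \<le> (\<Sum>c\<in>C. card (Lf c))"
    using sum_bounded_below[of C "card (Lf c)" "\<lambda>c. card (Lf c)"] c_min by simp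
  also have "\<dots> = card (\<Union>c\<in>C. Lf c)"
    by (subst card_UN_disjoint) (auto simp: Lf_def)
  also have "\<dots> \<le> card I" using LfI by (intro card_mono) auto
  finally have CI: "card C * card (Lf c) \<le> card I" .
  define f where "f i = (SOME y. edge B i y \<and> y \<noteq> c)" for i
  have f: "edge B i (f i)" "f i \<noteq> c" "f i \<in> C" "i \<notin> C" if "i \<in> I - Lf c" for i
  proof -
    have "\<exists>y. edge B i y \<and> y \<noteq> c" using that by (auto simp: I_def Lf_def)
    from someI_ex[OF this] have "edge B i (f i) \<and> f i \<noteq> c" unfolding f_def .
    then show "edge B i (f i)" "f i \<noteq> c" by auto
    then show "i \<notin> C" "f i \<in> C" using that edge_C by (auto simp: I_def)
  qed
  define V where "V = (\<lambda>i. i + f i) ` (I - Lf c)"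
  have owner: "x = i \<or> x = f i" if "i \<in> I - Lf c" "x \<in> B" "y \<in> B" "y + x = i + f i" for x y i
    using edge_same_sum[OF f(1)[OF that(1)] that(3,2)] that(4) by auto
  have "inj_on (\<lambda>i. i + f i) (I - Lf c)"
  proof (rule inj_onI)
    fix i j assume i: "i \<in> I - Lf c" and j: "j \<in> I - Lf c" and "i + f i = j + f j"
    then have "i = j \<or> i = f j"
      using owner[OF j, of i "f i"] edgeD[OF f(1)[OF i]] by (simp add: ac_simps)
    then show "i = j" using f[OF i] f[OF j] by auto
  qed
  then have cV: "card V = card I - card (Lf c)"
    unfolding V_def using LfI by (simp add: card_image card_Diff_subset)
  have bound: "2 * card V + 2 * card B \<le> CARD('a) + 4"
  proof (rule disjoint_edges_bound[OF e1 e2])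
    show "{c, x0} \<inter> {c', x1} = {}" using dist c' by auto
    show "V \<subseteq> U" using f(1) edge_sums_I by (auto simp: V_def)
    show "x + c \<notin> V" if "x \<in> B" for x
      using owner[of _ c x] that f c edgeD[OF e1] by (fastforce simp: V_def)
    show "x + x0 \<notin> V" if "x \<in> B" for x
      using owner[of _ x0 x] that f x0 LfC[OF x0] edgeD[OF e1] by (fastforce simp: V_def)
  qed
  have lc: "2 \<le> card (Lf c)" using two c by blast
  have "card {c, c'} \<le> card C" using c c' by (intro card_mono) auto
  then have C2: "2 \<le> card C" using c' by simp
  \<comment> \<open>Three centres force 3|V| + 8 \<ge> 2|B|, hence |B| at most about 3/10 of
    N.\<close>
  have "card C < 3"
  proof (rule ccontr)
    assume "\<not> card C < 3"
    then obtain m l where ml: "card C = m + 3" "card (Lf c) = l + 2"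
      using lc by (metis add.commute le_Suc_ex not_less)
    then have "m * l + 3 * l + 2 * m + 6 \<le> card I" using CI by (simp add: algebra_simps)
    then have "3 * card V + 8 \<ge> 2 * card B" using cV ml IC by simp
    then show False using bound size by linarith
  qed
  then have "card C = 2" using C2 by simp
  then have C: "C = {c, c'}" using c c' card_seteq[of C "{c, c'}"] by simp
  have "2 * card (Lf c) \<le> card I" using CI \<open>card C = 2\<close> by simp
  then have "3 * card B \<le> CARD('a) + 7" using bound cV IC \<open>card C = 2\<close> by linarith
  moreover have "\<forall>x y. edge B x y \<longrightarrow> x \<in> {c, c'} \<or> y \<in> {c, c'}" using edge_C C by blast
  ultimately show ?thesis using e1 e2 dist c'(2) by blast
qed

end

section \<open>Short odd relations\<close>

definition subgrp :: "'a::ab_group_add set \<Rightarrow> bool" where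
  "subgrp H \<longleftrightarrow> 0 \<in> H \<and> (\<forall>x\<in>H. \<forall>y\<in>H. x + y \<in> H)"

lemma subgrpD: "subgrp H \<Longrightarrow> 0 \<in> H" "subgrp H \<Longrightarrow> x \<in> H \<Longrightarrow> y \<in> H \<Longrightarrow> x + y \<in> H"
  by (auto simp: subgrp_def)

lemma subgrp_add_iff:
  fixes H :: "'a::char2 set"
  assumes "subgrp H" "x \<in> H"
  shows "x + y \<in> H \<longleftrightarrow> y \<in> H" "y + x \<in> H \<longleftrightarrow> y \<in> H"
  using assms subgrpD(2)[of H x "x + y"] subgrpD(2)[of H x y] by (auto simp: add.commute)

text \<open>Take a maximal subgroup among those containing E and missing u. If neither g nor g + u
  belonged to it, adjoining g would produce a larger one.\<close>

lemma exists_hyperplane: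
  fixes E :: "'a::{char2,finite} set"
  assumes E: "subgrp E" and u: "u \<notin> E"
  obtains H where "subgrp H" "E \<subseteq> H" "u \<notin> H" "\<And>g. g \<in> H \<or> g + u \<in> H"
proof -
  let ?S = "{H. subgrp H \<and> E \<subseteq> H \<and> u \<notin> H}"
  obtain H where H: "H \<in> ?S" and max: "\<And>H'. H' \<in> ?S \<Longrightarrow> H \<subseteq> H' \<Longrightarrow> H = H'"
    using finite_has_maximal2[of ?S E] E u by auto
  have "g \<in> H \<or> g + u \<in> H" for g
  proof (rule ccontr)
    assume g: "\<not> (g \<in> H \<or> g + u \<in> H)"
    let ?H = "H \<union> tr g H"
    have "x + y \<in> ?H" if "x \<in> ?H" "y \<in> ?H" for x y
    proof -
      have *: "x \<in> H \<or> x + g \<in> H" "y \<in> H \<or> y + g \<in> H" using that by auto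
      have "x + y + g = (x + g) + y" "x + y + g = x + (y + g)" "x + y = (x + g) + (y + g)"
        by (simp_all add: ac_simps)
      then show ?thesis using * subgrpD(2)[of H] H by (metis Un_iff mem_Collect_eq mem_tr)
    qed
    then have "subgrp ?H" using H by (auto simp: subgrp_def)
    moreover have "u \<notin> ?H" using g H by (auto simp: add.commute)
    ultimately have "H = ?H" using H by (intro max) auto
    moreover have "g \<in> ?H" using H by (auto simp: subgrpD)
    ultimately show False using g by blast
  qed
  then show thesis using H that by blast
qed

lemma card_split_hyperplane:
  fixes H :: "'a::{char2,finite} set"
  assumes "subgrp H" "subgrp K" "t \<in> H" "t \<notin> K" "\<And>g. g \<in> K \<or> g + t \<in> K"
  shows "card H = 2 * card (H \<inter> K)"
proof -
  have "x \<in> H - K \<longleftrightarrow> x + t \<in> H \<inter> K" for x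
    using assms(4) assms(5)[of x] subgrp_add_iff(2)[OF assms(1,3), of x]
      subgrp_add_iff(1)[OF assms(2), of x t] by blast
  then have "H - K = tr t (H \<inter> K)" by (intro set_eqI) (simp only: mem_tr)
  then have "card (H - K) = card (H \<inter> K)" by simp
  then show ?thesis using card_Diff_subset_Int[of H K] card_mono[of H "H \<inter> K"] by auto
qed

lemma tr_set_plus:
  fixes A :: "'a::char2 set"
  shows "tr s A + tr t C = tr (s + t) (A + C)"
proof (intro set_eqI iffI)
  fix x assume "x \<in> tr s A + tr t C"
  then obtain a c where "x = a + c" "a + s \<in> A" "c + t \<in> C" by (auto simp: set_plus_def)
  moreover have "a + c + (s + t) = (a + s) + (c + t)" by (simp add: ac_simps)
  ultimately show "x \<in> tr (s + t) (A + C)" by (metis mem_tr set_plus_intro)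
next
  fix x assume "x \<in> tr (s + t) (A + C)"
  then obtain a c where ac: "x + (s + t) = a + c" "a \<in> A" "c \<in> C" by (auto simp: set_plus_def)
  have "x = x + (s + t) + (s + t)" by (simp add: add.assoc)
  also have "\<dots> = (a + s) + (c + t)" unfolding ac(1) by (simp add: ac_simps)
  finally have "x = (a + s) + (c + t)" .
  moreover have "a + s \<in> tr s A" "c + t \<in> tr t C" using ac by (simp_all add: add.assoc)
  ultimately show "x \<in> tr s A + tr t C" by (metis set_plus_intro)
qed

text \<open>A weak form of Kneser's theorem: a hyperplane that splits both summands reduces the claim to
  the four pairs of halves, of which one in each parity class is large enough for the induction.\<close>

lemma sumset_half:
  fixes H :: "'a::{char2,finite} set"
  assumes "subgrp H" "A \<subseteq> H" "C \<subseteq> H" "A \<noteq> {}" "C \<noteq> {}" "card H < 2 * (card A + card C)"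
  shows "card H \<le> 2 * card (A + C)"
  using assms
proof (induction "card H" arbitrary: H A C rule: less_induct)
  case less
  note H = less.prems(1)
  \<comment> \<open>A hyperplane through s + t that misses s misses t as well.\<close>
  have split: "\<exists>K. subgrp K \<and> s \<notin> K \<and> t \<notin> K \<and> (\<forall>g. g \<in> K \<or> g + s \<in> K)" if st: "s \<noteq> 0" "t \<noteq> 0" for s t :: 'a
  proof -
    have "subgrp {0, s + t}" by (auto simp: subgrp_def ac_simps)
    moreover have "s \<notin> {0, s + t}" using st by (auto simp: add_eq_iff)
    ultimately obtain K where K: "subgrp K" "{0, s + t} \<subseteq> K" "s \<notin> K" "\<And>g. g \<in> K \<or> g + s \<in> K"
      by (rule exists_hyperplane) blast
    then have "t \<notin> K" using subgrp_add_iff(1)[OF K(1), of "s + t" t] by (auto simp: ac_simps)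
    then show ?thesis using K by blast
  qed
  \<comment> \<open>With a one-element summand the claim is parity: |H| is even unless H = {0}, so
    |H| < 2 + 2|C| improves to |H| \<le> 2|C|.\<close>
  have single: "card H \<le> 2 * card C" if "card H < 2 * (1 + card C)" "C \<noteq> {}" for C :: "'a set"
  proof (cases "H = {0}")
    case True
    then show ?thesis using that(2) card_gt_0_iff[of C] by auto
  next
    case False
    then obtain s where s: "s \<in> H" "s \<noteq> 0" using subgrpD(1)[OF H] by blast
    then obtain K where "subgrp K" "s \<notin> K" "\<And>g. g \<in> K \<or> g + s \<in> K" using split[of s s] by blast
    then have "card H = 2 * card (H \<inter> K)" using card_split_hyperplane[OF H] s by blast
    then show ?thesis using that(1) by presburger
  qed
  consider "card A = 1" | "card C = 1" | "card A \<ge> 2" "card C \<ge> 2"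
    using less.prems(4,5) by (metis One_nat_def Suc_1 card_0_eq finite_code le_Suc_eq not_less_eq_eq le0 le_antisym)
  then show ?case
  proof cases
    case 1
    then obtain a where "A = {a}" by (rule card_1_singletonE)
    then have "A + C = (\<lambda>x. a + x) ` C" by (auto simp: set_plus_def)
    then have "card (A + C) = card C" by (simp add: card_image)
    then show ?thesis using single[of C] less.prems 1 by simp
  next
    case 2
    then obtain c where "C = {c}" by (rule card_1_singletonE)
    then have "A + C = (\<lambda>x. x + c) ` A" by (auto simp: set_plus_def)
    then have "card (A + C) = card A" by (simp add: card_image)
    then show ?thesis using single[of A] less.prems 2 by simp
  next
    case 3
    obtain a1 a2 where a: "a1 \<in> A" "a2 \<in> A" "a1 \<noteq> a2"
      using 3(1) card_le_Suc0_iff_eq[of A] by force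
    obtain c1 c2 where c: "c1 \<in> C" "c2 \<in> C" "c1 \<noteq> c2"
      using 3(2) card_le_Suc0_iff_eq[of C] by force
    define t where "t = a1 + a2"
    obtain K where K: "subgrp K" "t \<notin> K" "c1 + c2 \<notin> K" "\<And>g. g \<in> K \<or> g + t \<in> K"
      using split[of t "c1 + c2"] a c by (auto simp: t_def)
    have tH: "t \<in> H" using a less.prems(2) subgrpD(2)[OF H] by (auto simp: t_def)
    have cH: "card H = 2 * card (H \<inter> K)" using card_split_hyperplane[OF H K(1) tH K(2,4)] .
    have HK: "subgrp (H \<inter> K)" using H K(1) by (auto simp: subgrp_def)
    have pos: "card H > 0" using subgrpD(1)[OF H] by (auto simp: card_gt_0_iff)
    have not_K: "x + y \<in> K" if "x \<notin> K" "y \<notin> K" for x y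
    proof -
      have "x + t \<in> K" "y + t \<in> K" using that K(4) by blast+
      then have "(x + t) + (y + t) \<in> K" using K(1) subgrpD(2) by blast
      then show ?thesis by (simp add: ac_simps)
    qed
    have a_ne: "A \<inter> K \<noteq> {}" "A - K \<noteq> {}"
      using a K(2) subgrpD(2)[OF K(1), of a1 a2] not_K[of a1 a2] by (auto simp: t_def)
    have c_ne: "C \<inter> K \<noteq> {}" "C - K \<noteq> {}"
      using c K(3) subgrpD(2)[OF K(1), of c1 c2] not_K[of c1 c2] by auto
    have inK: "tr t (S - K) \<subseteq> H \<inter> K" if "S \<subseteq> H" for S
    proof
      fix x assume "x \<in> tr t (S - K)"
      then have "x + t \<in> H" "x + t \<notin> K" using that by auto
      then show "x \<in> H \<inter> K" using subgrp_add_iff(2)[OF H tH] K(4)[of x] by auto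
    qed
    have IH: "card (H \<inter> K) \<le> 2 * card (S + S')"
      if "S \<subseteq> H \<inter> K" "S' \<subseteq> H \<inter> K" "S \<noteq> {}" "S' \<noteq> {}" "card (H \<inter> K) < 2 * (card S + card S')" for S S'
      using less.hyps[of "H \<inter> K" S S'] that HK cH pos by simp
    have ne_tr: "tr t S \<noteq> {}" if "S \<noteq> {}" for S
      using that by (metis card_0_eq card_tr finite_code)
    have cA: "card A = card (A \<inter> K) + card (A - K)" and cC: "card C = card (C \<inter> K) + card (C - K)"
      by (simp_all add: card_Int_Diff)
    \<comment> \<open>The two pairs of halves with sums in K contain |A| + |C| elements together,
      and so do the two mixed pairs. In each class one pair exceeds the threshold belonging to the
      half-size group.\<close>
    have half_disj: "h < 2 * (a0 + c0) \<or> h < 2 * (a1 + c1)"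
      if "2 * h < 2 * (a0 + a1 + (c0 + c1))" for h a0 a1 c0 c1 :: nat
      using that by arith
    have "card (H \<inter> K) \<le> 2 * card ((A + C) \<inter> K)"
    proof -
      have "card (H \<inter> K) < 2 * (card (A \<inter> K) + card (C \<inter> K))
          \<or> card (H \<inter> K) < 2 * (card (A - K) + card (C - K))"
        using less.prems(6) unfolding cH cA cC by (rule half_disj)
      then show ?thesis
      proof
        assume "card (H \<inter> K) < 2 * (card (A \<inter> K) + card (C \<inter> K))"
        then have "card (H \<inter> K) \<le> 2 * card ((A \<inter> K) + (C \<inter> K))"
          using a_ne c_ne less.prems(2,3) by (intro IH) auto
        also have "card ((A \<inter> K) + (C \<inter> K)) \<le> card ((A + C) \<inter> K)"
          using subgrpD(2)[OF K(1)] by (intro card_mono) (auto simp: set_plus_def)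
        finally show ?thesis by simp
      next
        assume "card (H \<inter> K) < 2 * (card (A - K) + card (C - K))"
        then have "card (H \<inter> K) \<le> 2 * card (tr t (A - K) + tr t (C - K))"
          using inK[OF less.prems(2)] inK[OF less.prems(3)] ne_tr a_ne c_ne by (intro IH) auto
        also have "card (tr t (A - K) + tr t (C - K)) = card ((A - K) + (C - K))"
          by (simp only: tr_set_plus card_tr)
        also have "\<dots> \<le> card ((A + C) \<inter> K)"
          using not_K by (intro card_mono) (auto simp: set_plus_def)
        finally show ?thesis by simp
      qed
    qed
    moreover have "card (H \<inter> K) \<le> 2 * card ((A + C) - K)"
    proof -
      have "card (H \<inter> K) < 2 * (card (A \<inter> K) + card (C - K))
          \<or> card (H \<inter> K) < 2 * (card (A - K) + card (C \<inter> K))"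
        using less.prems(6) unfolding cH cA cC add.commute[of "card (C \<inter> K)"] by (rule half_disj)
      then show ?thesis
      proof
        assume "card (H \<inter> K) < 2 * (card (A \<inter> K) + card (C - K))"
        then have "card (H \<inter> K) \<le> 2 * card (tr 0 (A \<inter> K) + tr t (C - K))"
          using a_ne c_ne ne_tr less.prems(2) inK[OF less.prems(3)] by (intro IH) auto
        also have "card (tr 0 (A \<inter> K) + tr t (C - K)) = card ((A \<inter> K) + (C - K))"
          by (simp only: tr_set_plus card_tr)
        also have "\<dots> \<le> card ((A + C) - K)"
          using subgrp_add_iff(1)[OF K(1)] by (intro card_mono) (auto simp: set_plus_def)
        finally show ?thesis by simp
      next
        assume "card (H \<inter> K) < 2 * (card (A - K) + card (C \<inter> K))"
        then have "card (H \<inter> K) \<le> 2 * card (tr t (A - K) + tr 0 (C \<inter> K))"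
          using a_ne c_ne ne_tr less.prems(3) inK[OF less.prems(2)] by (intro IH) auto
        also have "card (tr t (A - K) + tr 0 (C \<inter> K)) = card ((A - K) + (C \<inter> K))"
          by (simp only: tr_set_plus card_tr)
        also have "\<dots> \<le> card ((A + C) - K)"
          using subgrp_add_iff(2)[OF K(1)] by (intro card_mono) (auto simp: set_plus_def)
        finally show ?thesis by simp
      qed
    qed
    ultimately show ?thesis using cH card_Int_Diff[of "A + C" K] by simp
  qed
qed

section \<open>Sums of n elements and odd relations\<close>

fun nfold :: "'a::comm_monoid_add set \<Rightarrow> nat \<Rightarrow> 'a set" where
  "nfold U 0 = {0}"
| "nfold U (Suc n) = U + nfold U n"

lemma nfold_add: "x \<in> nfold U m \<Longrightarrow> y \<in> nfold U n \<Longrightarrow> x + y \<in> nfold U (m + n)"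
proof (induction m arbitrary: x)
  case (Suc m)
  then obtain u z where "x = u + z" "u \<in> U" "z \<in> nfold U m" by (auto simp: set_plus_def)
  then show ?case using Suc.IH[of z] Suc.prems(2) by (auto simp: set_plus_def add.assoc)
qed simp

lemma nfold_SucE:
  assumes "x \<in> nfold U (Suc n)" obtains u y where "u \<in> U" "y \<in> nfold U n" "x = u + y"
  using assms by (auto simp: set_plus_def)

lemma card_Un_tr_disjoint:
  fixes S :: "'a::{char2,finite} set"
  assumes "\<And>x. x \<in> S \<Longrightarrow> x + q \<notin> S"
  shows "card (S \<union> tr q S) = 2 * card S"
  using assms by (subst card_Un_disjoint) auto

text \<open>If the shortest odd relation has length at least 7, the eight words of the simplex code, read
  as partial sums of that relation, give pairwise disjoint translates of the set.\<close>

lemma odd_relation_cases: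
  fixes U :: "'a::{char2,finite} set"
  assumes "0 \<notin> U" "0 \<notin> nfold U 3" and large: "CARD('a) < 8 * card U"
  obtains "0 \<in> nfold U 5"
  | H where "subgrp H" "U \<inter> H = {}" "\<And>g u. u \<in> U \<Longrightarrow> g \<in> H \<or> g + u \<in> H"
proof (cases "\<exists>n. odd n \<and> 0 \<in> nfold U n")
  case False
  obtain u0 where u0: "u0 \<in> U" using large by fastforce
  \<comment> \<open>Sums of evenly many elements form a subgroup. It misses u0, as otherwise u0 + u0
    = 0 would be an odd relation; elements of U differ by elements of E, so a hyperplane through E
    missing u0 misses all of U.\<close>
  define E where "E = (\<Union>n. nfold U (2 * n))"
  have "subgrp E"
    unfolding subgrp_def E_def
  proof (intro conjI ballI)
    show "0 \<in> (\<Union>n. nfold U (2 * n))" by (auto intro!: exI[of _ 0])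
    fix x y assume "x \<in> (\<Union>n. nfold U (2 * n))" "y \<in> (\<Union>n. nfold U (2 * n))"
    then obtain m n where "x \<in> nfold U (2 * m)" "y \<in> nfold U (2 * n)" by auto
    then show "x + y \<in> (\<Union>n. nfold U (2 * n))" using nfold_add[of x U "2 * m" y "2 * n"]
      by (auto intro!: exI[of _ "m + n"])
  qed
  moreover have "u0 \<notin> E"
  proof
    assume "u0 \<in> E"
    then obtain n where "u0 \<in> nfold U (2 * n)" by (auto simp: E_def)
    then have "u0 + u0 \<in> nfold U (2 * n + 1)" using nfold_add[of u0 U "2 * n" u0 1] u0 by simp
    then show False using False by (metis even_plus_one_iff even_mult_iff even_numeral self_add)
  qed
  ultimately obtain H where H: "subgrp H" "E \<subseteq> H" "u0 \<notin> H" "\<And>g. g \<in> H \<or> g + u0 \<in> H"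
    by (rule exists_hyperplane) blast
  have diff: "u + u0 \<in> H" if "u \<in> U" for u
  proof -
    have "u + u0 \<in> nfold U (2 * 1)"
      using nfold_add[of u U "Suc 0" u0 "Suc 0"] that u0 by (simp add: numeral_2_eq_2)
    then show ?thesis using H(2) unfolding E_def by blast
  qed
  have "u \<notin> H" if "u \<in> U" for u
    using diff[OF that] subgrp_add_iff(1)[OF H(1), of u u0] H(3) by blast
  moreover have "g \<in> H \<or> g + u \<in> H" if "u \<in> U" for g u
  proof -
    have "g + u0 + (u + u0) = g + u" by (simp add: ac_simps)
    then show ?thesis using H(4)[of g] diff[OF that] subgrpD(2)[OF H(1)] by metis
  qed
  ultimately show thesis using that(2) H(1) by blast
next
  case True
  define n where "n = (LEAST n. odd n \<and> 0 \<in> nfold U n)"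
  have n: "odd n" "0 \<in> nfold U n" using LeastI_ex[OF True] by (simp_all add: n_def)
  have min: "0 \<notin> nfold U k" if "odd k" "k < n" for k
    using not_less_Least[of k "\<lambda>n. odd n \<and> 0 \<in> nfold U n"] that by (auto simp: n_def)
  have "n \<noteq> 1" "n \<noteq> 3" using n(2) assms(1,2) by auto
  show thesis
  proof (cases "n = 5")
    case True
    then show ?thesis using n(2) that(1) by simp
  next
    case False
    then have "7 \<le> n" using n(1) \<open>n \<noteq> 1\<close> \<open>n \<noteq> 3\<close> by presburger
    then obtain m where "n = m + 7" by (metis add.commute le_Suc_ex)
    then have m: "n = Suc (Suc (Suc (Suc (Suc (Suc (Suc m))))))" by simp
    obtain u1 r1 where 1: "u1 \<in> U" "r1 \<in> nfold U (Suc (Suc (Suc (Suc (Suc (Suc m))))))" "0 = u1 + r1"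
      using n(2) unfolding m by (rule nfold_SucE)
    obtain u2 r2 where 2: "u2 \<in> U" "r2 \<in> nfold U (Suc (Suc (Suc (Suc (Suc m)))))" "r1 = u2 + r2"
      using 1(2) by (rule nfold_SucE)
    obtain u3 r3 where 3: "u3 \<in> U" "r3 \<in> nfold U (Suc (Suc (Suc (Suc m))))" "r2 = u3 + r3"
      using 2(2) by (rule nfold_SucE)
    obtain u4 r4 where 4: "u4 \<in> U" "r4 \<in> nfold U (Suc (Suc (Suc m)))" "r3 = u4 + r4"
      using 3(2) by (rule nfold_SucE)
    obtain u5 r5 where 5: "u5 \<in> U" "r5 \<in> nfold U (Suc (Suc m))" "r4 = u5 + r5"
      using 4(2) by (rule nfold_SucE)
    obtain u6 r6 where 6: "u6 \<in> U" "r6 \<in> nfold U (Suc m)" "r5 = u6 + r6"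
      using 5(2) by (rule nfold_SucE)
    obtain u7 r where 7: "u7 \<in> U" "r \<in> nfold U m" "r6 = u7 + r"
      using 6(2) by (rule nfold_SucE)
    note u = 1(1) 2(1) 3(1) 4(1) 5(1) 6(1) 7(1) and r = 7(2)
    have "u1 = u2 + (u3 + (u4 + (u5 + (u6 + (u7 + r)))))"
      using 1(3) 2(3) 3(3) 4(3) 5(3) 6(3) 7(3) by (metis add_eq_0_iff_char2)
    then have r_eq: "r = u1 + (u2 + (u3 + (u4 + (u5 + (u6 + u7)))))"
      by (simp add: ac_simps)
    \<comment> \<open>Such a sum would be an odd relation of length m + 5 = n - 2.\<close>
    have no: "v + w + (x + (y + (z + r))) \<noteq> 0" if "v \<in> U" "w \<in> U" "x \<in> U" "y \<in> U" "z \<in> U" for v w x y z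
    proof -
      have "v + (w + (x + (y + (z + r)))) \<in> nfold U (Suc (Suc (Suc (Suc (Suc m)))))"
        using that r by (auto intro!: set_plus_intro)
      moreover have "odd (Suc (Suc (Suc (Suc (Suc m)))))" using n(1) m by simp
      ultimately show ?thesis using min[of "Suc (Suc (Suc (Suc (Suc m))))"] m by (auto simp: add.assoc)
    qed
    \<comment> \<open>The supports are {1,2,3,4}, {1,2,5,6} and {1,3,5,7}. The complements of their
      seven nonzero combinations are the lines of a Fano plane. Since u1, ..., u7 add up to r, each
      combination equals three of the u's plus r, so writing it as x + y would give the forbidden
      shorter relation.\<close>
    define q1 q2 q3 where "q1 = u1 + u2 + (u3 + u4)" and "q2 = u1 + u2 + (u5 + u6)" and "q3 = u1 + u3 + (u5 + u7)"
    have compl: "q1 + (u5 + (u6 + (u7 + r))) = 0" "q2 + (u3 + (u4 + (u7 + r))) = 0"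
      "q3 + (u2 + (u4 + (u6 + r))) = 0" "q1 + q2 + (u1 + (u2 + (u7 + r))) = 0"
      "q1 + q3 + (u1 + (u3 + (u6 + r))) = 0" "q2 + q3 + (u1 + (u4 + (u5 + r))) = 0"
      "q1 + (q2 + q3) + (u2 + (u3 + (u5 + r))) = 0"
      unfolding q1_def q2_def q3_def r_eq by (simp_all add: ac_simps del: add_eq_0_iff_char2)
    have q: "x + y \<noteq> q1" "x + y \<noteq> q2" "x + y \<noteq> q3" "x + y \<noteq> q1 + q2" "x + y \<noteq> q1 + q3"
      "x + y \<noteq> q2 + q3" "x + y \<noteq> q1 + (q2 + q3)" if "x \<in> U" "y \<in> U" for x y
      using no[OF that u(5) u(6) u(7)] no[OF that u(3) u(4) u(7)] no[OF that u(2) u(4) u(6)]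
        no[OF that u(1) u(2) u(7)] no[OF that u(1) u(3) u(6)] no[OF that u(1) u(4) u(5)]
        no[OF that u(2) u(3) u(5)] compl by auto
    define U1 U2 U3 where "U1 = U \<union> tr q1 U" and "U2 = U1 \<union> tr q2 U1" and "U3 = U2 \<union> tr q3 U2"
    have "card U1 = 2 * card U" unfolding U1_def
    proof (rule card_Un_tr_disjoint)
      fix x assume "x \<in> U" then show "x + q1 \<notin> U" using q(1)[of x "x + q1"] by auto
    qed
    moreover have "card U2 = 2 * card U1" unfolding U2_def
    proof (rule card_Un_tr_disjoint)
      fix x assume x: "x \<in> U1"
      show "x + q2 \<notin> U1"
      proof
        assume "x + q2 \<in> U1"
        then obtain y z where "y \<in> U" "z \<in> U" "y = x \<or> y = x + q1" "z = x + q2 \<or> z = x + q2 + q1"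
          using x unfolding U1_def by (metis Un_iff mem_tr)
        then show False using q(2,4)[of y z] by (auto simp: ac_simps)
      qed
    qed
    moreover have "card U3 = 2 * card U2" unfolding U3_def
    proof (rule card_Un_tr_disjoint)
      fix x assume x: "x \<in> U2"
      show "x + q3 \<notin> U2"
      proof
        assume x': "x + q3 \<in> U2"
        obtain y where y: "y \<in> U" "y = x \<or> y = x + q1 \<or> y = x + q2 \<or> y = x + q2 + q1"
          using x unfolding U1_def U2_def by (metis Un_iff mem_tr)
        obtain z where z: "z \<in> U" "z = x + q3 \<or> z = x + q3 + q1 \<or> z = x + q3 + q2 \<or> z = x + q3 + q2 + q1"
          using x' unfolding U1_def U2_def by (metis Un_iff mem_tr)
        show False using q(3,5,6,7)[OF y(1) z(1)] y(2) z(2) by (auto simp: ac_simps)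
      qed
    qed
    moreover have "card U3 \<le> CARD('a)" by (intro card_mono) auto
    ultimately show ?thesis using large by simp
  qed
qed

section \<open>Edge sums off a hyperplane\<close>

text \<open>The sides are given as subsets of the cosets s + H and t + H, not of H and its
  complement. This makes the situation symmetric, so that \<open>swap\<close> transfers one-sided
  results to the other side.\<close>

locale sided_cover = edge_cover B z0
  for B :: "'a::{char2,finite} set" and z0 :: 'a +
  fixes X Y H :: "'a set" and s t :: 'a
  assumes B_eq: "B = X \<union> Y"
    and subgrp_H: "subgrp H" and card_H: "2 * card H = CARD('a)" and st: "s + t \<notin> H"
    and X_sub: "X \<subseteq> tr s H" and Y_sub: "Y \<subseteq> tr t H" and U_sub: "U \<subseteq> tr (s + t) H"
begin

lemma swap: "sided_cover B z0 Y X H t s"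
  using B_eq subgrp_H card_H st X_sub Y_sub U_sub
  by unfold_locales (auto simp: add.commute)

lemma H_add: "x \<in> H \<Longrightarrow> y \<in> H \<Longrightarrow> x + y \<in> H"
  using subgrp_H by (rule subgrpD(2))

lemma side_sum:
  "x + s \<in> H \<Longrightarrow> y + t \<in> H \<Longrightarrow> x + y + (s + t) \<in> H"
  "x + s \<in> H \<Longrightarrow> u + (s + t) \<in> H \<Longrightarrow> x + u + t \<in> H"
  "y + t \<in> H \<Longrightarrow> u + (s + t) \<in> H \<Longrightarrow> y + u + s \<in> H"
  using H_add[of "x + s" "y + t"] H_add[of "x + s" "u + (s + t)"] H_add[of "y + t" "u + (s + t)"]
  by (simp_all add: ac_simps)

lemma sides_disjoint: "x + s \<in> H \<Longrightarrow> x + t \<notin> H"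
  using H_add[of "x + s" "x + t"] st by (auto simp: ac_simps)

lemma XD: "x \<in> X \<Longrightarrow> x + s \<in> H" and YD: "y \<in> Y \<Longrightarrow> y + t \<in> H" and UD: "u \<in> U \<Longrightarrow> u + (s + t) \<in> H"
  using X_sub Y_sub U_sub by auto

lemma X_B: "x \<in> X \<Longrightarrow> x \<in> B" and Y_B: "x \<in> Y \<Longrightarrow> x \<in> B" and B_cases: "x \<in> B \<Longrightarrow> x \<in> X \<or> x \<in> Y"
  using B_eq by auto

lemma XY_disjoint: "x \<in> X \<Longrightarrow> x \<notin> Y"
  using XD YD sides_disjoint by blast

lemma edge_sides: "edge B x y \<Longrightarrow> x \<in> X \<and> y \<in> Y \<or> x \<in> Y \<and> y \<in> X"
proof -
  assume e: "edge B x y"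
  have u: "x + y + (s + t) \<in> H" using UD edge_sums_I[OF e] by blast
  have False if "x \<in> X" "y \<in> X"
    using side_sum(2)[OF XD[OF that(1)] u] sides_disjoint[OF XD[OF that(2)]] by (simp add: ac_simps)
  moreover have False if "x \<in> Y" "y \<in> Y"
    using side_sum(3)[OF YD[OF that(1)] u] sides_disjoint[of y] YD[OF that(2)] by (simp add: ac_simps)
  ultimately show ?thesis using edgeD[OF e] B_cases by blast
qed

lemma edge_X: "edge B x y \<Longrightarrow> x \<in> X \<Longrightarrow> y \<in> Y" and edge_Y: "edge B x y \<Longrightarrow> x \<in> Y \<Longrightarrow> y \<in> X"
  using edge_sides XY_disjoint by blast+

text \<open>All edges end at c1 or c2, both in Y, so nearly all of B lies in X. Translation by c1 +
  c2 moves \<open>X'\<close> off itself, because x + c1 = (x + c1 + c2) + c2 would be a second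
  representation. Hence \<open>X'\<close> fills at most half of a coset of H, and |B| is about N/4
  at most.\<close>

lemma same_side_centres:
  assumes "c1 \<noteq> c2" "c1 \<in> Y" "c2 \<in> Y"
    and touch: "\<And>x y. edge B x y \<Longrightarrow> x \<in> {c1, c2} \<or> y \<in> {c1, c2}"
  shows False
proof -
  define X' where "X' = X - {z0}"
  have edges: "edge B x c1 \<or> edge B x c2" if x: "x \<in> X'" for x
  proof -
    obtain y where "edge B x y" using covered[of x] x X_B by (auto simp: X'_def)
    then show ?thesis using touch[of x y] x XY_disjoint assms(2,3) by (auto simp: X'_def)
  qed
  have "y \<in> {c1, c2, z0}" if y: "y \<in> Y" for y
  proof (cases "y = z0")
    case False
    then obtain x where "edge B y x" using covered[of y] y Y_B by auto
    then show ?thesis using touch[of y x] edge_Y[of y x] y XY_disjoint assms(2,3) by blast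
  qed simp
  then have "B \<subseteq> X' \<union> {c1, c2, z0}" using B_cases by (auto simp: X'_def)
  then have "card B \<le> card (X' \<union> {c1, c2, z0})" by (intro card_mono) auto
  also have "\<dots> \<le> card X' + card {c1, c2, z0}" by (rule card_Un_le)
  also have "card {c1, c2, z0} \<le> 3" by (simp add: card_insert_if)
  finally have b: "card B \<le> card X' + 3" by simp
  have no: "x + (c1 + c2) \<notin> X'" if x: "x \<in> X'" for x
  proof
    assume x': "x + (c1 + c2) \<in> X'"
    have cs: "c1 \<in> B" "c2 \<in> B" "x + (c1 + c2) \<in> B" "x \<noteq> c1" "x \<noteq> c2"
      using assms(2,3) x x' XY_disjoint X_B Y_B by (auto simp: X'_def)
    show False
      using edges[OF x]
    proof
      assume "edge B x c1"
      then show False using edge_same_sum[of B x c1 "x + (c1 + c2)" c2] cs assms(1) by (auto simp: ac_simps)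
    next
      assume "edge B x c2"
      then show False using edge_same_sum[of B x c2 "x + (c1 + c2)" c1] cs assms(1) by (auto simp: ac_simps)
    qed
  qed
  have "X' \<union> tr (c1 + c2) X' \<subseteq> tr s H"
  proof
    fix x assume "x \<in> X' \<union> tr (c1 + c2) X'"
    then have "x + s \<in> H \<or> x + (c1 + c2) + s \<in> H" using XD by (auto simp: X'_def)
    moreover have "c1 + c2 \<in> H" using H_add[OF YD[OF assms(2)] YD[OF assms(3)]] by (simp add: ac_simps)
    ultimately show "x \<in> tr s H" using H_add[of "x + (c1 + c2) + s" "c1 + c2"] by (auto simp: ac_simps)
  qed
  then have "card (X' \<union> tr (c1 + c2) X') \<le> card (tr s H)" by (intro card_mono) auto
  moreover have "card (X' \<union> tr (c1 + c2) X') = 2 * card X'" using no by (rule card_Un_tr_disjoint)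
  ultimately show False using b size card_H by simp
qed

text \<open>By uniqueness the sumset X' + Y' and the edge sums c1 + X' and c2 + Y' are pairwise
  disjoint, and all lie in one coset of H. If |X'| + |Y'| exceeded |H|/2, then
  \<open>sumset_half\<close> would make the sumset half of that coset and overfill it.\<close>

lemma opposite_centres:
  assumes "c1 \<in> Y" "c2 \<in> X" and x1: "edge B c1 x1" "x1 \<noteq> c2" and x2: "edge B c2 x2" "x2 \<noteq> c1"
    and touch: "\<And>x y. edge B x y \<Longrightarrow> x \<in> {c1, c2} \<or> y \<in> {c1, c2}"
  shows False
proof -
  define X' Y' where "X' = {x \<in> X. x \<noteq> c2 \<and> (\<exists>y. edge B x y)}" and "Y' = {y \<in> Y. y \<noteq> c1 \<and> (\<exists>x. edge B y x)}"
  have eX: "edge B x c1" if "x \<in> X'" for x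
    using that touch edge_X XY_disjoint assms(1,2) by (fastforce simp: X'_def)
  have eY: "edge B y c2" if "y \<in> Y'" for y
    using that touch edge_Y XY_disjoint assms(1,2) by (fastforce simp: Y'_def)
  have "B \<subseteq> (X' \<union> Y') \<union> {c1, c2, z0}" using covered B_cases by (auto simp: X'_def Y'_def)
  then have "card B \<le> card ((X' \<union> Y') \<union> {c1, c2, z0})" by (intro card_mono) auto
  also have "\<dots> \<le> card (X' \<union> Y') + card {c1, c2, z0}" by (rule card_Un_le)
  also have "card {c1, c2, z0} \<le> 3" by (simp add: card_insert_if)
  finally have b: "card B \<le> card X' + card Y' + 3" using card_Un_le[of X' Y'] by linarith
  have "x1 \<in> X'" "x2 \<in> Y'"
    using x1 x2 edge_Y[OF x1(1)] edge_X[OF x2(1)] assms(1,2) edge_sym by (auto simp: X'_def Y'_def)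
  then have ne: "tr s X' \<noteq> {}" "tr t Y' \<noteq> {}"
    by (metis card_0_eq card_tr empty_iff finite_code)+
  have sub: "tr s X' \<subseteq> H" "tr t Y' \<subseteq> H"
    using XD YD by (force simp: X'_def Y'_def ac_simps)+
  have inB: "c1 \<in> B" "c2 \<in> B" "\<And>x. x \<in> X' \<Longrightarrow> x \<in> B" "\<And>y. y \<in> Y' \<Longrightarrow> y \<in> B"
    using assms(1,2) X_B Y_B by (auto simp: X'_def Y'_def)
  have nX: "x \<noteq> c1 \<and> x \<noteq> c2" if "x \<in> X'" for x
    using that XY_disjoint assms(1) by (auto simp: X'_def)
  have nY: "y \<noteq> c1 \<and> y \<noteq> c2" if "y \<in> Y'" for y
    using that XY_disjoint assms(2) by (auto simp: Y'_def)
  have d1: "(X' + Y') \<inter> tr c1 X' = {}"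
  proof (intro equals0I)
    fix v assume v: "v \<in> (X' + Y') \<inter> tr c1 X'"
    then obtain x y where xy: "x \<in> X'" "y \<in> Y'" "v = x + y" by (auto simp: set_plus_def)
    have "v + c1 \<in> X'" using v by simp
    then have "(v + c1) = x \<and> c1 = y \<or> (v + c1) = y \<and> c1 = x"
      using edge_same_sum[OF eX, of "v + c1" x y] xy inB by (simp add: ac_simps)
    then show False using nX[OF xy(1)] nY[OF xy(2)] by blast
  qed
  have d2: "(X' + Y') \<inter> tr c2 Y' = {}"
  proof (intro equals0I)
    fix v assume v: "v \<in> (X' + Y') \<inter> tr c2 Y'"
    then obtain x y where xy: "x \<in> X'" "y \<in> Y'" "v = x + y" by (auto simp: set_plus_def)
    have "v + c2 \<in> Y'" using v by simp
    then have "(v + c2) = x \<and> c2 = y \<or> (v + c2) = y \<and> c2 = x"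
      using edge_same_sum[OF eY, of "v + c2" x y] xy inB by (simp add: ac_simps)
    then show False using nX[OF xy(1)] nY[OF xy(2)] by blast
  qed
  have d3: "tr c1 X' \<inter> tr c2 Y' = {}"
  proof (intro equals0I)
    fix v assume v: "v \<in> tr c1 X' \<inter> tr c2 Y'"
    then have "v + c1 \<in> X'" "v + c2 \<in> Y'" by auto
    then have "(v + c1) = (v + c2) \<and> c1 = c2 \<or> (v + c1) = c2 \<and> c1 = v + c2"
      using edge_same_sum[OF eX, of "v + c1" "v + c2" c2] inB by (simp add: ac_simps)
    then show False using nX[OF \<open>v + c1 \<in> X'\<close>] XY_disjoint assms(1,2) by blast
  qed
  have "(X' + Y') \<union> tr c1 X' \<union> tr c2 Y' \<subseteq> tr (s + t) H"
  proof
    fix v assume "v \<in> (X' + Y') \<union> tr c1 X' \<union> tr c2 Y'"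
    then consider x y where "x \<in> X" "y \<in> Y" "v = x + y" | "v + c1 \<in> X" | "v + c2 \<in> Y"
      by (auto simp: X'_def Y'_def set_plus_def)
    then show "v \<in> tr (s + t) H"
    proof cases
      case 1 then show ?thesis using side_sum(1) XD YD by simp
    next
      case 2 then show ?thesis using side_sum(1)[OF XD[OF 2] YD[OF assms(1)]] by (simp add: ac_simps)
    next
      case 3 then show ?thesis using side_sum(1)[OF XD[OF assms(2)] YD[OF 3]] by (simp add: ac_simps)
    qed
  qed
  then have "card ((X' + Y') \<union> tr c1 X' \<union> tr c2 Y') \<le> card (tr (s + t) H)" by (intro card_mono) auto
  moreover have "card ((X' + Y') \<union> tr c1 X' \<union> tr c2 Y') = card (X' + Y') + card X' + card Y'"
    using d1 d2 d3 by (simp add: card_Un_disjoint Int_Un_distrib2)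
  ultimately have total: "card (X' + Y') + card X' + card Y' \<le> card H" by simp
  have "\<not> card H < 2 * (card X' + card Y')"
  proof
    assume "card H < 2 * (card X' + card Y')"
    then have "card H \<le> 2 * card (tr s X' + tr t Y')"
      using sumset_half[OF subgrp_H sub ne] by simp
    then have "card H \<le> 2 * card (X' + Y')" by (simp only: tr_set_plus card_tr)
    then show False using total \<open>card H < 2 * (card X' + card Y')\<close> by presburger
  qed
  then have "2 * card X' + 2 * card Y' \<le> card H" by simp
  then show False using b size card_H by linarith
qed

lemma no_two_centres:
  assumes "c1 \<noteq> c2" and x1: "edge B c1 x1" "x1 \<noteq> c2" and x2: "edge B c2 x2" "x2 \<noteq> c1"
    and touch: "\<And>x y. edge B x y \<Longrightarrow> x \<in> {c1, c2} \<or> y \<in> {c1, c2}"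
  shows False
proof -
  interpret sw: sided_cover B z0 Y X H t s by (rule swap)
  have "c1 \<in> X \<union> Y" "c2 \<in> X \<union> Y" using edgeD[OF x1(1)] edgeD[OF x2(1)] B_cases by auto
  then consider "c1 \<in> Y" "c2 \<in> Y" | "c1 \<in> X" "c2 \<in> X" | "c1 \<in> Y" "c2 \<in> X" | "c1 \<in> X" "c2 \<in> Y" by blast
  then show False
    using same_side_centres[OF assms(1) _ _ touch] sw.same_side_centres[OF assms(1) _ _ touch]
      opposite_centres[OF _ _ x1 x2 touch] sw.opposite_centres[OF _ _ x1 x2 touch] by cases blast+
qed

end

section \<open>Two disjoint edges across the hyperplane and their period\<close>

lemma sum_card_swap:
  assumes "finite A" "finite C"
  shows "(\<Sum>x\<in>A. card {z \<in> C. R z x}) = (\<Sum>z\<in>C. card {x \<in> A. R z x})"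
proof -
  have "card {z \<in> C. R z x} = (\<Sum>z\<in>C. if R z x then 1 else 0)" for x
    using assms by (simp add: sum.If_cases Int_def)
  moreover have "card {x \<in> A. R z x} = (\<Sum>x\<in>A. if R z x then 1 else 0)" for z
    using assms by (simp add: sum.If_cases Int_def)
  ultimately show ?thesis by (simp add: sum.swap[of _ A C])
qed

text \<open>The hypothesis \<open>free\<close> is the first alternative of
  \<open>edge_dichotomy\<close>. It also supplies the second edge, from any covered vertex other
  than a and b.\<close>

locale sided_free = sided_cover B z0 X Y H s t
  for B :: "'a::{char2,finite} set" and z0 X Y H s t +
  fixes a b c e :: 'a
  assumes ab: "edge B a b" and aX: "a \<in> X" and bY: "b \<in> Y"
    and ce: "edge B c e" and cX: "c \<in> X" and eY: "e \<in> Y"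
    and ac: "a \<noteq> c" and be: "b \<noteq> e"
    and free: "\<And>z. z \<notin> {a, b} \<Longrightarrow> \<exists>y. edge B z y \<Longrightarrow> \<exists>w. edge B z w \<and> w \<notin> {a, b}"
begin

text \<open>Elements of \<open>P\<close> come in pairs \<open>x, x + d\<close> inside \<open>B\<close>, and \<open>gap\<close> is the part of the side of \<open>Y\<close> not
  covered by \<open>QY\<close> and the copy \<open>a + b + QX\<close>, which by uniqueness of the sums \<open>a + b\<close> and \<open>c + e\<close> meet
  in four points only.\<close>

definition "d = a + b + (c + e)"
definition "PX = X \<inter> tr d X"
definition "QX = X \<union> tr d X"
definition "PY = Y \<inter> tr d Y"
definition "QY = Y \<union> tr d Y"
definition "gap = tr t H - (tr (a + b) QX \<union> QY)"

lemma d_eqs: "a + d = b + (c + e)" "b + d = a + (c + e)" "c + d = e + (a + b)" "e + d = c + (a + b)"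
    "a + b + d = c + e" "c + e + d = a + b"
  by (simp_all add: d_def ac_simps)

lemma neqs: "a \<noteq> e" "b \<noteq> c" "a \<noteq> b" "c \<noteq> e"
  using XY_disjoint aX bY cX eY by blast+

lemma d_nz: "d \<noteq> 0"
proof
  assume "d = 0"
  then have "a + b = c + e" by (simp add: d_def)
  then show False using edge_same_sum[OF ab, of c e] edgeD[OF ce] ac neqs by blast
qed

lemma u_H: "a + b + (s + t) \<in> H" "c + e + (s + t) \<in> H"
  using UD edge_sums_I ab ce by blast+

lemma d_H: "d \<in> H"
  using H_add[OF u_H] by (simp add: d_def ac_simps)

lemma d_side: "x + d + r \<in> H \<longleftrightarrow> x + r \<in> H"
  using H_add[OF d_H, of "x + r"] H_add[OF d_H, of "x + d + r"] by (auto simp: ac_simps)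

lemma card_PQ: "card PX + card QX = 2 * card X" "card PY + card QY = 2 * card Y"
  using card_Un_Int_eq[of X "tr d X"] card_Un_Int_eq[of Y "tr d Y"]
  by (simp_all add: PX_def QX_def PY_def QY_def)

lemma QX_side: "x \<in> QX \<Longrightarrow> x + s \<in> H" and QY_side: "y \<in> QY \<Longrightarrow> y + t \<in> H"
  using XD YD d_side by (auto simp: QX_def QY_def)

lemma QX_d: "x + d \<in> QX \<longleftrightarrow> x \<in> QX" and QY_d: "x + d \<in> QY \<longleftrightarrow> x \<in> QY"
  and PX_d: "x + d \<in> PX \<longleftrightarrow> x \<in> PX" and PY_d: "x + d \<in> PY \<longleftrightarrow> x \<in> PY"
  by (auto simp: QX_def QY_def PX_def PY_def add.assoc)

text \<open>For instance a + d = b + (c + e), so a + d in B would represent c + e through b.\<close>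

lemma not_P: "a \<notin> PX" "b \<notin> PY" "c \<notin> PX" "e \<notin> PY"
proof -
  show "a \<notin> PX" using edge_owner[OF ce, of b] X_B Y_B bY be neqs d_eqs(1) by (auto simp: PX_def ac_simps)
  show "b \<notin> PY" using edge_owner[OF ce, of a] X_B Y_B aX ac neqs d_eqs(2) by (auto simp: PY_def ac_simps)
  show "c \<notin> PX" using edge_owner[OF ab, of e] X_B Y_B eY be neqs d_eqs(3) by (auto simp: PX_def ac_simps)
  show "e \<notin> PY" using edge_owner[OF ab, of c] X_B Y_B cX ac neqs d_eqs(4) by (auto simp: PY_def ac_simps)
qed

text \<open>A common point comes from some y in Y with a + b + y or c + e + y in B, and uniqueness
  of these two sums leaves only y = b and y = e.\<close>

lemma Q_Int: "tr (a + b) QX \<inter> QY = {b, b + d, e, e + d}"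
proof
  show "tr (a + b) QX \<inter> QY \<subseteq> {b, b + d, e, e + d}"
  proof
    fix x assume x: "x \<in> tr (a + b) QX \<inter> QY"
    obtain y where y: "y \<in> Y" "x = y \<or> x = y + d" using x by (auto simp: QY_def add.assoc)
    obtain x' where x': "x' \<in> X" "x' = x + (a + b) \<or> x' = x + (a + b) + d"
      using x by (auto simp: QX_def)
    have "a + b + y \<in> B \<or> c + e + y \<in> B"
      using x' y(2) X_B[OF x'(1)] d_eqs(5)[symmetric] by (auto simp: ac_simps)
    then have "y \<in> {a, b, c, e}"
      using edge_owner[OF ab Y_B[OF y(1)]] edge_owner[OF ce Y_B[OF y(1)]] by blast
    then have "y = b \<or> y = e" using y(1) XY_disjoint aX cX by blast
    then show "x \<in> {b, b + d, e, e + d}" using y(2) by auto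
  qed
  have eqs: "b + (a + b) = a" "e + (a + b) = c + d" using d_eqs(3) by (simp_all add: ac_simps)
  have "a \<in> QX" "c + d \<in> QX" using aX cX QX_d[of c] by (auto simp: QX_def)
  then have "b \<in> tr (a + b) QX" "e \<in> tr (a + b) QX" unfolding mem_tr eqs by blast+
  moreover have "b + d + (a + b) = (b + (a + b)) + d" "e + d + (a + b) = (e + (a + b)) + d"
    by (simp_all add: ac_simps)
  then have "b + d \<in> tr (a + b) QX" "e + d \<in> tr (a + b) QX"
    unfolding mem_tr using QX_d \<open>a \<in> QX\<close> \<open>c + d \<in> QX\<close> by (simp_all only: eqs)
  moreover have "b \<in> QY" "e \<in> QY" using bY eY by (auto simp: QY_def)
  ultimately show "{b, b + d, e, e + d} \<subseteq> tr (a + b) QX \<inter> QY"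
    using QY_d by blast
qed

lemma card_Q_Int: "card (tr (a + b) QX \<inter> QY) = 4"
proof -
  have "b + d \<noteq> e"
  proof
    assume "b + d = e"
    then have "a = e + (c + e)" unfolding d_eqs(2) by (simp add: add_eq_iff)
    then show False using ac by (simp add: ac_simps)
  qed
  then have "b \<noteq> e + d" by (simp add: add_eq_iff)
  then show ?thesis using \<open>b + d \<noteq> e\<close> d_nz be unfolding Q_Int by (simp add: card_insert_if)
qed

lemma trQX_side: "tr (a + b) QX \<subseteq> tr t H"
proof
  fix x assume "x \<in> tr (a + b) QX"
  then have "x + (a + b) + (a + b) + t \<in> H" using side_sum(2)[OF QX_side u_H(1)] by simp
  then show "x \<in> tr t H" by (simp add: ac_simps)
qed

lemma card_gap: "card gap + card QX + card QY = card H + 4"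
proof -
  have sub: "tr (a + b) QX \<union> QY \<subseteq> tr t H" using trQX_side QY_side by auto
  then have "card gap = card H - card (tr (a + b) QX \<union> QY)"
    unfolding gap_def by (subst card_Diff_subset) auto
  moreover have "card (tr (a + b) QX \<union> QY) \<le> card H" using card_mono[OF _ sub] by simp
  ultimately show ?thesis using card_Un_Int_eq[of "tr (a + b) QX" QY] card_Q_Int by simp
qed

lemma gapI: "x + t \<in> H \<Longrightarrow> x + (a + b) \<notin> QX \<Longrightarrow> x \<notin> QY \<Longrightarrow> x \<in> gap"
  by (auto simp: gap_def)

text \<open>If v and v + d both lie in V, then v + a lies in the gap: v + a in \<open>QY\<close>, or
  v + b in \<open>QX\<close>, would write v or v + d as a sum of an element of B and a or b.\<close>

lemma card_doubles:
  assumes "V \<subseteq> U" and Va: "\<And>y. y \<in> B \<Longrightarrow> y + a \<notin> V" and Vb: "\<And>y. y \<in> B \<Longrightarrow> y + b \<notin> V"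
  shows "card (V \<inter> tr d V) \<le> card gap"
proof -
  have "tr a (V \<inter> tr d V) \<subseteq> gap"
  proof
    fix x assume "x \<in> tr a (V \<inter> tr d V)"
    then have x: "x + a \<in> V" "x + a + d \<in> V" by auto
    show "x \<in> gap"
    proof (rule gapI)
      show "x + t \<in> H"
        using side_sum(2)[OF XD[OF aX], of "x + a"] UD[of "x + a"] x assms(1) by (auto simp: ac_simps)
      show "x + (a + b) \<notin> QX"
        using Vb[of "x + (a + b)"] Vb[of "x + (a + b) + d"] x X_B by (auto simp: QX_def ac_simps)
      show "x \<notin> QY"
        using Va[of x] Va[of "x + d"] x Y_B by (auto simp: QY_def ac_simps)
    qed
  qed
  then show ?thesis using card_mono[of gap "tr a (V \<inter> tr d V)"] by simp
qed

text \<open>This is the first packing of \<open>disjoint_edges_bound\<close>, carried out inside the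
  single coset t + H.\<close>

lemma card_avoid_P:
  assumes "V \<subseteq> U" and Va: "\<And>y. y \<in> B \<Longrightarrow> y + a \<notin> V" and Vb: "\<And>y. y \<in> B \<Longrightarrow> y + b \<notin> V"
  shows "card (V \<union> tr d V) + card PX + card PY \<le> card H"
proof -
  let ?W = "V \<union> tr d V"
  have 1: "tr a ?W \<inter> tr (a + b) PX = {}"
  proof (intro equals0I)
    fix x assume "x \<in> tr a ?W \<inter> tr (a + b) PX"
    then show False using Vb[of "x + (a + b)"] Vb[of "x + (a + b) + d"] X_B by (auto simp: PX_def ac_simps)
  qed
  have 2: "tr a ?W \<inter> PY = {}"
  proof (intro equals0I)
    fix x assume "x \<in> tr a ?W \<inter> PY"
    then show False using Va[of x] Va[of "x + d"] Y_B by (auto simp: PY_def ac_simps)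
  qed
  have 3: "tr (a + b) PX \<inter> PY = {}"
  proof -
    have "tr (a + b) PX \<inter> PY \<subseteq> tr (a + b) QX \<inter> QY"
      by (auto simp: PX_def QX_def PY_def QY_def)
    then have "tr (a + b) PX \<inter> PY \<subseteq> {b, b + d, e, e + d}" unfolding Q_Int .
    moreover have "b \<notin> PY" "b + d \<notin> PY" "e \<notin> PY" "e + d \<notin> PY" using not_P PY_d by blast+
    ultimately show ?thesis by blast
  qed
  have "tr a ?W \<union> tr (a + b) PX \<union> PY \<subseteq> tr t H"
  proof
    fix x assume "x \<in> tr a ?W \<union> tr (a + b) PX \<union> PY"
    then consider "x + a \<in> V \<or> x + a + d \<in> V" | "x \<in> tr (a + b) QX" | "x \<in> QY"
      by (auto simp: PX_def QX_def PY_def QY_def)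
    then show "x \<in> tr t H"
    proof cases
      case 1
      then have "x + a + (s + t) \<in> H" using UD assms(1) d_side[of "x + a" "s + t"] by blast
      then show ?thesis using side_sum(2)[OF XD[OF aX], of "x + a"] by (simp add: ac_simps)
    qed (use trQX_side QY_side in auto)
  qed
  then have "card (tr a ?W \<union> tr (a + b) PX \<union> PY) \<le> card (tr t H)" by (intro card_mono) auto
  moreover have "card (tr a ?W \<union> tr (a + b) PX \<union> PY) = card (tr a ?W) + card (tr (a + b) PX) + card PY"
    using 1 2 3 by (subst card_Un_disjoint) (auto simp: card_Un_disjoint)
  ultimately show ?thesis by simp
qed

text \<open>Neither x0 nor x0 + d serves as an end for V, so the d-closure of V translated by x0
  avoids all of \<open>QY\<close> and not just \<open>PY\<close>.\<close>

lemma card_avoid_QY: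
  assumes "V \<subseteq> U" and x0: "x0 \<in> PX"
    and V0: "\<And>y. y \<in> B \<Longrightarrow> y + x0 \<notin> V" and V1: "\<And>y. y \<in> B \<Longrightarrow> y + (x0 + d) \<notin> V"
  shows "card (V \<union> tr d V) + card QY \<le> card H"
proof -
  let ?W = "V \<union> tr d V"
  have x0X: "x0 \<in> X" using x0 by (auto simp: PX_def)
  have "tr x0 ?W \<inter> QY = {}"
  proof (intro equals0I)
    fix x assume "x \<in> tr x0 ?W \<inter> QY"
    then show False using V0[of x] V0[of "x + d"] V1[of x] V1[of "x + d"] Y_B by (auto simp: QY_def ac_simps)
  qed
  moreover have "tr x0 ?W \<union> QY \<subseteq> tr t H"
  proof
    fix x assume "x \<in> tr x0 ?W \<union> QY"
    then consider "x + x0 \<in> V \<or> x + x0 + d \<in> V" | "x \<in> QY" by auto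
    then show "x \<in> tr t H"
    proof cases
      case 1
      then have "x + x0 + (s + t) \<in> H" using UD assms(1) d_side[of "x + x0" "s + t"] by blast
      then show ?thesis using side_sum(2)[OF XD[OF x0X], of "x + x0"] by (simp add: ac_simps)
    qed (use QY_side in auto)
  qed
  then have "card (tr x0 ?W \<union> QY) \<le> card (tr t H)" by (intro card_mono) auto
  ultimately show ?thesis using card_Un_disjoint[of "tr x0 ?W" QY] by simp
qed

section \<open>Sums of chosen edges avoiding a and b\<close>

definition "g z = (SOME w. edge B z w \<and> w \<notin> {a, b})"
definition "ES S = (\<lambda>z. z + g z) ` S"

lemma g:
  assumes "z \<in> B - {z0, a, b}"
  shows "edge B z (g z)" "g z \<notin> {a, b}"
  using someI_ex[OF free, of z] covered[of z] assms unfolding g_def by auto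

lemma ES_owner:
  assumes "S \<subseteq> B - {z0, a, b}" "z \<in> S" "x \<in> B" "y \<in> B" "y + x = z + g z"
  shows "x = z \<or> x = g z"
  using edge_same_sum[OF g(1), of z y x] assms by auto

lemma ES_U: "S \<subseteq> B - {z0, a, b} \<Longrightarrow> ES S \<subseteq> U"
  unfolding ES_def using edge_sums_I[OF g(1)] by blast

lemma ES_inj:
  assumes "S \<subseteq> B - {z0, a, b}" "\<And>z. z \<in> S \<Longrightarrow> g z \<notin> S"
  shows "inj_on (\<lambda>z. z + g z) S"
proof (rule inj_onI)
  fix x y assume xy: "x \<in> S" "y \<in> S" "x + g x = y + g y"
  then have "x = y \<or> x = g y"
    using ES_owner[OF assms(1) xy(2), of x "g x"] edgeD[OF g(1)[of x]] assms(1) by (auto simp: ac_simps)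
  then show "x = y" using assms(2)[OF xy(2)] xy(1) by auto
qed

lemma card_ES:
  "S \<subseteq> B - {z0, a, b} \<Longrightarrow> (\<And>z. z \<in> S \<Longrightarrow> g z \<notin> S) \<Longrightarrow> card (ES S) = card S"
  unfolding ES_def by (rule card_image[OF ES_inj])

lemma ES_avoid:
  assumes "S \<subseteq> B - {z0, a, b}" "y \<in> B" "x \<in> B" "x \<notin> S" "\<And>z. z \<in> S \<Longrightarrow> g z \<noteq> x"
  shows "y + x \<notin> ES S"
proof
  assume "y + x \<in> ES S"
  then obtain z where z: "z \<in> S" "y + x = z + g z" by (auto simp: ES_def)
  then show False using ES_owner[OF assms(1) z(1) assms(3,2) z(2)] assms(4,5) by blast
qed

lemma ES_avoid_ab:
  assumes "S \<subseteq> B - {z0, a, b}" "y \<in> B"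
  shows "y + a \<notin> ES S" "y + b \<notin> ES S"
  using ES_avoid[OF assms, of a] ES_avoid[OF assms, of b] edgeD[OF ab] g(2) assms(1) by blast+

text \<open>Choose edges at all of X except four points. \<open>card_avoid_QY\<close> and the bound
  on doubled sums give 2|X| - 8 - |gap| \<le> |H| - |QY|; eliminating |H| by \<open>card_gap\<close>
  and |X| by \<open>card_PQ\<close> leaves |PX| and the gap.\<close>

lemma card_PX_le: "card PX \<le> 2 * card gap + 4"
proof (cases "PX = {}")
  case False
  then obtain x0 where x0: "x0 \<in> PX" by blast
  then have x0X: "x0 \<in> X" "x0 + d \<in> X" by (auto simp: PX_def)
  define S where "S = X - {z0, a, x0, x0 + d}"
  have S: "S \<subseteq> B - {z0, a, b}" using X_B bY XY_disjoint by (auto simp: S_def)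
  have gY: "g z \<in> Y" if "z \<in> S" for z using edge_X[OF g(1)] that S by (auto simp: S_def)
  have "X \<subseteq> S \<union> {z0, a, x0, x0 + d}" by (auto simp: S_def)
  then have "card X \<le> card (S \<union> {z0, a, x0, x0 + d})" by (intro card_mono) auto
  also have "\<dots> \<le> card S + card {z0, a, x0, x0 + d}" by (rule card_Un_le)
  also have "card {z0, a, x0, x0 + d} \<le> 4" by (simp add: card_insert_if)
  finally have "card X \<le> card S + 4" by simp
  moreover have "card (ES S) = card S"
    using gY XY_disjoint by (intro card_ES[OF S]) (auto simp: S_def)
  moreover have "card (ES S \<union> tr d (ES S)) + card QY \<le> card H"
  proof (rule card_avoid_QY[OF ES_U[OF S] x0])
    fix y assume y: "y \<in> B"
    have ne: "g z \<noteq> x0" "g z \<noteq> x0 + d" if "z \<in> S" for z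
      using gY[OF that] XY_disjoint[OF x0X(1)] XY_disjoint[OF x0X(2)] by auto
    show "y + x0 \<notin> ES S" using ne(1) X_B[OF x0X(1)] by (intro ES_avoid[OF S y]) (auto simp: S_def)
    show "y + (x0 + d) \<notin> ES S" using ne(2) X_B[OF x0X(2)] by (intro ES_avoid[OF S y]) (auto simp: S_def)
  qed
  moreover have "card (ES S \<inter> tr d (ES S)) \<le> card gap"
    using ES_avoid_ab[OF S] by (intro card_doubles[OF ES_U[OF S]]) auto
  ultimately show ?thesis
    using card_Un_Int_eq[of "ES S" "tr d (ES S)"] card_PQ(1) card_gap by simp
qed simp

lemma swap_free: "sided_free B z0 Y X H t s b a e c"
proof -
  interpret sw: sided_cover B z0 Y X H t s by (rule swap)
  show ?thesis
    using ab ce aX bY cX eY ac be free by unfold_locales (auto simp: edge_sym insert_commute)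
qed

lemma card_PY_le: "card PY \<le> 2 * card gap + 4"
proof -
  interpret sw: sided_free B z0 Y X H t s b a e c by (rule swap_free)
  have "sw.d = d" by (simp add: sw.d_def d_def ac_simps)
  then have "sw.PX = PY" "sw.QX = QY" "sw.QY = QX"
    by (simp_all add: sw.PX_def sw.QX_def sw.QY_def PY_def QX_def QY_def)
  then show ?thesis using sw.card_PX_le sw.card_gap card_gap by simp
qed

section \<open>Counting the edge sums at paired vertices against the gap\<close>

definition "P = PX \<union> PY"
definition "S3 = P - {z0}"
definition "W = ES S3 \<union> tr d (ES S3)"

lemma P_B: "p \<in> P \<Longrightarrow> p \<in> B" and P_d: "p + d \<in> P \<longleftrightarrow> p \<in> P"
  using X_B Y_B PX_d PY_d by (auto simp: P_def PX_def PY_def)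

text \<open>The sum p + q is represented a second time as (p + d) + (q + d).\<close>

lemma P_indep:
  assumes "p \<in> P" "q \<in> P" shows "\<not> edge B p q"
proof
  assume e: "edge B p q"
  have "p + d \<in> B" "q + d \<in> B" using assms P_B P_d by blast+
  moreover have "p + q = (p + d) + (q + d)" by (simp add: ac_simps)
  ultimately have "p = p + d \<or> p = q + d" using edge_same_sum[OF e, of "p + d" "q + d"] by blast
  then have "p = q + d" using d_nz by simp
  moreover have "p \<in> X \<and> q + d \<in> Y \<or> p \<in> Y \<and> q + d \<in> X"
    using edge_sides[OF e] assms XY_disjoint by (auto simp: P_def PX_def PY_def)
  ultimately show False using XY_disjoint by blast
qed

lemma S3: "S3 \<subseteq> B - {z0, a, b}"
proof -
  have "a \<notin> P" "b \<notin> P" using not_P aX bY XY_disjoint by (auto simp: P_def PX_def PY_def)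
  then show ?thesis using P_B by (auto simp: S3_def)
qed

lemma g_S3: "z \<in> S3 \<Longrightarrow> g z \<notin> P"
  using P_indep g(1) S3 by (auto simp: S3_def)

lemma card_S3: "card (ES S3) = card S3" "card PX + card PY \<le> card S3 + 1"
proof -
  show "card (ES S3) = card S3" using g_S3 by (intro card_ES[OF S3]) (auto simp: S3_def)
  have "card P = card PX + card PY"
    unfolding P_def using XY_disjoint by (intro card_Un_disjoint) (auto simp: PX_def PY_def)
  moreover have "card P \<le> card (S3 \<union> {z0})" by (intro card_mono) (auto simp: S3_def)
  ultimately show "card PX + card PY \<le> card S3 + 1" using card_Un_le[of S3 "{z0}"] by simp
qed

lemma card_doubles_S3: "card (ES S3 \<inter> tr d (ES S3)) \<le> card gap"
  using ES_avoid_ab[OF S3] by (intro card_doubles[OF ES_U[OF S3]]) auto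

lemma card_W: "card W + card (ES S3 \<inter> tr d (ES S3)) = 2 * card S3"
  unfolding W_def using card_Un_Int_eq[of "ES S3" "tr d (ES S3)"] card_S3(1) by simp

lemma card_W_P: "card W + card PX + card PY \<le> card H"
  unfolding W_def using ES_avoid_ab[OF S3] by (intro card_avoid_P[OF ES_U[OF S3]]) auto

lemma card_B: "card B = card X + card Y"
  unfolding B_eq using XY_disjoint by (intro card_Un_disjoint) auto

text \<open>For p in \<open>P\<close> and w in \<open>W\<close>, the sum w + p avoids B and its
  d-translate unless w stems, up to d, from the edge chosen at p or at p + d. These exceptions are
  the error terms below.\<close>

definition "own p = {w. \<exists>q\<in>S3. (q = p \<or> q = p + d) \<and> (w = q + g q \<or> w = q + g q + d)}"

lemma own_I:
  assumes p: "p \<in> P" and w: "w \<in> W" and "w + p \<in> B \<or> w + p + d \<in> B"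
  shows "w \<in> own p"
proof -
  obtain z where z: "z \<in> S3" "z + g z = w \<or> z + g z = w + d"
    using w by (auto simp: W_def ES_def)
  obtain y where y: "y \<in> B" "y = w + p \<or> y = w + p + d" using assms(3) by blast
  define p' where "p' = y + (z + g z)"
  have p': "p' = p \<or> p' = p + d" using z(2) y(2) by (auto simp: p'_def ac_simps)
  then have p'P: "p' \<in> P" using p P_d by blast
  have "y + p' = z + g z" by (simp add: p'_def)
  then have "p' = z \<or> p' = g z" using ES_owner[OF S3 z(1) P_B[OF p'P] y(1)] by blast
  then have "z = p'" using g_S3[OF z(1)] p'P by blast
  then have "z = p \<or> z = p + d" using p' by blast
  moreover have "w = z + g z \<or> w = z + g z + d"
    using z(2)
  proof
    assume eq: "z + g z = w + d"
    show ?thesis unfolding eq by (simp add: add.assoc)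
  qed simp
  ultimately show ?thesis using z(1) unfolding own_def by blast
qed

lemma card_own: "card (own p) \<le> 4"
proof -
  let ?F = "{p + g p, p + g p + d, p + d + g (p + d), p + d + g (p + d) + d}"
  have "own p \<subseteq> ?F" by (auto simp: own_def)
  then have "card (own p) \<le> card ?F" by (intro card_mono) auto
  also have "\<dots> \<le> 4" by (simp add: card_insert_if)
  finally show ?thesis .
qed

text \<open>Chosen edges at different vertices of \<open>S3\<close> have different sums, so w and w
  + d come from at most one vertex each.\<close>

lemma card_owners: "card {p. w \<in> own p} \<le> 4"
proof -
  define Q where "Q = {q \<in> S3. q + g q \<in> {w, w + d}}"
  have "inj_on (\<lambda>z. z + g z) S3" using g_S3 by (intro ES_inj[OF S3]) (auto simp: S3_def)
  then have "inj_on (\<lambda>z. z + g z) Q" by (rule inj_on_subset) (auto simp: Q_def)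
  then have "card Q \<le> card {w, w + d}" by (rule card_inj_on_le) (auto simp: Q_def)
  also have "\<dots> \<le> 2" by (simp add: card_insert_if)
  finally have "card Q \<le> 2" .
  have "{p. w \<in> own p} \<subseteq> Q \<union> tr d Q"
    by (auto simp: own_def Q_def add.assoc)
  then have "card {p. w \<in> own p} \<le> card (Q \<union> tr d Q)" by (intro card_mono) auto
  also have "\<dots> \<le> card Q + card (tr d Q)" by (rule card_Un_le)
  finally show ?thesis using \<open>card Q \<le> 2\<close> by simp
qed

lemma W_side: "w \<in> W \<Longrightarrow> w + (s + t) \<in> H"
  using UD ES_U[OF S3] d_side by (auto simp: W_def)

lemma card_QX_diff: "card (tr (a + b) QX - QY) + 4 = card QX"
  using card_Int_Diff[of "tr (a + b) QX" QY] card_Q_Int by simp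

lemma card_QY_diff: "card (QY - tr (a + b) QX) + 4 = card QY"
  using card_Int_Diff[of QY "tr (a + b) QX"] card_Q_Int by (simp add: Int_commute)

text \<open>Apart from the at most four elements of \<open>own x\<close>, the translate of
  \<open>W\<close> by x misses \<open>QY\<close>. It is thus divided between the gap and the part of
  a + b + \<open>QX\<close> outside \<open>QY\<close>, which has |QX| - 4 elements; the two fours
  cancel.\<close>

lemma card_W_X:
  assumes x: "x \<in> PX"
  shows "card W \<le> card {z \<in> gap. z + x \<in> W} + card QX"
proof -
  have xX: "x \<in> X" "x \<in> P" using x by (auto simp: PX_def P_def)
  have "tr x W \<subseteq> {z \<in> gap. z + x \<in> W} \<union> ((tr (a + b) QX - QY) \<union> tr x (own x))"
  proof
    fix z assume "z \<in> tr x W"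
    then have zW: "z + x \<in> W" by simp
    have zt: "z + t \<in> H" using side_sum(2)[OF XD[OF xX(1)] W_side[OF zW]] by (simp add: ac_simps)
    show "z \<in> {z \<in> gap. z + x \<in> W} \<union> ((tr (a + b) QX - QY) \<union> tr x (own x))"
    proof (cases "z \<in> QY")
      case True
      then have "z + x + x \<in> B \<or> z + x + x + d \<in> B" using Y_B by (auto simp: QY_def add.assoc)
      then show ?thesis using own_I[OF xX(2) zW] by simp
    next
      case False
      then show ?thesis using gapI[OF zt] zW by auto
    qed
  qed
  then have "card (tr x W) \<le> card ({z \<in> gap. z + x \<in> W} \<union> ((tr (a + b) QX - QY) \<union> tr x (own x)))"
    by (intro card_mono) auto
  also have "\<dots> \<le> card {z \<in> gap. z + x \<in> W} + (card (tr (a + b) QX - QY) + card (tr x (own x)))"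
    by (intro order_trans[OF card_Un_le] add_left_mono card_Un_le)
  finally show ?thesis using card_QX_diff card_own[of x] by simp
qed

lemma card_W_Y:
  assumes y: "y \<in> PY"
  shows "card W \<le> card {z \<in> gap. z + (a + b + y) \<in> W} + card QY"
proof -
  have yY: "y \<in> Y" "y \<in> P" using y by (auto simp: PY_def P_def)
  let ?r = "a + b + y"
  have "tr ?r W \<subseteq> {z \<in> gap. z + ?r \<in> W} \<union> ((QY - tr (a + b) QX) \<union> tr ?r (own y))"
  proof
    fix z assume "z \<in> tr ?r W"
    then have zW: "z + ?r \<in> W" by simp
    have "y + (z + ?r) + s \<in> H" using side_sum(3)[OF YD[OF yY(1)] W_side[OF zW]] .
    then have "z + (a + b) + s \<in> H" by (simp add: ac_simps)
    from side_sum(2)[OF this u_H(1)] have zt: "z + t \<in> H" by (simp add: ac_simps)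
    show "z \<in> {z \<in> gap. z + ?r \<in> W} \<union> ((QY - tr (a + b) QX) \<union> tr ?r (own y))"
    proof (cases "z + (a + b) \<in> QX")
      case True
      have eq: "z + ?r + y = z + (a + b)" by (simp add: ac_simps)
      have "z + ?r + y \<in> B \<or> z + ?r + y + d \<in> B" unfolding eq using True X_B by (auto simp: QX_def)
      then show ?thesis using own_I[OF yY(2) zW] by simp
    next
      case False
      then show ?thesis using gapI[OF zt] zW by auto
    qed
  qed
  then have "card (tr ?r W) \<le> card ({z \<in> gap. z + ?r \<in> W} \<union> ((QY - tr (a + b) QX) \<union> tr ?r (own y)))"
    by (intro card_mono) auto
  also have "\<dots> \<le> card {z \<in> gap. z + ?r \<in> W} + (card (QY - tr (a + b) QX) + card (tr ?r (own y)))"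
    by (intro order_trans[OF card_Un_le] add_left_mono card_Un_le)
  finally show ?thesis using card_QY_diff card_own[of y] by simp
qed

text \<open>The fourth point of the parallelogram is reached by adding x to z + (a + b + y), which
  keeps it out of \<open>QY\<close>, and, up to a + b, by adding y to z + x, which keeps it out of a
  + b + \<open>QX\<close>. The exceptions are owned elements.\<close>

lemma completion:
  assumes z: "z \<in> gap" and x: "x \<in> PX" "z + x \<in> W" and y: "y \<in> PY" "z + (a + b + y) \<in> W"
  shows "z + x + (a + b + y) \<in> gap \<or> z + (a + b + y) \<in> own x \<or> z + x \<in> own y"
proof -
  have xX: "x \<in> X" "x \<in> P" and yP: "y \<in> P" using x y by (auto simp: PX_def PY_def P_def)
  let ?r = "z + x + (a + b + y)"
  have "?r + t \<in> H" using side_sum(2)[OF XD[OF xX(1)] W_side[OF y(2)]] by (simp add: ac_simps)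
  moreover have "z + (a + b + y) \<in> own x" if "?r \<in> QY"
  proof -
    have eq: "z + (a + b + y) + x = ?r" by (simp add: ac_simps)
    have "z + (a + b + y) + x \<in> B \<or> z + (a + b + y) + x + d \<in> B"
      unfolding eq using that Y_B by (auto simp: QY_def)
    then show ?thesis by (rule own_I[OF xX(2) y(2)])
  qed
  moreover have "z + x \<in> own y" if "?r + (a + b) \<in> QX"
  proof -
    have eq: "z + x + y = ?r + (a + b)" by (simp add: ac_simps)
    have "z + x + y \<in> B \<or> z + x + y + d \<in> B"
      unfolding eq using that X_B by (auto simp: QX_def)
    then show ?thesis by (rule own_I[OF yP x(2)])
  qed
  ultimately show ?thesis using gapI by blast
qed

text \<open>If both fibres are nonempty, a fixed point of one maps the other injectively into the
  gap by \<open>completion\<close>, with at most 4 + 4 exceptions. If one is empty, the bound on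
  |PX| or |PY| alone suffices for the other.\<close>

lemma fibre_bound:
  assumes z: "z \<in> gap"
  shows "card {x \<in> PX. z + x \<in> W} + card {y \<in> PY. z + (a + b + y) \<in> W} \<le> 2 * card gap + 16"
proof -
  let ?A = "{x \<in> PX. z + x \<in> W}" and ?C = "{y \<in> PY. z + (a + b + y) \<in> W}"
  have C: "card ?C \<le> card gap + 8" if xA: "x \<in> ?A" for x
  proof -
    have "?C \<subseteq> tr (z + x + (a + b)) gap \<union> (tr (z + (a + b)) (own x) \<union> {p. z + x \<in> own p})"
    proof
      fix y assume y: "y \<in> ?C"
      then have "z + x + (a + b + y) \<in> gap \<or> z + (a + b + y) \<in> own x \<or> z + x \<in> own y"
        using completion[OF z] xA by blast
      moreover have "z + x + (a + b + y) = y + (z + x + (a + b))" "z + (a + b + y) = y + (z + (a + b))"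
        by (simp_all add: ac_simps)
      ultimately show "y \<in> tr (z + x + (a + b)) gap \<union> (tr (z + (a + b)) (own x) \<union> {p. z + x \<in> own p})"
        by simp
    qed
    then have "card ?C \<le> card (tr (z + x + (a + b)) gap \<union> (tr (z + (a + b)) (own x) \<union> {p. z + x \<in> own p}))"
      by (intro card_mono) auto
    also have "\<dots> \<le> card (tr (z + x + (a + b)) gap) + (card (tr (z + (a + b)) (own x)) + card {p. z + x \<in> own p})"
      by (intro order_trans[OF card_Un_le] add_left_mono card_Un_le)
    finally show ?thesis using card_own[of x] card_owners[of "z + x"] by simp
  qed
  have A: "card ?A \<le> card gap + 8" if yC: "y \<in> ?C" for y
  proof -
    have "?A \<subseteq> tr (z + (a + b + y)) gap \<union> (tr z (own y) \<union> {p. z + (a + b + y) \<in> own p})"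
    proof
      fix x assume x: "x \<in> ?A"
      then have "z + x + (a + b + y) \<in> gap \<or> z + (a + b + y) \<in> own x \<or> z + x \<in> own y"
        using completion[OF z] yC by blast
      moreover have eqs: "x + (z + (a + b + y)) = z + x + (a + b + y)" "x + z = z + x"
        by (simp_all add: ac_simps)
      ultimately show "x \<in> tr (z + (a + b + y)) gap \<union> (tr z (own y) \<union> {p. z + (a + b + y) \<in> own p})"
        unfolding Un_iff mem_tr mem_Collect_eq eqs by blast
    qed
    then have "card ?A \<le> card (tr (z + (a + b + y)) gap \<union> (tr z (own y) \<union> {p. z + (a + b + y) \<in> own p}))"
      by (intro card_mono) auto
    also have "\<dots> \<le> card (tr (z + (a + b + y)) gap) + (card (tr z (own y)) + card {p. z + (a + b + y) \<in> own p})"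
      by (intro order_trans[OF card_Un_le] add_left_mono card_Un_le)
    finally show ?thesis using card_own[of y] card_owners[of "z + (a + b + y)"] by simp
  qed
  have "card ?A \<le> card PX" "card ?C \<le> card PY" by (auto intro!: card_mono)
  show ?thesis
  proof (cases "?A = {} \<or> ?C = {}")
    case True
    then have "card ?A = 0 \<or> card ?C = 0" by (elim disjE) (simp_all only: card.empty simp_thms)
    then show ?thesis using \<open>card ?A \<le> card PX\<close> \<open>card ?C \<le> card PY\<close> card_PX_le card_PY_le by linarith
  next
    case False
    then obtain x y where "x \<in> ?A" "y \<in> ?C" by blast
    then show ?thesis using A C by fastforce
  qed
qed

text \<open>Incidences between paired vertices and gap points are counted from both ends, by
  \<open>card_W_X\<close> and \<open>card_W_Y\<close> on one side and \<open>fibre_bound\<close> on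
  the other. Integers are used because |W| - |QX| may be negative.\<close>

lemma double_count:
  "int (card PX) * (int (card W) - int (card QX)) + int (card PY) * (int (card W) - int (card QY))
    \<le> int (card gap) * (2 * int (card gap) + 16)"
proof -
  have X: "int (card PX) * (int (card W) - int (card QX)) \<le> int (\<Sum>x\<in>PX. card {z \<in> gap. z + x \<in> W})"
  proof -
    have "(\<Sum>x\<in>PX. int (card W) - int (card QX)) \<le> (\<Sum>x\<in>PX. int (card {z \<in> gap. z + x \<in> W}))"
    proof (rule sum_mono)
      fix x assume "x \<in> PX"
      from card_W_X[OF this] show "int (card W) - int (card QX) \<le> int (card {z \<in> gap. z + x \<in> W})" by linarith
    qed
    then show ?thesis by simp
  qed
  have Y: "int (card PY) * (int (card W) - int (card QY)) \<le> int (\<Sum>y\<in>PY. card {z \<in> gap. z + (a + b + y) \<in> W})"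
  proof -
    have "(\<Sum>y\<in>PY. int (card W) - int (card QY)) \<le> (\<Sum>y\<in>PY. int (card {z \<in> gap. z + (a + b + y) \<in> W}))"
    proof (rule sum_mono)
      fix y assume "y \<in> PY"
      from card_W_Y[OF this] show "int (card W) - int (card QY) \<le> int (card {z \<in> gap. z + (a + b + y) \<in> W})" by linarith
    qed
    then show ?thesis by simp
  qed
  have "(\<Sum>x\<in>PX. card {z \<in> gap. z + x \<in> W}) + (\<Sum>y\<in>PY. card {z \<in> gap. z + (a + b + y) \<in> W})
      = (\<Sum>z\<in>gap. card {x \<in> PX. z + x \<in> W} + card {y \<in> PY. z + (a + b + y) \<in> W})"
    by (simp add: sum_card_swap[of PX gap] sum_card_swap[of PY gap] sum.distrib)
  also have "\<dots> \<le> (\<Sum>z\<in>gap. 2 * card gap + 16)" by (rule sum_mono) (rule fibre_bound)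
  also have "\<dots> = card gap * (2 * card gap + 16)" by simp
  finally have "int (\<Sum>x\<in>PX. card {z \<in> gap. z + x \<in> W}) + int (\<Sum>y\<in>PY. card {z \<in> gap. z + (a + b + y) \<in> W})
      \<le> int (card gap * (2 * card gap + 16))" by linarith
  then show ?thesis using X Y by simp
qed

lemma contradiction: False
proof -
  define pX pY qX qY w r n m where "pX = int (card PX)" and "pY = int (card PY)" and "qX = int (card QX)"
    and "qY = int (card QY)" and "w = int (card W)" and "r = int (card gap)" and "n = int (card H)"
    and "m = 2 * int (card B) - int (card H)"
  note defs = pX_def pY_def qX_def qY_def w_def r_def n_def m_def
  have nn: "0 \<le> pX" "0 \<le> pY" "0 \<le> r" "0 \<le> n" by (simp_all add: defs)
  have q: "r + qX + qY = n + 4" using card_gap by (simp add: defs)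
  have p: "pX + pY = m + r - 4" using card_PQ card_B q by (simp add: defs)
  \<comment> \<open>The size hypothesis in terms of m = 2|B| - |H|. With the coefficient 9 the
    products of m and r cancel in the final estimate.\<close>
  have m: "2 * n + 72 < 9 * m" using size card_H by (simp add: defs)
  have pX: "pX \<le> 2 * r + 4" and pY: "pY \<le> 2 * r + 4" using card_PX_le card_PY_le by (simp_all add: defs)
  have w: "w \<ge> 2 * pX + 2 * pY - 2 - r" using card_W card_S3(2) card_doubles_S3 by (simp add: defs)
  have wP: "2 * pX + 2 * pY - 2 \<le> n - pX - pY + r"
    using card_W card_S3(2) card_doubles_S3 card_W_P by (simp add: defs)
  show False
  proof (cases "PX = {} \<or> PY = {}")
    case True
    then have "pX = 0 \<or> pY = 0" by (auto simp: defs)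
    then have "m + r - 4 \<le> 2 * r + 4" using p pX pY by linarith
    then show False using wP p m nn by linarith
  next
    case False
    then obtain x y where x: "x \<in> PX" and y: "y \<in> PY" by blast
    \<comment> \<open>A vertex of \<open>PX\<close> fails to reach at most sX points of the gap, a
      vertex of \<open>PY\<close> at most sY.\<close>
    define sX sY where "sX = r + qX - w" and "sY = r + qY - w"
    have "card {z \<in> gap. z + x \<in> W} \<le> card gap" "card {z \<in> gap. z + (a + b + y) \<in> W} \<le> card gap"
      by (auto intro!: card_mono)
    then have s0: "0 \<le> sX" "0 \<le> sY" using card_W_X[OF x] card_W_Y[OF y] by (simp_all add: sX_def sY_def defs)
    have "sX + sY \<le> n - r + 24 - 4 * m" using w q p by (simp add: sX_def sY_def)
    then have S: "2 * sX + 2 * sY \<le> m - 25 - 2 * r" using m by linarith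
    have "pX * (r - sX) + pY * (r - sY) \<le> r * (2 * r + 16)"
      using double_count by (simp add: sX_def sY_def defs)
    moreover have "pX * sX \<le> (2 * r + 4) * sX" "pY * sY \<le> (2 * r + 4) * sY"
      using pX pY s0 by (auto intro!: mult_right_mono)
    ultimately have "(pX + pY) * r \<le> r * (2 * r + 16) + (2 * r + 4) * (sX + sY)"
      by (simp add: algebra_simps)
    also have "(2 * r + 4) * (sX + sY) = (r + 2) * (2 * sX + 2 * sY)" by (simp add: algebra_simps)
    also have "\<dots> \<le> (r + 2) * (m - 25 - 2 * r)" using S nn by (intro mult_left_mono) auto
    \<comment> \<open>This makes m at least quadratic in r, whereas |PX|, |PY| \<le> 2r + 4 bound m
      linearly.\<close>
    finally have "r * r + 9 * r + 50 \<le> 2 * m" unfolding p by (simp add: algebra_simps)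
    moreover have "m \<le> 3 * r + 12" using p pX pY by linarith
    moreover have "0 \<le> r * r" by simp
    ultimately show False using nn by linarith
  qed
qed

end

lemma (in edge_cover) no_hyperplane:
  assumes nonstar: "\<And>c. \<exists>x y. edge B x y \<and> x \<noteq> c \<and> y \<noteq> c"
    and H: "subgrp H" "U \<inter> H = {}" "\<And>g u. u \<in> U \<Longrightarrow> g \<in> H \<or> g + u \<in> H"
  shows False
proof -
  obtain x0 y0 where e0: "edge B x0 y0" using nonstar by blast
  define u where "u = x0 + y0"
  have u: "u \<in> U" using edge_sums_I[OF e0] by (simp add: u_def)
  then have uH: "u \<notin> H" using H(2) by blast
  have compl: "x + u \<in> H \<longleftrightarrow> x \<notin> H" for x
    using H(3)[OF u, of x] subgrp_add_iff(1)[OF H(1), of x u] uH by blast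
  have "subgrp (UNIV :: 'a set)" by (simp add: subgrp_def)
  then have "CARD('a) = 2 * card (UNIV \<inter> H)"
    using card_split_hyperplane[of UNIV H u] H(1) uH H(3)[OF u] by blast
  then have card_H: "2 * card H = CARD('a)" by simp
  interpret sided_cover B z0 "B - H" "B \<inter> H" H u 0
  proof
    show "B = (B - H) \<union> (B \<inter> H)" by blast
    show "u + 0 \<notin> H" using uH by simp
    show "B - H \<subseteq> tr u H" unfolding tr_def compl by blast
    show "B \<inter> H \<subseteq> tr 0 H" unfolding tr_def add_0_right by blast
    show "U \<subseteq> tr (u + 0) H" unfolding tr_def add_0_right compl using H(2) by blast
  qed (fact H(1) card_H)+
  consider a b where "edge B a b"
      "\<And>z. z \<notin> {a, b} \<Longrightarrow> \<exists>y. edge B z y \<Longrightarrow> \<exists>w. edge B z w \<and> w \<notin> {a, b}"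
    | c1 c2 x1 x2 where "c1 \<noteq> c2" "edge B c1 x1" "edge B c2 x2" "x1 \<noteq> c2" "x2 \<noteq> c1"
      "\<And>x y. edge B x y \<Longrightarrow> x \<in> {c1, c2} \<or> y \<in> {c1, c2}"
    using edge_dichotomy[OF nonstar] by blast
  then show False
  proof cases
    case 2
    then show False using no_two_centres[of c1 c2 x1 x2] by blast
  next
    case (1 a' b')
    obtain a b where ab: "edge B a b" "a \<in> B - H" "b \<in> B \<inter> H"
      and free: "\<And>z. z \<notin> {a, b} \<Longrightarrow> \<exists>y. edge B z y \<Longrightarrow> \<exists>w. edge B z w \<and> w \<notin> {a, b}"
    proof (cases "a' \<in> B - H")
      case True
      then show ?thesis using that[of a' b'] edge_X[OF 1(1)] 1 by blast
    next
      case False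
      have "b' \<in> B - H" "a' \<in> B \<inter> H" using False edge_sides[OF 1(1)] by blast+
      moreover have "\<And>z. z \<notin> {b', a'} \<Longrightarrow> \<exists>y. edge B z y \<Longrightarrow> \<exists>w. edge B z w \<and> w \<notin> {b', a'}"
        using 1(2) unfolding insert_commute[of b' a'] .
      ultimately show ?thesis by (rule that[OF edge_sym[OF 1(1)]])
    qed
    have "card (B - {a, b, z0}) > 0"
    proof -
      have "card B \<le> card (B - {a, b, z0}) + card {a, b, z0}"
        using diff_card_le_card_Diff[of "{a, b, z0}" B] by simp
      moreover have "card {a, b, z0} \<le> 3" by (simp add: card_insert_if)
      ultimately show ?thesis using size by linarith
    qed
    then obtain z where "z \<in> B - {a, b, z0}" by (auto simp: card_gt_0_iff)
    then obtain w where zw: "edge B z w" "z \<notin> {a, b}" "w \<notin> {a, b}" using free[of z] covered[of z] by auto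
    then obtain c e where ce: "edge B c e" "c \<in> B - H" "e \<in> B \<inter> H" "c \<notin> {a, b}" "e \<notin> {a, b}"
      using edge_sides[OF zw(1)] edge_sym by blast
    interpret sided_free B z0 "B - H" "B \<inter> H" H u 0 a b c e
    proof
      show "a \<noteq> c" "b \<noteq> e" using ce by auto
    qed (fact ab ce free)+
    show False by (rule contradiction)
  qed
qed

section \<open>Five edge sums adding up to zero\<close>

text \<open>Any four elements of T are independent and the fifth is their sum. Joining elements of
  the span that differ by an element of T gives the Clebsch graph, strongly regular with parameters
  (16, 5, 0, 2).\<close>

locale clebsch =
  fixes T :: "'a::{char2,finite} set"
  assumes card_T: "card T = 5" and sum_T: "\<Sum>T = 0"
    and T_sum_free: "\<And>x y. x \<in> T \<Longrightarrow> y \<in> T \<Longrightarrow> x + y \<notin> T" and T_nz: "0 \<notin> T"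
begin

text \<open>Sums of at most two elements suffice: a sum of three distinct elements of T is the sum
  of the other two, a sum of four is the fifth. The order is 1 + 5 + 10.\<close>

definition "K = T \<union> {p + q | p q. p \<in> T \<and> q \<in> T}"

lemma four:
  assumes "w \<in> T" "x \<in> T" "y \<in> T" "z \<in> T" "distinct [w, x, y, z]"
  shows "w + x + y + z \<in> T"
proof -
  have "card (T - {w, x, y, z}) = 1" using assms card_T by (simp add: card_Diff_subset)
  then obtain v where v: "T - {w, x, y, z} = {v}" by (rule card_1_singletonE)
  then have T: "T = {w, x, y, z, v}" using assms by blast
  have "w \<notin> {x, y, z, v}" "x \<notin> {y, z, v}" "y \<notin> {z, v}" "z \<notin> {v}" using v assms(5) by auto
  then have "\<Sum>{w, x, y, z, v} = w + (x + (y + (z + v)))"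
    by simp
  then have "\<Sum>{w, x, y, z, v} = w + x + y + z + v" by (simp only: add.assoc)
  then have "w + x + y + z = v" using sum_T unfolding T by simp
  then show ?thesis using T by simp
qed

lemma three:
  assumes "x \<in> T" "y \<in> T" "z \<in> T" "distinct [x, y, z]"
  obtains v w where "v \<in> T" "w \<in> T" "x + y + z = v + w"
proof -
  have "card (T - {x, y, z}) = 2" using assms card_T by (simp add: card_Diff_subset)
  then obtain v w where v: "T - {x, y, z} = {v, w}" "v \<noteq> w" by (auto simp: card_2_iff)
  have "v \<in> T" "w \<in> T" "distinct [x, y, z, v]" using v assms(4) by auto
  moreover from this have "x + y + z + v \<in> T" using assms by (intro four) auto
  ultimately show ?thesis using that[of v "x + y + z + v"] by (simp add: ac_simps)
qed

lemma three_notin: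
  assumes "x \<in> T" "y \<in> T" "z \<in> T" "distinct [x, y, z]"
  shows "x + y + z \<notin> T"
  using three[OF assms] T_sum_free by metis

lemma other: "\<exists>t\<in>T. t \<noteq> x \<and> t \<noteq> y \<and> t \<noteq> z"
proof (rule ccontr)
  assume "\<not> ?thesis"
  then have "card T \<le> card {x, y, z}" by (intro card_mono) auto
  then show False using card_T by (simp add: card_insert_if split: if_splits)
qed

lemma T_K: "x \<in> T \<Longrightarrow> x \<in> K" and TT_K: "p \<in> T \<Longrightarrow> q \<in> T \<Longrightarrow> p + q \<in> K"
  by (auto simp: K_def)

lemma zero_K: "0 \<in> K"
proof -
  obtain t where "t \<in> T" using other by blast
  then show ?thesis using TT_K[of t t] by simp
qed

lemma K_cases:
  assumes "k \<in> K"
  obtains "k = 0" | "k \<in> T" | p q where "p \<in> T" "q \<in> T" "p \<noteq> q" "k = p + q"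
  using assms by (cases "k = 0") (auto simp: K_def)

lemma pair_eq:
  assumes "p \<in> T" "q \<in> T" "r \<in> T" "s \<in> T" "p \<noteq> q" "r \<noteq> s" "p + q = r + s"
  shows "p = r \<and> q = s \<or> p = s \<and> q = r"
proof (rule ccontr)
  assume neg: "\<not> ?thesis"
  have "p \<noteq> r" "p \<noteq> s" "q \<noteq> r" "q \<noteq> s" using neg assms(7) by (auto simp: ac_simps)
  then have "p + q + r + s \<in> T" using assms by (intro four) auto
  moreover have "p + q + r + s = 0" by (simp add: assms(7) ac_simps)
  ultimately show False using T_nz by simp
qed

lemma K_add_T:
  assumes "x \<in> T" "l \<in> K"
  shows "x + l \<in> K"
  using assms(2)
proof (cases rule: K_cases)
  case (3 p q)
  show ?thesis
  proof (cases "distinct [x, p, q]")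
    case True
    then obtain v w where "v \<in> T" "w \<in> T" "x + p + q = v + w" using three assms(1) 3 by metis
    then show ?thesis using TT_K[of v w] 3 by (simp add: add.assoc)
  next
    case False
    then have "x + l = q \<or> x + l = p" using 3 by (auto simp: ac_simps)
    then show ?thesis using T_K[OF 3(1)] T_K[OF 3(2)] by metis
  qed
qed (use assms T_K TT_K in auto)

lemma subgrp_K: "subgrp K"
proof -
  have "k + l \<in> K" if "k \<in> K" "l \<in> K" for k l
    using that(1)
  proof (cases rule: K_cases)
    case (3 p q)
    then show ?thesis using K_add_T[of q l] K_add_T[of p "q + l"] that(2) by (simp add: add.assoc)
  qed (use that K_add_T in auto)
  then show ?thesis using zero_K by (auto simp: subgrp_def)
qed

lemmas K_add = subgrpD(2)[OF subgrp_K]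

lemma card_K: "card K = 16"
proof -
  let ?P = "{A. A \<subseteq> T \<and> card A = 2}"
  have inj: "inj_on \<Sum> ?P"
  proof (rule inj_onI)
    fix A C assume *: "A \<in> ?P" "C \<in> ?P" "\<Sum>A = \<Sum>C"
    then obtain p q r s where "A = {p, q}" "p \<noteq> q" "C = {r, s}" "r \<noteq> s" by (auto simp: card_2_iff)
    then show "A = C" using pair_eq[of p q r s] * by auto
  qed
  have P: "\<Sum> ` ?P = {p + q | p q. p \<in> T \<and> q \<in> T \<and> p \<noteq> q}"
  proof (intro set_eqI iffI)
    fix x assume "x \<in> \<Sum> ` ?P"
    then obtain A where A: "A \<subseteq> T" "card A = 2" "x = \<Sum>A" by blast
    then obtain p q where "A = {p, q}" "p \<noteq> q" by (auto simp: card_2_iff)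
    then have "p \<in> T" "q \<in> T" "p \<noteq> q" "x = p + q" using A by auto
    then show "x \<in> {p + q | p q. p \<in> T \<and> q \<in> T \<and> p \<noteq> q}" by blast
  next
    fix x assume "x \<in> {p + q | p q. p \<in> T \<and> q \<in> T \<and> p \<noteq> q}"
    then obtain p q where pq: "p \<in> T" "q \<in> T" "p \<noteq> q" "x = p + q" by blast
    then have "{p, q} \<in> ?P" "x = \<Sum>{p, q}" by auto
    then show "x \<in> \<Sum> ` ?P" by blast
  qed
  have "K = insert 0 (T \<union> \<Sum> ` ?P)"
    unfolding P using zero_K T_K TT_K by (auto elim!: K_cases)
  moreover have "0 \<notin> T \<union> \<Sum> ` ?P" unfolding P using T_nz by (auto simp: eq_commute[of 0])
  moreover have "T \<inter> \<Sum> ` ?P = {}" unfolding P using T_sum_free by auto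
  moreover have "card (\<Sum> ` ?P) = 10"
    using inj by (simp add: card_image n_subsets card_T choose_two)
  ultimately show ?thesis by (simp add: card_Un_disjoint card_T)
qed

text \<open>The intersection is the set of common neighbours of h and h' in the Clebsch graph: none
  if they are adjacent, two if not.\<close>

lemma tr_T_Int:
  assumes "h + h' \<in> K" "h \<noteq> h'"
  shows "card (tr h T \<inter> tr h' T) \<le> 2"
proof -
  have h': "x + h' = x + h + (h + h')" for x by (simp add: ac_simps)
  obtain p q where pq: "tr h T \<inter> tr h' T \<subseteq> tr h {p, q}"
    using assms(1)
  proof (cases rule: K_cases)
    case 2
    have "tr h T \<inter> tr h' T = {}"
    proof (intro equals0I)
      fix x assume "x \<in> tr h T \<inter> tr h' T"
      then have "x + h \<in> T" "x + h + (h + h') \<in> T" unfolding h'[symmetric] by auto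
      then show False using 2 T_sum_free by blast
    qed
    then show ?thesis using that by blast
  next
    case (3 p q)
    have "x + h = p \<or> x + h = q" if "x + h \<in> T" "x + h' \<in> T" for x
    proof (rule ccontr)
      assume "\<not> ?thesis"
      then have "x + h + p + q \<notin> T" using that(1) 3 by (intro three_notin) auto
      moreover have "x + h' = x + h + p + q" using h'[of x] 3(4) by (simp only: add.assoc)
      ultimately show False using that(2) by (simp only: not_True_eq_False)
    qed
    then have "tr h T \<inter> tr h' T \<subseteq> tr h {p, q}" unfolding tr_def by blast
    then show ?thesis by (rule that)
  qed (use assms in simp)
  have "card (tr h T \<inter> tr h' T) \<le> card (tr h {p, q})" using pq by (intro card_mono) auto
  also have "\<dots> \<le> 2" unfolding card_tr by (simp add: card_insert_if)
  finally show ?thesis .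
qed

text \<open>Summing over all g counts each coset 16 times and avoids choosing
  representatives.\<close>

lemma sum_card_cosets: "(\<Sum>g\<in>UNIV. card (S \<inter> tr g K)) = 16 * card S"
proof -
  have "(\<Sum>g\<in>UNIV. card (S \<inter> tr g K)) = (\<Sum>g\<in>UNIV. card {x \<in> S. x + g \<in> K})"
    by (intro sum.cong refl arg_cong[where f = card]) auto
  also have "\<dots> = (\<Sum>x\<in>S. card {g \<in> UNIV. x + g \<in> K})"
    by (rule sum_card_swap) simp_all
  also have "\<dots> = (\<Sum>x\<in>S. card (tr x K))"
    by (intro sum.cong refl arg_cong[where f = card]) (auto simp: add.commute)
  finally show ?thesis by (simp add: card_K)
qed

text \<open>Here S is an independent set of the Clebsch graph. With one point moved to 0, the others
  are sums of pairs from T, and disjoint pairs would give adjacent points. At least four pairwise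
  intersecting pairs cannot form a triangle, so they share an element i, and S is the neighbourhood
  of s + i.\<close>

lemma large_coset:
  assumes S: "S \<subseteq> tr g K" "\<And>x t. x \<in> S \<Longrightarrow> t \<in> T \<Longrightarrow> x + t \<notin> S" and five: "5 \<le> card S"
  obtains z where "z + g \<in> K" "S = tr z T"
proof -
  obtain s where s: "s \<in> S" using five by fastforce
  define D where "D = tr s S - {0}"
  have "0 \<in> tr s S" using s by simp
  then have "card D + 1 = card S" by (simp add: D_def card_Diff_singleton) (use five in linarith)
  then have D4: "card D \<ge> 4" using five by linarith
  have diff: "x + y \<in> K - T" if "x + s \<in> S" "y + s \<in> S" for x y
  proof -
    have eq: "x + y = (x + s + g) + (y + s + g)" by (simp add: ac_simps)
    have "x + s + g \<in> K" "y + s + g \<in> K" using S(1) that by auto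
    then have "x + y \<in> K" unfolding eq by (rule K_add)
    moreover have "x + y \<notin> T" using S(2)[OF that(1), of "x + y"] that(2) by (auto simp: ac_simps)
    ultimately show ?thesis by blast
  qed
  have D_pair: "\<exists>p\<in>T. \<exists>q\<in>T. p \<noteq> q \<and> x = p + q" if "x \<in> D" for x
  proof -
    have "x \<in> K - T" "x \<noteq> 0" using diff[of x 0] that s by (auto simp: D_def)
    then show ?thesis by (metis DiffE K_cases)
  qed
  have meet: "p = r \<or> p = w \<or> q = r \<or> q = w"
    if "p + q \<in> D" "r + w \<in> D" "p \<in> T" "q \<in> T" "r \<in> T" "w \<in> T" "p \<noteq> q" "r \<noteq> w" for p q r w
  proof (rule ccontr)
    assume "\<not> ?thesis"
    then have "p + q + r + w \<in> T" using that by (intro four) auto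
    moreover have "p + q + (r + w) \<notin> T" using diff[of "p + q" "r + w"] that(1,2) by (simp add: D_def)
    ultimately show False by (simp add: add.assoc)
  qed
  obtain d1 d2 where d: "d1 \<in> D" "d2 \<in> D" "d1 \<noteq> d2"
    using D4 card_le_Suc0_iff_eq[of D] by force
  obtain i a c where iac: "i \<in> T" "a \<in> T" "c \<in> T" "i \<noteq> a" "i \<noteq> c" "a \<noteq> c" "i + a \<in> D" "i + c \<in> D"
  proof -
    obtain p q where p: "p \<in> T" "q \<in> T" "p \<noteq> q" "d1 = p + q" using D_pair[OF d(1)] by blast
    obtain r w where r: "r \<in> T" "w \<in> T" "r \<noteq> w" "d2 = r + w" using D_pair[OF d(2)] by blast
    have "p = r \<or> p = w \<or> q = r \<or> q = w" using meet p r d by blast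
    then show ?thesis
    proof (elim disjE)
      assume "p = r" then show ?thesis using that[of p q w] p r d by blast
    next
      assume "p = w" then show ?thesis using that[of p q r] p r d unfolding add.commute[of r w] by blast
    next
      assume "q = r" then show ?thesis using that[of q p w] p r d unfolding add.commute[of p q] by blast
    next
      assume "q = w" then show ?thesis
        using that[of q p r] p r d unfolding add.commute[of p q] add.commute[of r w] by blast
    qed
  qed
  have cases: "(\<exists>y\<in>T. y \<noteq> i \<and> x = i + y) \<or> x = a + c" if x: "x \<in> D" for x
  proof -
    obtain p q where p: "p \<in> T" "q \<in> T" "p \<noteq> q" "x = p + q" using D_pair[OF x] by blast
    have "p = i \<or> p = a \<or> q = i \<or> q = a" "p = i \<or> p = c \<or> q = i \<or> q = c"
      using meet[of p q i a] meet[of p q i c] p x iac by blast+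
    then show ?thesis using p iac(6) by (auto simp: add.commute)
  qed
  have ac: "a + c \<notin> D"
  proof
    assume acD: "a + c \<in> D"
    have "D \<subseteq> {i + a, i + c, a + c}"
    proof
      fix x assume x: "x \<in> D"
      show "x \<in> {i + a, i + c, a + c}" using cases[OF x]
      proof
        assume "\<exists>y\<in>T. y \<noteq> i \<and> x = i + y"
        then obtain y where "y \<in> T" "y \<noteq> i" "x = i + y" by blast
        then show ?thesis using meet[of i y a c] x acD iac by auto
      qed simp
    qed
    then have "card D \<le> card {i + a, i + c, a + c}" by (intro card_mono) auto
    also have "\<dots> \<le> 3" by (simp add: card_insert_if)
    finally show False using D4 by simp
  qed
  define z where "z = s + i"
  have "S \<subseteq> tr z T"
  proof
    fix x assume x: "x \<in> S"
    show "x \<in> tr z T"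
    proof (cases "x = s")
      case True
      then show ?thesis using iac by (simp add: z_def)
    next
      case False
      then have "x + s \<in> D" using x by (auto simp: D_def add.assoc)
      then obtain y where "y \<in> T" "x + s = i + y" using cases ac by metis
      then have "x + s + i \<in> T" by (simp add: ac_simps)
      then show ?thesis by (simp add: z_def add.assoc)
    qed
  qed
  moreover have "card (tr z T) = 5" using card_T by simp
  ultimately have "S = tr z T" using five by (intro card_seteq) auto
  moreover have "z + g \<in> K"
  proof -
    have "s + g \<in> K" using s S(1) by auto
    from K_add[OF this T_K[OF iac(1)]] show ?thesis by (simp add: z_def ac_simps)
  qed
  ultimately show ?thesis using that by blast
qed

end

section \<open>Cosets of K filled by a neighbourhood\<close>

locale five_cycle = edge_cover B z0 + clebsch T
  for B :: "'a::{char2,finite} set" and z0 :: 'a and T :: "'a set" +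
  fixes M :: nat
  assumes T_U: "T \<subseteq> U" and card_G: "CARD('a) = 16 * M" and M8: "8 dvd M" and M0: "M > 0"
begin

lemma K_sum: "k \<in> K \<Longrightarrow> l \<in> K \<Longrightarrow> k + l = m \<Longrightarrow> m \<in> K"
  using K_add by blast

lemma sum_indicator: "(\<Sum>g\<in>UNIV. c + (if g \<in> S then d else 0)) = c * CARD('a) + d * card S"
  for S :: "'a set" and c d :: nat
  unfolding sum.distrib by (simp add: sum.If_cases)

text \<open>Deleting one end of each of the five edges leaves no two points that differ by an element of \<open>T\<close>.\<close>

definition "B0 = B - (\<lambda>t. SOME x. \<exists>y. edge B x y \<and> x + y = t) ` T"

lemma B0_B: "x \<in> B0 \<Longrightarrow> x \<in> B" by (simp add: B0_def)

lemma card_B0: "card B \<le> card B0 + 5"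
proof -
  let ?E = "(\<lambda>t. SOME x. \<exists>y. edge B x y \<and> x + y = t) ` T"
  have "card ?E \<le> 5" using card_image_le[of T] card_T by simp
  then show ?thesis using diff_card_le_card_Diff[of ?E B] by (simp add: B0_def)
qed

lemma B0_free:
  assumes "x \<in> B0" "t \<in> T"
  shows "x + t \<notin> B0"
proof
  assume xt: "x + t \<in> B0"
  let ?P = "\<lambda>x. \<exists>y. edge B x y \<and> x + y = t"
  let ?x = "SOME x. ?P x"
  have "\<exists>x. ?P x" using T_U assms(2) by (blast elim: edge_sums_E)
  then have "?P ?x" by (rule someI_ex)
  then obtain y where y: "edge B ?x y" "?x + y = t" by blast
  have "?x + y = x + (x + t)" using y(2) by simp
  then have "?x = x \<or> ?x = x + t"
    using edge_same_sum[OF y(1) B0_B[OF assms(1)] B0_B[OF xt]] by blast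
  moreover have "?x \<notin> B0" using assms(2) by (auto simp: B0_def)
  ultimately show False using assms(1) xt by auto
qed

definition "Z = {z. \<forall>t\<in>T. z + t \<in> B0}"

lemma Z_B: "z \<in> Z \<Longrightarrow> t \<in> T \<Longrightarrow> z + t \<in> B"
  using B0_B by (auto simp: Z_def)

text \<open>Two centres in a coset would have the same five neighbours, namely all of
  \<open>B0\<close> in that coset, but distinct vertices share at most two.\<close>

lemma Z_unique:
  assumes "z \<in> Z" "z' \<in> Z" "z + z' \<in> K"
  shows "z = z'"
proof -
  let ?S = "B0 \<inter> tr z K"
  have sub: "tr x T \<subseteq> ?S" if "x \<in> Z" "z + x \<in> K" for x
  proof
    fix y assume "y \<in> tr x T"
    then have y: "y + x \<in> T" by simp
    then have "x + (y + x) \<in> B0" using that by (simp add: Z_def)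
    moreover have "(y + x) + (z + x) \<in> K" using K_add[OF T_K[OF y] that(2)] .
    ultimately show "y \<in> ?S" by (simp add: ac_simps)
  qed
  have zz: "z + z \<in> K" using zero_K by simp
  have five: "5 \<le> card ?S" using card_mono[OF _ sub[OF assms(1) zz]] card_T by simp
  have free: "x + t \<notin> ?S" if "x \<in> ?S" "t \<in> T" for x t using B0_free that by blast
  obtain w where w: "w + z \<in> K" "?S = tr w T" by (rule large_coset[OF Int_lower2 free five])
  have "tr z T = tr w T" "tr z' T = tr w T"
    using sub[OF assms(1) zz] sub[OF assms(2,3)] unfolding w(2) by (intro card_subset_eq; simp)+
  then have eq: "tr z T = tr z' T" by simp
  show ?thesis
  proof (rule ccontr)
    assume "z \<noteq> z'"
    then show False using tr_T_Int[OF assms(3)] eq card_T by simp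
  qed
qed

definition "ZK = {g. \<exists>z\<in>Z. z + g \<in> K}"

lemma card_sum_inj:
  assumes S: "S \<subseteq> K"
  shows "card {z + k | z k. z \<in> Z \<and> k \<in> S} = card Z * card S"
proof -
  have "inj_on (\<lambda>(z, k). z + k) (Z \<times> S)"
  proof (rule inj_onI, clarify)
    fix z k z' k' assume *: "z \<in> Z" "k \<in> S" "z' \<in> Z" "k' \<in> S" "z + k = z' + k'"
    have "z + z' = k + k'" using *(5) by (metis add.assoc add.commute self_add_left)
    then have "z = z'" using K_add[of k k'] S * by (intro Z_unique) auto
    then show "z = z' \<and> k = k'" using *(5) by simp
  qed
  moreover have "{z + k | z k. z \<in> Z \<and> k \<in> S} = (\<lambda>(z, k). z + k) ` (Z \<times> S)" by auto
  ultimately show ?thesis by (simp add: card_image card_cartesian_product)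
qed

lemma card_ZK: "card ZK = 16 * card Z"
proof -
  have "ZK = {z + k | z k. z \<in> Z \<and> k \<in> K}"
  proof (intro set_eqI iffI)
    fix g assume "g \<in> ZK"
    then obtain z where "z \<in> Z" "z + g \<in> K" by (auto simp: ZK_def)
    then show "g \<in> {z + k | z k. z \<in> Z \<and> k \<in> K}" by (intro CollectI exI[of _ z] exI[of _ "z + g"]) simp
  next
    fix g assume "g \<in> {z + k | z k. z \<in> Z \<and> k \<in> K}"
    then obtain z k where "g = z + k" "z \<in> Z" "k \<in> K" by blast
    then have "z + g \<in> K" "z \<in> Z" by simp_all
    then show "g \<in> ZK" unfolding ZK_def by blast
  qed
  then show ?thesis using card_sum_inj[of K] card_K by simp
qed

lemma ZK_cong: "g \<in> ZK \<Longrightarrow> g + h \<in> K \<Longrightarrow> h \<in> ZK"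
proof -
  assume "g \<in> ZK" "g + h \<in> K"
  then obtain z where "z \<in> Z" "z + g \<in> K" "g + h \<in> K" by (auto simp: ZK_def)
  moreover from this have "z + h \<in> K" using K_add[of "z + g" "g + h"] by (simp add: ac_simps)
  ultimately show ?thesis by (auto simp: ZK_def)
qed

text \<open>A coset holds five points of \<open>B0\<close> if it has a centre and at most four
  otherwise, so |B0| \<le> 4M + |Z|. The size hypothesis then yields 8M \<le> 9|Z| + 8, which rounds
  to 7/8 because 8 divides M.\<close>

lemma card_Z: "7 * M \<le> 8 * card Z"
proof -
  have "card (B0 \<inter> tr g K) \<le> 4 + (if g \<in> ZK then 1 else 0)" for g
  proof (cases "5 \<le> card (B0 \<inter> tr g K)")
    case True
    obtain z where z: "z + g \<in> K" "B0 \<inter> tr g K = tr z T"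
      using large_coset[of "B0 \<inter> tr g K" g] True B0_free by blast
    have "z + t \<in> B0" if "t \<in> T" for t
    proof -
      have "z + t \<in> tr z T" using that by (simp add: ac_simps)
      then show ?thesis using z(2) by blast
    qed
    then have "g \<in> ZK" using z(1) by (auto simp: ZK_def Z_def)
    then show ?thesis using z(2) card_T by simp
  qed auto
  then have "(\<Sum>g\<in>UNIV. card (B0 \<inter> tr g K)) \<le> (\<Sum>g\<in>UNIV. 4 + (if g \<in> ZK then 1 else 0))"
    by (intro sum_mono)
  also have "\<dots> = 4 * CARD('a) + card ZK" using sum_indicator[of 4 ZK 1] by simp
  finally have "16 * card B0 \<le> 64 * M + 16 * card Z" using sum_card_cosets[of B0] card_ZK card_G by simp
  then have "card B0 \<le> 4 * M + card Z" by linarith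
  then have "8 * M \<le> 9 * card Z + 8" using card_B0 size card_G by linarith
  moreover obtain m where m: "M = 8 * m" using M8 by blast
  ultimately have "7 * m \<le> card Z" by linarith
  then show ?thesis using m by simp
qed

text \<open>The cosets with a centre fill at least 7/8 of the group, so their union meets each of
  its translates.\<close>

lemma ex_rep: "\<exists>x\<in>Z. \<exists>x'\<in>Z. g + x + x' \<in> K"
proof -
  have "ZK \<inter> tr g ZK \<noteq> {}"
  proof
    assume "ZK \<inter> tr g ZK = {}"
    then have "card ZK + card (tr g ZK) \<le> CARD('a)"
      using card_mono[of UNIV "ZK \<union> tr g ZK"] by (simp add: card_Un_disjoint)
    then show False using card_ZK card_Z card_G M0 by simp
  qed
  then obtain y where "y \<in> ZK" "y + g \<in> ZK" by auto
  then obtain x x' where x: "x \<in> Z" "x + y \<in> K" "x' \<in> Z" "x' + (y + g) \<in> K" by (auto simp: ZK_def)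
  have "g + x + x' \<in> K" by (rule K_sum[OF x(2,4)]) (simp add: ac_simps)
  then show ?thesis using x by blast
qed

text \<open>Otherwise v + x + x' is 0 or p + q with distinct p, q in T. Then v is (x + t) + (x' + t)
  for every t, or both (x + p) + (x' + q) and (x + q) + (x' + p), against uniqueness. If x = x', the
  latter two coincide; then v = p + q contradicts sum-freeness of the edge sums.\<close>

lemma pair_T:
  assumes v: "v \<in> U" and x: "x \<in> Z" "x' \<in> Z" and K: "v + x + x' \<in> K"
  shows "v + x + x' \<in> T"
proof -
  obtain e f where ef: "edge B e f" "v = e + f" using v by (rule edge_sums_E)
  have two: False if "p \<in> T" "q \<in> T" "r \<in> T" "w \<in> T" "p \<noteq> r" "x + p \<noteq> x' + w" "v = (x + p) + (x' + q)" "v = (x + r) + (x' + w)"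
    for p q r w
    using edge_same_sum[OF ef(1) Z_B[OF x(1) that(1)] Z_B[OF x(2) that(2)]]
      edge_same_sum[OF ef(1) Z_B[OF x(1) that(3)] Z_B[OF x(2) that(4)]] that(5-8) ef(2) by (metis add_left_cancel)
  have v_eq: "v = (v + x + x') + x + x'" by (simp add: ac_simps)
  show ?thesis using K
  proof (cases rule: K_cases)
    case 1
    obtain t where t: "t \<in> T" using other by blast
    obtain t' where t': "t' \<in> T" "t \<noteq> t'" using other by metis
    have "v = x + x'" using v_eq unfolding 1 by simp
    then have eqs: "v = (x + t) + (x' + t)" "v = (x + t') + (x' + t')" by (simp_all add: ac_simps)
    have "x \<noteq> x'" using \<open>v = x + x'\<close> edge_sums_nonzero[OF v] by auto
    then have "x + x' \<notin> K" using Z_unique x by blast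
    moreover have "x + x' = t + t'" if "x + t = x' + t'"
    proof -
      have "x = x' + t' + t" using that by (simp add: add_eq_iff)
      then show ?thesis by (simp add: ac_simps)
    qed
    ultimately have "x + t \<noteq> x' + t'" using TT_K[of t t'] t t' by auto
    then show ?thesis using two[of t t t' t'] t t' eqs by blast
  next
    case (3 p q)
    have eqs: "v = (x + p) + (x' + q)" "v = (x + q) + (x' + p)" using v_eq unfolding 3(4) by (simp_all add: ac_simps)
    have "x \<noteq> x'"
    proof
      assume "x = x'"
      then have "v = p + q" using eqs(1) by (simp add: ac_simps)
      then show False using sum_free_U[of p q v] v T_U 3 by blast
    qed
    then have "x + p \<noteq> x' + p" by simp
    then show ?thesis using two[of p q q p] 3 eqs by blast
  qed
qed

section \<open>Edge sums at the neighbourhoods of the centres\<close>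

definition "I = {z + t | z t. z \<in> Z \<and> t \<in> T}"

lemma I_B: "x \<in> I \<Longrightarrow> x \<in> B"
  using Z_B by (auto simp: I_def)

lemma card_I: "card I = 5 * card Z"
proof -
  have "T \<subseteq> K" using T_K by blast
  from card_sum_inj[OF this] show ?thesis by (simp add: I_def card_T)
qed

lemma I_independent:
  assumes "x \<in> I" "y \<in> I"
  shows "\<not> edge B x y"
proof
  assume e: "edge B x y"
  obtain z t z' t' where *: "x = z + t" "y = z' + t'" "z \<in> Z" "z' \<in> Z" "t \<in> T" "t' \<in> T"
    using assms by (auto simp: I_def)
  have eq: "x + y + z + z' = t + t'" unfolding * by (simp add: ac_simps)
  then have "x + y + z + z' \<in> T" using pair_T[OF edge_sums_I[OF e] *(3,4)] TT_K[OF *(5,6)] by simp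
  then show False using T_sum_free[OF *(5,6)] eq by simp
qed

definition "V = {v. \<exists>x\<in>I. \<exists>y. edge B x y \<and> v = x + y}"

lemma V_U: "v \<in> V \<Longrightarrow> v \<in> U"
  by (auto simp: V_def intro: edge_sums_I)

lemma card_V: "5 * card Z \<le> card V + 1"
proof -
  have "\<forall>x\<in>I - {z0}. \<exists>y. edge B x y" using covered I_B by blast
  then obtain f where f: "\<And>x. x \<in> I - {z0} \<Longrightarrow> edge B x (f x)" by metis
  have "inj_on (\<lambda>x. x + f x) (I - {z0})"
  proof (rule inj_onI)
    fix x y assume *: "x \<in> I - {z0}" "y \<in> I - {z0}" "x + f x = y + f y"
    then have "x = y \<or> x = f y"
      using edge_same_sum[OF f[OF *(1)], of y "f y"] edgeD[OF f[OF *(2)]] by blast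
    then show "x = y" using I_independent[of y x] f[OF *(2)] * by auto
  qed
  moreover have "(\<lambda>x. x + f x) ` (I - {z0}) \<subseteq> V" using f by (auto simp: V_def)
  ultimately have "card (I - {z0}) \<le> card V" by (intro card_inj_on_le) auto
  moreover have "card I \<le> card (I - {z0}) + 1" using diff_card_le_card_Diff[of "{z0}" I] by simp
  ultimately show ?thesis using card_I by linarith
qed

text \<open>Three is the threshold because distinct translates of T in a coset share at most two
  points: three points of \<open>V\<close> determine the translate that contains them.\<close>

definition "A3 = {g. 3 \<le> card (V \<inter> tr g K)}"

lemma V_coset:
  assumes "g + x + x' \<in> K" "x \<in> Z" "x' \<in> Z"
  shows "V \<inter> tr g K \<subseteq> tr (x + x') T"
proof
  fix v assume "v \<in> V \<inter> tr g K"
  then have v: "v \<in> U" "v + g \<in> K" using V_U by auto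
  have "v + x + x' \<in> K" by (rule K_sum[OF v(2) assms(1)]) (simp add: ac_simps)
  from pair_T[OF v(1) assms(2,3) this] show "v \<in> tr (x + x') T" by (simp add: add.assoc)
qed

text \<open>No coset holds more than five points of \<open>V\<close>, while \<open>V\<close> has
  nearly five for each centre, so cosets with at most two are rare.\<close>

lemma card_A3: "80 * card Z \<le> 32 * M + 3 * card A3 + 16"
proof -
  have "card (V \<inter> tr g K) \<le> 2 + (if g \<in> A3 then 3 else 0)" for g
  proof -
    obtain x x' where "g + x + x' \<in> K" "x \<in> Z" "x' \<in> Z" using ex_rep by blast
    then have "card (V \<inter> tr g K) \<le> card (tr (x + x') T)" by (intro card_mono V_coset) auto
    then show ?thesis using card_T by (auto simp: A3_def)
  qed
  then have "(\<Sum>g\<in>UNIV. card (V \<inter> tr g K)) \<le> (\<Sum>g\<in>UNIV. 2 + (if g \<in> A3 then 3 else 0))"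
    by (intro sum_mono)
  also have "\<dots> = 2 * CARD('a) + 3 * card A3" by (rule sum_indicator)
  finally have "16 * card V \<le> 32 * M + 3 * card A3" using sum_card_cosets[of V] card_G by simp
  then show ?thesis using card_V by linarith
qed

lemma A3_unique:
  assumes "g \<in> A3" "g + x + x' \<in> K" "g + y + y' \<in> K" "x \<in> Z" "x' \<in> Z" "y \<in> Z" "y' \<in> Z"
  shows "x + x' = y + y'"
proof (rule ccontr)
  assume ne: "x + x' \<noteq> y + y'"
  have K: "x + x' + (y + y') \<in> K" by (rule K_sum[OF assms(2,3)]) (simp add: ac_simps)
  have "V \<inter> tr g K \<subseteq> tr (x + x') T \<inter> tr (y + y') T"
    using V_coset[OF assms(2,4,5)] V_coset[OF assms(3,6,7)] by blast
  then have "card (V \<inter> tr g K) \<le> 2"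
    using card_mono[of "tr (x + x') T \<inter> tr (y + y') T"] tr_T_Int[OF K ne] by (meson finite le_trans)
  then show False using assms(1) by (simp add: A3_def)
qed

text \<open>Few points are bad, so some h has centres y1 and y2 in the cosets of h + x1 and h + x2,
  with h and h + k in \<open>A3\<close>. \<open>A3_unique\<close> at h gives x1 + y1 = x2 + y2, and
  at h + k it gives x1' + y1 = x2' + y2; on adding, y1 and y2 cancel.\<close>

lemma ZZ_unique:
  assumes x: "x1 \<in> Z" "x1' \<in> Z" "x2 \<in> Z" "x2' \<in> Z" and K: "x1 + x1' + (x2 + x2') \<in> K"
  shows "x1 + x1' = x2 + x2'"
proof -
  define k where "k = x1 + x1'"
  let ?S = "(- A3 \<union> - tr k A3) \<union> (- tr x1 ZK \<union> - tr x2 ZK)"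
  have compl: "card (- X) = 16 * M - card X" for X :: "'a set"
    by (simp add: Compl_eq_Diff_UNIV card_Diff_subset card_G)
  have "card ?S \<le> (card (- A3) + card (- tr k A3)) + (card (- tr x1 ZK) + card (- tr x2 ZK))"
    by (intro order_trans[OF card_Un_le] add_mono card_Un_le)
  also have "\<dots> = 2 * (16 * M - card A3) + 2 * (16 * M - 16 * card Z)"
    by (simp add: compl card_ZK)
  also have "\<dots> < 16 * M" using card_A3 card_Z M8 M0 by (auto elim!: dvdE)
  finally have "?S \<noteq> UNIV" using card_G by auto
  then obtain h where h: "h \<in> A3" "h + k \<in> A3" "h + x1 \<in> ZK" "h + x2 \<in> ZK" by auto
  obtain y1 y2 where y: "y1 \<in> Z" "y1 + (h + x1) \<in> K" "y2 \<in> Z" "y2 + (h + x2) \<in> K"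
    using h(3,4) by (auto simp: ZK_def)
  have "x1 + y1 = x2 + y2"
    using A3_unique[OF h(1), of x1 y1 x2 y2] x y by (simp add: ac_simps)
  moreover have "x1' + y1 = x2' + y2"
  proof (rule A3_unique[OF h(2)])
    show "h + k + x1' + y1 \<in> K" using y(2) by (simp add: k_def ac_simps)
    show "h + k + x2' + y2 \<in> K" by (rule K_sum[OF y(4) K]) (simp add: k_def ac_simps)
  qed (use x y in auto)
  ultimately have "(x1 + y1) + (x1' + y1) = (x2 + y2) + (x2' + y2)" by simp
  then show ?thesis by (simp add: ac_simps)
qed

section \<open>The differences of centres as a complement of K\<close>

definition "H = {x + x' | x x'. x \<in> Z \<and> x' \<in> Z}"

lemma H_Z:
  assumes h: "h \<in> H" and y: "y \<in> Z" and ZK: "h + y \<in> ZK"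
  shows "h + y \<in> Z"
proof -
  obtain x x' where x: "x \<in> Z" "x' \<in> Z" "h = x + x'" using h by (auto simp: H_def)
  obtain y' where y': "y' \<in> Z" "y' + (h + y) \<in> K" using ZK by (auto simp: ZK_def)
  have "x + x' + (y + y') \<in> K" using y'(2) unfolding x(3) by (simp add: ac_simps)
  then have "h = y + y'" unfolding x(3) by (rule ZZ_unique[OF x(1,2) y y'(1)])
  then show ?thesis using y'(1) by (simp add: ac_simps)
qed

lemma Z_ne: "Z \<noteq> {}"
  using card_Z M0 by auto

text \<open>For some g the cosets of g, g + h and g + h' all have centres, each condition failing on
  at most an eighth of the group. If y is the centre for g, then h + y and h' + y are centres by
  \<open>H_Z\<close>, and their sum is h + h'.\<close>

lemma subgrp_H: "subgrp H"
proof -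
  have "h + h' \<in> H" if h: "h \<in> H" "h' \<in> H" for h h'
  proof -
    let ?S = "- ZK \<union> (- tr h ZK \<union> - tr h' ZK)"
    have compl: "card (- X) = 16 * M - card X" for X :: "'a set"
      by (simp add: Compl_eq_Diff_UNIV card_Diff_subset card_G)
    have "card ?S \<le> card (- ZK) + (card (- tr h ZK) + card (- tr h' ZK))"
      by (intro order_trans[OF card_Un_le] add_left_mono card_Un_le)
    also have "\<dots> = 3 * (16 * M - 16 * card Z)" by (simp add: compl card_ZK)
    also have "\<dots> < 16 * M" using card_Z M0 by linarith
    finally have "?S \<noteq> UNIV" using card_G by auto
    then obtain g where g: "g \<in> ZK" "g + h \<in> ZK" "g + h' \<in> ZK" by auto
    then obtain y where y: "y \<in> Z" "y + g \<in> K" by (auto simp: ZK_def)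
    have "h + y \<in> Z" "h' + y \<in> Z"
      using H_Z[OF h(1) y(1)] H_Z[OF h(2) y(1)] ZK_cong[OF g(2), of "h + y"] ZK_cong[OF g(3), of "h' + y"] y(2)
      by (simp_all add: ac_simps)
    moreover have "h + h' = (h + y) + (h' + y)" by (simp add: ac_simps)
    ultimately show ?thesis unfolding H_def by blast
  qed
  moreover have "0 \<in> H"
  proof -
    obtain z where "z \<in> Z" using Z_ne by blast
    moreover have "0 = z + z" by simp
    ultimately show ?thesis unfolding H_def by blast
  qed
  ultimately show ?thesis by (auto simp: subgrp_def)
qed

lemma H_sum: "x \<in> H \<Longrightarrow> y \<in> H \<Longrightarrow> x + y = z \<Longrightarrow> z \<in> H"
  using subgrpD(2)[OF subgrp_H] by blast

lemma H_K: "h \<in> H \<Longrightarrow> h \<in> K \<Longrightarrow> h = 0"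
  using Z_unique by (auto simp: H_def)

lemma ex_complement: "\<exists>k\<in>K. g + k \<in> H"
proof -
  obtain x x' where x: "x \<in> Z" "x' \<in> Z" "g + x + x' \<in> K" using ex_rep by blast
  have "g + (g + x + x') = x + x'" by (simp add: ac_simps)
  then have "g + (g + x + x') \<in> H" using x unfolding H_def by blast
  then show ?thesis using x(3) by blast
qed

lemma card_H: "card H = M"
proof -
  let ?f = "\<lambda>(h, k). h + k"
  have "inj_on ?f (H \<times> K)"
  proof (rule inj_onI, clarify)
    fix h k h' k' assume *: "h \<in> H" "k \<in> K" "h' \<in> H" "k' \<in> K" "h + k = h' + k'"
    have eq: "h + h' = k + k'" using *(5) by (metis add.assoc add.commute self_add_left)
    have "h + h' \<in> H" "k + k' \<in> K" using * subgrpD(2)[OF subgrp_H] K_add by blast+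
    then have "h = h'" using H_K[of "h + h'"] eq by simp
    then show "h = h' \<and> k = k'" using *(5) by simp
  qed
  moreover have "?f ` (H \<times> K) = UNIV"
  proof (intro set_eqI iffI)
    fix g :: 'a
    obtain k where "k \<in> K" "g + k \<in> H" using ex_complement by blast
    moreover have "g = ?f (g + k, k)" by (simp add: add.assoc)
    ultimately show "g \<in> ?f ` (H \<times> K)" by blast
  qed simp
  ultimately have "card (H \<times> K) = CARD('a)" by (metis card_image)
  then show ?thesis by (simp add: card_cartesian_product card_K card_G)
qed

text \<open>The whole group is the direct sum of \<open>H\<close> and \<open>K\<close>; the type of an element is its \<open>K\<close>-component
  relative to \<open>s\<close>.\<close>

definition "s = (SOME z. z \<in> Z)"
definition "ty c k \<longleftrightarrow> k \<in> K \<and> c + s + k \<in> H"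

lemma s_Z: "s \<in> Z"
  using Z_ne by (simp add: s_def some_in_eq)

lemma Z_s: "z \<in> Z \<Longrightarrow> z + s \<in> H"
  using s_Z by (auto simp: H_def)

lemma ty_ex: "\<exists>k. ty c k"
  using ex_complement[of "c + s"] by (auto simp: ty_def)

lemma ty_unique: "ty c k \<Longrightarrow> ty c l \<Longrightarrow> k = l"
proof -
  assume "ty c k" "ty c l"
  then have *: "k \<in> K" "l \<in> K" "c + s + k \<in> H" "c + s + l \<in> H" by (auto simp: ty_def)
  have "k + l \<in> H" by (rule H_sum[OF *(3,4)]) (simp add: ac_simps)
  then show ?thesis using H_K[of "k + l"] K_add[OF *(1,2)] by simp
qed

lemma ty_I: "z \<in> Z \<Longrightarrow> t \<in> T \<Longrightarrow> ty (z + t) t"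
proof -
  assume "z \<in> Z" "t \<in> T"
  moreover have eq: "z + t + s + t = z + s" by (simp add: ac_simps)
  ultimately show ?thesis unfolding ty_def eq using Z_s[of z] T_K by blast
qed

lemma U_T:
  assumes "v \<in> U"
  shows "\<exists>t\<in>T. v + t \<in> H"
proof -
  obtain x x' where x: "x \<in> Z" "x' \<in> Z" "v + x + x' \<in> K" using ex_rep by blast
  have "v + (v + x + x') = x + x'" by (simp add: ac_simps)
  then have "v + (v + x + x') \<in> H" using x unfolding H_def by blast
  then show ?thesis using pair_T[OF assms x] by blast
qed

lemma ty_add:
  assumes "ty c k" "ty c' k'" "c + c' + t \<in> H" "t \<in> K"
  shows "k + k' = t"
proof -
  have *: "k \<in> K" "k' \<in> K" "c + s + k \<in> H" "c' + s + k' \<in> H" using assms(1,2) by (auto simp: ty_def)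
  have "c + c' + k + k' \<in> H" by (rule H_sum[OF *(3,4)]) (simp add: ac_simps)
  from H_sum[OF this assms(3), of "k + k' + t"] have "k + k' + t \<in> H" by (simp add: ac_simps)
  moreover have "k + k' + t \<in> K" using * assms(4) K_add by blast
  ultimately have "k + k' + t = 0" by (rule H_K)
  then show ?thesis by simp
qed

lemma ty_edge:
  assumes "edge B c c'" "ty c k" "ty c' k'"
  shows "k + k' \<in> T"
proof -
  obtain t where t: "t \<in> T" "c + c' + t \<in> H" using U_T[OF edge_sums_I[OF assms(1)]] by blast
  then show ?thesis using ty_add[OF assms(2,3) t(2) T_K[OF t(1)]] by simp
qed

text \<open>Points of \<open>I\<close> have types in T. When an edge sum in j + H uses one of type
  i, its other end has type i + j; so \<open>C j\<close> collects the candidates for other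
  ends.\<close>

definition "C j = {c \<in> B. \<exists>i\<in>T. ty c (i + j)}"
definition "VT j = {v \<in> V. v + j \<in> H}"

lemma VT_rep:
  assumes "v \<in> VT j" "j \<in> T"
  obtains z i c where "z \<in> Z" "i \<in> T" "c \<in> B" "v = z + i + c" "ty c (i + j)"
proof -
  obtain x c where x: "x \<in> I" "edge B x c" "v = x + c" "x + c + j \<in> H" using assms(1) by (auto simp: VT_def V_def)
  obtain z i where z: "z \<in> Z" "i \<in> T" "x = z + i" using x(1) by (auto simp: I_def)
  obtain k where k: "ty c k" using ty_ex by blast
  have tx: "ty x i" unfolding z(3) by (rule ty_I[OF z(1,2)])
  have "i + k = j" using ty_add[OF tx k x(4) T_K[OF assms(2)]] .
  then have "k = i + j" by (auto simp: ac_simps)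
  then show ?thesis using that[of z i c] z edgeD(2)[OF x(2)] x(3) k by blast
qed

text \<open>The type of the only candidate c fixes i, so all sums lie in the single translate i + c
  + \<open>Z\<close>.\<close>

lemma card_VT_one:
  assumes j: "j \<in> T" and C: "C j \<subseteq> {c}"
  shows "card (VT j) \<le> card Z"
proof (cases "VT j = {}")
  case False
  then obtain w where "w \<in> VT j" by blast
  then obtain z i c' where i: "i \<in> T" "c' \<in> B" "ty c' (i + j)" using VT_rep[OF _ j] by metis
  then have "c' \<in> C j" by (auto simp: C_def)
  then have ty: "ty c (i + j)" using C i(3) by blast
  have "VT j \<subseteq> tr (i + c) Z"
  proof
    fix v assume "v \<in> VT j"
    then obtain z i' c' where *: "z \<in> Z" "i' \<in> T" "c' \<in> B" "v = z + i' + c'" "ty c' (i' + j)" using VT_rep[OF _ j] by metis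
    then have "c' \<in> C j" by (auto simp: C_def)
    then have c': "c' = c" using C by blast
    then have "i' + j = i + j" using ty_unique[OF _ ty] *(5) by blast
    then have "v + (i + c) = z" using *(4) c' by (simp add: ac_simps)
    then show "v \<in> tr (i + c) Z" using *(1) by simp
  qed
  then have "card (VT j) \<le> card (tr (i + c) Z)" by (intro card_mono) auto
  then show ?thesis by simp
qed simp

text \<open>A sum in both c + i + \<open>Z\<close> and c' + i' + \<open>Z\<close> is represented
  through c and through c'. These coincide only if c has type i', impossible as T is sum-free. So
  each sum misses one of the two translates, and each translate leaves out M - |Z| points of j +
  H.\<close>

lemma card_VT_two:
  assumes j: "j \<in> T" and c: "c \<in> C j" "c' \<in> C j" "c \<noteq> c'"
  shows "card (VT j) \<le> 2 * (M - card Z)"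
proof -
  obtain i i' where i: "i \<in> T" "ty c (i + j)" "i' \<in> T" "ty c' (i' + j)" "c \<in> B" "c' \<in> B"
    using c(1,2) by (auto simp: C_def)
  have N: "card (tr j H - tr (c + i) Z) = M - card Z" if "ty c (i + j)" for c i
  proof -
    have "tr (c + i) Z \<subseteq> tr j H"
    proof
      fix y assume "y \<in> tr (c + i) Z"
      then have 1: "y + (c + i) + s \<in> H" using Z_s by simp
      have 2: "c + s + (i + j) \<in> H" using that by (simp add: ty_def)
      have "y + j \<in> H" by (rule H_sum[OF 1 2]) (simp add: ac_simps)
      then show "y \<in> tr j H" by simp
    qed
    then show ?thesis by (simp add: card_Diff_subset card_H)
  qed
  have "VT j \<subseteq> (tr j H - tr (c + i) Z) \<union> (tr j H - tr (c' + i') Z)"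
  proof
    fix v assume v: "v \<in> VT j"
    have False if z: "v + (c + i) \<in> Z" "v + (c' + i') \<in> Z"
    proof -
      have "v \<in> U" using v V_U by (auto simp: VT_def)
      then obtain e f where ef: "edge B e f" "v = e + f" by (rule edge_sums_E)
      let ?x = "v + (c + i) + i" and ?x' = "v + (c' + i') + i'"
      have x: "?x \<in> B" "?x' \<in> B" using Z_B z i by blast+
      have eqs: "e + f = ?x + c" "e + f = ?x' + c'" unfolding ef(2)[symmetric] by (simp_all add: ac_simps)
      have "c = c' \<or> c = ?x'"
        using edge_same_sum[OF ef(1) x(1) i(5) eqs(1)] edge_same_sum[OF ef(1) x(2) i(6) eqs(2)] by metis
      then have "ty c i'" using c(3) ty_I[OF z(2) i(3)] by auto
      then have "i + j = i'" by (rule ty_unique[OF i(2)])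
      then show False using T_sum_free[OF i(1) j] i(3) by simp
    qed
    moreover have "v + j \<in> H" using v by (simp add: VT_def)
    ultimately show "v \<in> (tr j H - tr (c + i) Z) \<union> (tr j H - tr (c' + i') Z)"
      unfolding tr_def by blast
  qed
  then have "card (VT j) \<le> card ((tr j H - tr (c + i) Z) \<union> (tr j H - tr (c' + i') Z))"
    by (intro card_mono) auto
  also have "\<dots> \<le> 2 * (M - card Z)" using card_Un_le[of "tr j H - tr (c + i) Z" "tr j H - tr (c' + i') Z"] N i by simp
  finally show ?thesis .
qed

lemma card_VT:
  assumes j: "j \<in> T"
  shows "card (VT j) \<le> card Z"
proof (cases "\<exists>c. C j \<subseteq> {c}")
  case True
  then show ?thesis using card_VT_one[OF j] by blast
next
  case False
  then obtain c c' where "c \<in> C j" "c' \<in> C j" "c \<noteq> c'" by blast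
  from card_VT_two[OF j this] show ?thesis using card_Z by linarith
qed

text \<open>Five sets of size at most |Z| cover \<open>V\<close>, which has at least 5|Z| - 1
  elements; so each has at least |Z| - 1, too many for no candidate and for two.\<close>

lemma C_singleton:
  assumes j: "j \<in> T"
  obtains c where "C j = {c}"
proof -
  have V: "V = (\<Union>i\<in>T. VT i)" using U_T V_U by (auto simp: VT_def)
  have T: "T = insert j (T - {j})" using j by blast
  have "V = VT j \<union> (\<Union>i\<in>T - {j}. VT i)" unfolding V using j by blast
  then have "card V \<le> card (VT j) + card (\<Union>i\<in>T - {j}. VT i)" using card_Un_le by metis
  also have "card (\<Union>i\<in>T - {j}. VT i) \<le> (\<Sum>i\<in>T - {j}. card (VT i))" by (rule card_UN_le) simp
  also have "(\<Sum>i\<in>T - {j}. card (VT i)) \<le> (\<Sum>i\<in>T - {j}. card Z)" using card_VT by (intro sum_mono) auto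
  also have "\<dots> = 4 * card Z" using j card_T by simp
  finally have VTj: "card Z \<le> card (VT j) + 1" using card_V by linarith
  obtain m where m: "M = 8 * m" using M8 by blast
  have "m \<ge> 1" using M0 m by simp
  have "VT j \<noteq> {}" using VTj card_Z m \<open>m \<ge> 1\<close> by auto
  then obtain c where c: "c \<in> C j" using VT_rep[OF _ j] by (force simp: C_def)
  have "c' = c" if "c' \<in> C j" for c'
  proof (rule ccontr)
    assume "c' \<noteq> c"
    from card_VT_two[OF j that c this] show False using VTj card_Z m \<open>m \<ge> 1\<close> by linarith
  qed
  then show ?thesis using that[of c] c by blast
qed

text \<open>Otherwise the types of the centres would pair off the five elements of \<open>T\<close>.\<close>

lemma ex_centre:
  obtains c where "ty c 0" "\<And>j. j \<in> T \<Longrightarrow> C j = {c}"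
proof -
  have "\<forall>j\<in>T. \<exists>c. C j = {c}" using C_singleton by metis
  then obtain f where f: "\<And>j. j \<in> T \<Longrightarrow> C j = {f j}" by metis
  have "\<exists>i. i \<in> T \<and> ty (f j) (i + j)" if "j \<in> T" for j using f[OF that] by (auto simp: C_def)
  then obtain p where p: "\<And>j. j \<in> T \<Longrightarrow> p j \<in> T" "\<And>j. j \<in> T \<Longrightarrow> ty (f j) (p j + j)" by metis
  have fB: "f j \<in> B" if "j \<in> T" for j using f[OF that] by (auto simp: C_def)
  have inC: "f j = f i" if "j \<in> T" "i \<in> T" "q \<in> T" "ty (f j) (q + i)" for i j q
  proof -
    have "f j \<in> C i" using that fB[OF that(1)] by (auto simp: C_def)
    then show ?thesis using f[OF that(2)] by simp
  qed
  \<comment> \<open>The type j + p j of f j is symmetric in j and p j, so f j is also the candidate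
    for p j.\<close>
  have invol: "p (p j) = j" if j: "j \<in> T" for j
  proof -
    have tj: "ty (f j) (j + p j)" using p(2)[OF j] by (simp add: add.commute)
    then have "f j = f (p j)" using inC[OF j p(1)[OF j] j] by blast
    then have "p (p j) + p j = j + p j" using ty_unique[OF _ tj] p(2)[OF p(1)[OF j]] by simp
    then show ?thesis by simp
  qed
  have "\<exists>j\<in>T. p j = j"
  proof (rule ccontr)
    assume no: "\<not> ?thesis"
    obtain a where a: "a \<in> T" using other by blast
    obtain c where c: "c \<in> T" "c \<noteq> a" "c \<noteq> p a" using other[of a "p a"] by metis
    have pc: "p c \<noteq> a" "p c \<noteq> p a" "p c \<noteq> c" "p a \<noteq> a" using a c invol no by metis+
    have "card (T - {a, p a, c, p c}) = 1" using a c pc p(1) card_T by (subst card_Diff_subset) auto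
    then obtain e where e: "T - {a, p a, c, p c} = {e}" by (rule card_1_singletonE)
    then have eT: "e \<in> T" "e \<notin> {a, p a, c, p c}" by blast+
    have "p e \<in> {a, p a, c, p c, e}" using e p(1)[OF eT(1)] by blast
    then show False using eT a c invol no by (metis insertE singletonD insertCI)
  qed
  then obtain j where j: "j \<in> T" "p j = j" by blast
  have t0: "ty (f j) 0" using p(2)[OF j(1)] j(2) by simp
  have "f j = f i" if "i \<in> T" for i using inC[OF j(1) that that] t0 by simp
  then show ?thesis using that[of "f j"] t0 f by simp
qed

text \<open>A vertex of type 0 or p + q lies in some \<open>C j\<close>, hence is c. All others have
  a type in T, and two such types never add up to an element of T, as the ends of an edge
  must.\<close>

lemma is_star: "\<exists>c. \<forall>x y. edge B x y \<longrightarrow> x = c \<or> y = c"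
proof -
  obtain c where c: "ty c 0" "\<And>j. j \<in> T \<Longrightarrow> C j = {c}" using ex_centre by blast
  have T: "\<exists>t\<in>T. ty b t" if b: "b \<in> B" "b \<noteq> c" for b
  proof -
    obtain k where k: "ty b k" using ty_ex by blast
    have notin: "b \<notin> C j" if "j \<in> T" for j using c(2)[OF that] b(2) by blast
    have "k \<in> K" using k by (simp add: ty_def)
    then show ?thesis
    proof (cases rule: K_cases)
      case 1
      obtain t where "t \<in> T" using other by blast
      moreover have "k = t + t" using 1 by simp
      ultimately show ?thesis using notin[of t] b(1) k by (auto simp: C_def)
    next
      case (3 p q)
      then show ?thesis using notin[of q] b(1) k by (auto simp: C_def)
    qed (use k in blast)
  qed
  have "x = c \<or> y = c" if e: "edge B x y" for x y
  proof (rule ccontr)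
    assume "\<not> ?thesis"
    then obtain t t' where "t \<in> T" "t' \<in> T" "ty x t" "ty y t'" using T edgeD[OF e] by blast
    then show False using ty_edge[OF e] T_sum_free by blast
  qed
  then show ?thesis by blast
qed

end

section \<open>Stars and maximal sum-free sets\<close>

lemma UNIV_bit: "(UNIV :: bit set) = {0, 1}"
  by (auto intro: bit.exhaust)

instance bit :: finite
  by standard (simp add: UNIV_bit)

context edge_cover
begin

lemma no_five_cycle:
  assumes nonstar: "\<And>c. \<exists>x y. edge B x y \<and> x \<noteq> c \<and> y \<noteq> c"
    and r: "CARD('a) = 2 ^ r" and five: "0 \<in> nfold U 5"
  shows False
proof -
  have b: "3 * card B \<le> CARD('a) + 7" using edge_dichotomy[OF nonstar] by blast
  then have "60 < CARD('a)" using size by linarith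
  \<comment> \<open>Order 64 survives the inequality and falls only to rounding: 36 * 23 = 828 is
    less than 11 * 64 + 144 = 848. Order at least 128 makes M divisible by 8.\<close>
  moreover have "CARD('a) \<noteq> 64"
  proof
    assume eq: "CARD('a) = 64"
    then have "card B \<le> 23" using b by linarith
    then show False using size eq by linarith
  qed
  ultimately have "(2::nat) ^ 5 < 2 ^ r" "r \<noteq> 6" unfolding r by auto
  then have "7 \<le> r" using power_less_imp_less_exp[of "2::nat" 5 r] by linarith
  then obtain k where k: "r = 7 + k" using le_Suc_ex by blast
  obtain a b c d e where U: "a \<in> U" "b \<in> U" "c \<in> U" "d \<in> U" "e \<in> U"
    and sum0: "a + (b + (c + (d + e))) = 0"
    using five by (auto simp: eval_nat_numeral set_plus_def)
  \<comment> \<open>Equal terms would cancel and leave x + y = z among the edge sums.\<close>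
  have ne: "v \<noteq> w" if "v \<in> U" "w \<in> U" "x \<in> U" "y \<in> U" "z \<in> U" "v + (w + (x + (y + z))) = 0" for v w x y z
  proof
    assume "v = w"
    then have "x + y = z" using that(6) by simp
    then show False using sum_free_U that by blast
  qed
  have dist: "a \<noteq> b" "a \<noteq> c" "a \<noteq> d" "a \<noteq> e" "b \<noteq> c" "b \<noteq> d" "b \<noteq> e" "c \<noteq> d" "c \<noteq> e" "d \<noteq> e"
    by (rule ne[OF U(1) U(2) U(3) U(4) U(5)], use sum0 in \<open>simp only: ac_simps\<close>,
      rule ne[OF U(1) U(3) U(2) U(4) U(5)], use sum0 in \<open>simp only: ac_simps\<close>,
      rule ne[OF U(1) U(4) U(2) U(3) U(5)], use sum0 in \<open>simp only: ac_simps\<close>,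
      rule ne[OF U(1) U(5) U(2) U(3) U(4)], use sum0 in \<open>simp only: ac_simps\<close>,
      rule ne[OF U(2) U(3) U(1) U(4) U(5)], use sum0 in \<open>simp only: ac_simps\<close>,
      rule ne[OF U(2) U(4) U(1) U(3) U(5)], use sum0 in \<open>simp only: ac_simps\<close>,
      rule ne[OF U(2) U(5) U(1) U(3) U(4)], use sum0 in \<open>simp only: ac_simps\<close>,
      rule ne[OF U(3) U(4) U(1) U(2) U(5)], use sum0 in \<open>simp only: ac_simps\<close>,
      rule ne[OF U(3) U(5) U(1) U(2) U(4)], use sum0 in \<open>simp only: ac_simps\<close>,
      rule ne[OF U(4) U(5) U(1) U(2) U(3)], use sum0 in \<open>simp only: ac_simps\<close>)
  interpret five_cycle B z0 "{a, b, c, d, e}" "8 * 2 ^ k"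
  proof
    show "card {a, b, c, d, e} = 5" using dist by simp
    have "\<Sum>{a, b, c, d, e} = a + (b + (c + (d + e)))" using dist by simp
    then show "\<Sum>{a, b, c, d, e} = 0" using sum0 by simp
    show sub: "{a, b, c, d, e} \<subseteq> U" using U by blast
    show "x + y \<notin> {a, b, c, d, e}" if "x \<in> {a, b, c, d, e}" "y \<in> {a, b, c, d, e}" for x y
      using sum_free_U[OF subsetD[OF sub that(1)] subsetD[OF sub that(2)]] sub by blast
    show "0 \<notin> {a, b, c, d, e}" using sub edge_sums_nonzero by blast
    show "CARD('a) = 16 * (8 * 2 ^ k)" by (simp add: r k power_add)
  qed simp_all
  show False using is_star nonstar by metis
qed

lemma ex_star:
  assumes r: "CARD('a) = 2 ^ r"
  shows "\<exists>c. \<forall>x y. edge B x y \<longrightarrow> x = c \<or> y = c"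
proof (rule ccontr)
  assume "\<not> ?thesis"
  then have nonstar: "\<exists>x y. edge B x y \<and> x \<noteq> c \<and> y \<noteq> c" for c by blast
  have nz: "0 \<notin> U" using edge_sums_nonzero by blast
  have nz3: "0 \<notin> nfold U 3"
  proof
    assume "0 \<in> nfold U 3"
    then obtain a b c where "a \<in> U" "b \<in> U" "c \<in> U" "a + (b + c) = 0"
      by (auto simp: eval_nat_numeral set_plus_def)
    moreover from this have "b + c = a" by simp
    ultimately show False using sum_free_U by blast
  qed
  \<comment> \<open>The two ends of each edge sum together exhaust B, except possibly for
    z0.\<close>
  have "CARD('a) < 8 * card U"
  proof -
    have "B - {z0} \<subseteq> (\<Union>u\<in>U. B \<inter> tr u B)"
    proof
      fix x assume "x \<in> B - {z0}"
      then obtain y where e: "edge B x y" using covered by blast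
      then have "x \<in> B \<inter> tr (x + y) B" using edge_Int[OF e] by blast
      then show "x \<in> (\<Union>u\<in>U. B \<inter> tr u B)" using edge_sums_I[OF e] by blast
    qed
    then have "card (B - {z0}) \<le> card (\<Union>u\<in>U. B \<inter> tr u B)" by (intro card_mono) auto
    also have "\<dots> \<le> (\<Sum>u\<in>U. card (B \<inter> tr u B))" by (rule card_UN_le) simp
    also have "\<dots> = 2 * card U" by (simp add: card_edge_sums_Int)
    finally have "card (B - {z0}) \<le> 2 * card U" .
    moreover have "card B \<le> card (B - {z0}) + 1" using diff_card_le_card_Diff[of "{z0}" B] by simp
    ultimately show ?thesis using size by linarith
  qed
  from odd_relation_cases[OF nz nz3 this] show False
    using no_five_cycle[OF nonstar r] no_hyperplane[OF nonstar] by metis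
qed

end

section \<open>From minimality to edges, and from stars to sum-free sets\<close>

lemma saturating_iff:
  fixes A :: "'a::char2 set"
  assumes "A \<noteq> {}"
  shows "A \<union> (A + A) = UNIV \<longleftrightarrow> insert 0 A + insert 0 A = UNIV"
proof -
  obtain a where a: "a \<in> A" using assms by blast
  have "0 \<in> A + A" using set_plus_intro[OF a a] by simp
  moreover have "insert 0 A + insert 0 A = insert 0 (A \<union> (A + A))" by (force simp: set_plus_def)
  ultimately show ?thesis by (simp add: insert_absorb)
qed

text \<open>Removing a leaves some g uncovered. Every representation of g uses a, so g = a + y is
  unique.\<close>

lemma minimal_saturating_edge:
  fixes A :: "'a::{char2,finite} set"
  assumes A: "minimal_one_saturating A" and card: "2 \<le> card A" and a: "a \<in> A"
  shows "\<exists>y. edge (insert 0 A) a y"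
proof -
  let ?A = "A - {a}"
  have sat: "A \<subseteq> UNIV - {0}" "A \<union> (A + A) = UNIV"
    using A by (auto simp: minimal_one_saturating_def one_saturating_def)
  have "?A \<noteq> {}"
  proof
    assume "?A = {}"
    then have "card A \<le> card {a}" by (intro card_mono) auto
    then show False using card by simp
  qed
  have "\<not> one_saturating ?A" using A a by (auto simp: minimal_one_saturating_def)
  then have "insert 0 ?A + insert 0 ?A \<noteq> UNIV"
    using sat(1) saturating_iff[OF \<open>?A \<noteq> {}\<close>] by (auto simp: one_saturating_def)
  then obtain g where g: "g \<notin> insert 0 ?A + insert 0 ?A" by blast
  have rep: "x = a \<or> y = a" if "x \<in> insert 0 A" "y \<in> insert 0 A" "x + y = g" for x y
    using g set_plus_intro[of x "insert 0 ?A" y "insert 0 ?A"] that by auto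
  have "A \<noteq> {}" using a by blast
  then have "g \<in> insert 0 A + insert 0 A" using saturating_iff[of A] sat(2) by simp
  then obtain x y where xy: "x \<in> insert 0 A" "y \<in> insert 0 A" "g = x + y" by (rule set_plus_elim)
  then have "x = a \<or> y = a" by (intro rep) auto
  then obtain y where y: "y \<in> insert 0 A" "g = a + y"
  proof
    assume "x = a"
    then show ?thesis using that[OF xy(2)] xy(3) by blast
  next
    assume "y = a"
    then show ?thesis using that[OF xy(1)] xy(3) by (simp add: add.commute)
  qed
  have "g \<noteq> 0" using g set_plus_intro[of 0 "insert 0 ?A" 0 "insert 0 ?A"] by auto
  then have "a \<noteq> y" using y(2) by auto
  moreover have "z = a \<or> z = y" if "z \<in> insert 0 A" "a + y + z \<in> insert 0 A" for z
  proof -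
    have "z = a \<or> a + y + z = a" using rep[OF that] y(2) by (simp add: ac_simps)
    then show ?thesis by (auto simp: add.assoc)
  qed
  ultimately have "edge (insert 0 A) a y" using a y(1) by (auto simp: edge_def)
  then show ?thesis ..
qed

lemma elt_plus_eq_tr: "s +o X = tr s (X :: 'a::char2 set)"
  unfolding elt_set_plus_def tr_eq_image by (auto simp: add.commute[of s])

text \<open>All elements of B other than c, 0 included, are joined to c. Uniqueness of the sums x +
  c says that the translate of B by c, without 0, is sum-free. It is maximal because any further t
  is x + y = (x + c) + (y + c) with x and y in B.\<close>

lemma star_imp_sum_free:
  fixes A :: "'a::{char2,finite} set"
  defines "B \<equiv> insert 0 A"
  assumes A: "0 \<notin> A" "B + B = UNIV" and card: "2 \<le> card A"
    and edges: "\<And>a. a \<in> A \<Longrightarrow> \<exists>y. edge B a y"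
    and star: "\<And>x y. edge B x y \<Longrightarrow> x = c \<or> y = c"
  shows "\<exists>S s. maximal_sum_free S \<and> s \<in> S \<union> {0} \<and> A = (s +o (S \<union> {0})) - {0}"
proof -
  have "\<not> A \<subseteq> {c}" using card card_mono[of "{c}" A] by auto
  have A_edge: "edge B x c" if "x \<in> A" "x \<noteq> c" for x
    using edges[OF that(1)] star that(2) by blast
  have cB: "c \<in> B" using A_edge \<open>\<not> A \<subseteq> {c}\<close> edgeD(2) by blast
  have all: "edge B x c" if x: "x \<in> B" "x \<noteq> c" for x
  proof (cases "x = 0")
    case True
    have "z = 0 \<or> z = c" if z: "z \<in> B" "c + z \<in> B" for z
    proof (rule ccontr)
      assume neg: "\<not> ?thesis"
      then have "edge B z c" using A_edge z(1) by (auto simp: B_def)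
      moreover have "z + c = (c + z) + 0" "0 \<in> B" by (simp_all add: add.commute B_def)
      ultimately have "z = c + z \<or> z = 0" using edge_same_sum[of B z c "c + z" 0] z(2) by blast
      then show False using neg \<open>x = 0\<close> x(2) by (auto simp: add_eq_iff)
    qed
    then show ?thesis using True x cB by (auto simp: edge_def)
  next
    case False
    then show ?thesis using A_edge x by (auto simp: B_def)
  qed
  define S where "S = tr c B - {0}"
  have S0: "S \<union> {0} = tr c B" using cB by (auto simp: S_def)
  have "x + y \<notin> S" if "x \<in> S" "y \<in> S" for x y
  proof
    assume "x + y \<in> S"
    then have "edge B (x + y + c) c" by (intro all) (auto simp: S_def)
    moreover have "x + y + c + c = (x + c) + (y + c)" by (simp add: ac_simps)
    ultimately have "c = y + c \<or> c = x + c"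
      using edge_same_sum[of B "x + y + c" c "x + c" "y + c"] that by (auto simp: S_def)
    then show False using that by (auto simp: S_def)
  qed
  then have "sum_free S" by (auto simp: sum_free_def set_plus_def)
  moreover have "\<not> sum_free R" if R: "S \<subset> R" for R
  proof
    assume sf: "sum_free R"
    have no: "x + y \<notin> R" if "x \<in> R" "y \<in> R" for x y
      using sf set_plus_intro[OF that] by (auto simp: sum_free_def)
    obtain t where t: "t \<in> R" "t \<notin> S" using R by blast
    have "t \<noteq> 0" using no[OF t(1) t(1)] t(1) by auto
    obtain x y where xy: "x \<in> B" "y \<in> B" "t = x + y" using A(2) by (metis UNIV_I set_plus_elim)
    have t': "t = (x + c) + (y + c)" using xy(3) by (simp add: ac_simps)
    have "x + c \<in> S \<union> {0}" "y + c \<in> S \<union> {0}" unfolding S0 using xy by (simp_all add: add.assoc)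
    then show False using t' \<open>t \<noteq> 0\<close> t no[of "x + c" "y + c"] R by auto
  qed
  ultimately have "maximal_sum_free S" by (auto simp: maximal_sum_free_def)
  moreover have "c \<in> S \<union> {0}" unfolding S0 by (simp add: B_def)
  moreover have "tr c (tr c B) - {0} = A" using A(1) by (auto simp: B_def add.assoc)
  ultimately show ?thesis unfolding elt_plus_eq_tr using S0 by metis
qed

text \<open>For nonzero g outside S, adjoining g creates a relation. As g + g = 0 and S is sum-free,
  this relation can be solved for g as a sum of two elements of S.\<close>

lemma maximal_sum_free_cover:
  fixes S :: "'a::char2 set"
  assumes S: "maximal_sum_free S" and ne: "S \<noteq> {}"
  shows "insert 0 S + insert 0 S = UNIV"
proof -
  have sf: "x + y \<notin> S" if "x \<in> S" "y \<in> S" for x y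
    using S set_plus_intro[OF that] by (auto simp: maximal_sum_free_def sum_free_def)
  have z: "0 \<notin> S" using sf[of 0 0] by auto
  have "g \<in> S \<union> (S + S)" for g
  proof (cases "g \<in> S \<or> g = 0")
    case True
    obtain x where "x \<in> S" using ne by blast
    then have "0 \<in> S + S" using set_plus_intro[of x S x S] by simp
    then show ?thesis using True by blast
  next
    case False
    then have "\<not> sum_free (insert g S)" using S by (auto simp: maximal_sum_free_def)
    then obtain p where p: "p \<in> insert g S" "p \<in> insert g S + insert g S"
      unfolding sum_free_def by blast
    from p(2) obtain x y where "p = x + y" "x \<in> insert g S" "y \<in> insert g S" by (rule set_plus_elim)
    then have xy: "x \<in> insert g S" "y \<in> insert g S" "x + y \<in> insert g S" using p(1) by simp_all
    have "\<exists>p\<in>S. \<exists>q\<in>S. g = p + q"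
    proof (cases "x = g")
      case True
      then have "y \<noteq> g" using xy(3) z False by auto
      then have yS: "y \<in> S" using xy(2) by blast
      then have "g + y \<in> S" using xy(3) True z by auto
      moreover have "g = (g + y) + y" by (simp add: add.assoc)
      ultimately show ?thesis using yS by blast
    next
      case xg: False
      then have xS: "x \<in> S" using xy(1) by blast
      show ?thesis
      proof (cases "y = g")
        case True
        then have "x + g \<in> S" using xy(3) xS z by auto
        moreover have "g = x + (x + g)" by simp
        ultimately show ?thesis using xS by blast
      next
        case False
        then have "y \<in> S" using xy(2) by blast
        then have "x + y = g" using xy(3) sf[OF xS] by blast
        then show ?thesis using xS \<open>y \<in> S\<close> by blast
      qed
    qed
    then show ?thesis by (auto simp: set_plus_def)
  qed
  then show ?thesis using saturating_iff[OF ne] by blast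
qed

text \<open>An element t of S is a sum over S with 0 only as 0 + t, hence over the translate by s
  only as s + (t + s). Each a in A occurs in such a pair, with t = a + s, or with any t in S if a =
  s, and so cannot be dropped.\<close>

lemma sum_free_imp_minimal:
  fixes S :: "'a::{char2,finite} set"
  assumes S: "maximal_sum_free S" and s: "s \<in> S \<union> {0}" and A: "A = (s +o (S \<union> {0})) - {0}" and ne: "A \<noteq> {}"
  shows "minimal_one_saturating A"
proof -
  have sf: "x + y \<notin> S" if "x \<in> S" "y \<in> S" for x y
    using S set_plus_intro[OF that] by (auto simp: maximal_sum_free_def sum_free_def)
  have neS: "S \<noteq> {}" using ne s unfolding A elt_plus_eq_tr by auto
  have B: "insert 0 A = tr s (insert 0 S)" using s unfolding A elt_plus_eq_tr by auto
  have "insert 0 A + insert 0 A = tr (s + s) (insert 0 S + insert 0 S)" unfolding B by (rule tr_set_plus)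
  also have "\<dots> = UNIV" unfolding maximal_sum_free_cover[OF S neS] by auto
  finally have "one_saturating A" using saturating_iff[OF ne] A by (auto simp: one_saturating_def)
  moreover have "\<not> one_saturating C" if C: "C \<subset> A" for C
  proof
    assume sat: "one_saturating C"
    then have "C \<noteq> {}" by (auto simp: one_saturating_def set_plus_def)
    then have cover: "insert 0 C + insert 0 C = UNIV"
      using sat saturating_iff by (auto simp: one_saturating_def)
    obtain a where a: "a \<in> A" "a \<notin> C" using C by blast
    have "a \<noteq> 0" using a(1) A by blast
    then have aC: "a \<notin> insert 0 C" using a(2) by blast
    have "a + s \<in> insert 0 S" using a(1) B by auto
    then obtain t where t: "t \<in> S" "a = s \<or> t = a + s" using neS by fastforce
    obtain x y where xy: "x \<in> insert 0 C" "y \<in> insert 0 C" "t = x + y"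
      using cover by (metis UNIV_I set_plus_elim)
    have R: "x + s \<in> insert 0 S" "y + s \<in> insert 0 S"
      unfolding mem_tr[symmetric] B[symmetric] using xy C by blast+
    have "t = (x + s) + (y + s)" using xy(3) by (simp add: ac_simps)
    then have "x + s = 0 \<or> y + s = 0" using sf[of "x + s" "y + s"] t(1) R by auto
    then have "x = s \<and> y = t + s \<or> y = s \<and> x = t + s" using xy(3) by (auto simp: ac_simps)
    then have "x = a \<or> y = a" using t(2) by (auto simp: add.assoc)
    then show False using xy(1,2) aC by blast
  qed
  ultimately show ?thesis by (auto simp: minimal_one_saturating_def)
qed

theorem theorem1p1:
  fixes A :: "(bit ^ 'r) set"
  assumes "A \<subseteq> UNIV - {0}"
    and "real (card A) > 11 / 36 * 2 ^ CARD('r) + 3"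
  shows "minimal_one_saturating A \<longleftrightarrow>
    (\<exists>S :: (bit ^ 'r) set. \<exists>s. maximal_sum_free S \<and> s \<in> S \<union> {0} \<and> A = (s +o (S \<union> {0})) - {0})"
proof
  have card_G: "CARD(bit ^ 'r) = 2 ^ CARD('r)" by (simp add: UNIV_bit numeral_2_eq_2)
  have "real (36 * card A) > real (11 * 2 ^ CARD('r) + 108)" using assms(2) by simp
  then have size: "36 * card A > 11 * CARD(bit ^ 'r) + 108" unfolding of_nat_less_iff card_G .
  have A0: "0 \<notin> A" using assms(1) by blast
  {
    assume min: "minimal_one_saturating A"
    have "2 \<le> card A" using size by linarith
    note edges = minimal_saturating_edge[OF min this]
    interpret edge_cover "insert 0 A" 0
    proof
      show "11 * CARD(bit ^ 'r) + 144 < 36 * card (insert 0 A)" using size A0 by simp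
      show "\<exists>y. edge (insert 0 A) x y" if "x \<in> insert 0 A" "x \<noteq> 0" for x using edges that by blast
    qed
    obtain c where "\<And>x y. edge (insert 0 A) x y \<Longrightarrow> x = c \<or> y = c" using ex_star[OF card_G] by blast
    moreover have "insert 0 A + insert 0 A = UNIV"
    proof -
      have "A \<noteq> {}" using \<open>2 \<le> card A\<close> by auto
      moreover have "A \<union> (A + A) = UNIV"
        using min by (simp add: minimal_one_saturating_def one_saturating_def)
      ultimately show ?thesis using saturating_iff by blast
    qed
    ultimately show "\<exists>S :: (bit ^ 'r) set. \<exists>s. maximal_sum_free S \<and> s \<in> S \<union> {0} \<and> A = (s +o (S \<union> {0})) - {0}"
      by (intro star_imp_sum_free A0 \<open>2 \<le> card A\<close> edges) blast+
  next
    assume "\<exists>S :: (bit ^ 'r) set. \<exists>s. maximal_sum_free S \<and> s \<in> S \<union> {0} \<and> A = (s +o (S \<union> {0})) - {0}"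
    then obtain S :: "(bit ^ 'r) set" and s
      where S: "maximal_sum_free S" "s \<in> S \<union> {0}" "A = (s +o (S \<union> {0})) - {0}" by blast
    have "A \<noteq> {}" using size by auto
    then show "minimal_one_saturating A" by (rule sum_free_imp_minimal[OF S])
  }
qed

end
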